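(* Assume Proposition 1: all non-trivial zeros of $\mathcal{U}(s)$ lie on $\Re(s)=3/4$, and all non-trivial poles of $\mathcal{U}(s)$ lie on $\Re(s)=1/4$. Then $$\Re\,\frac{\partial}{\partial s}\log\mathcal{U}(s)<0$$ for all $s=\sigma+it$ with $\tfrac14\le\sigma\le\tfrac34$ and $t>4.08046$.
   Context: $\xi_1(s)=\pi^{-s/2}\Gamma(s/2)\zeta(s)$, where $\zeta$ is the Riemann zeta function. $\mathcal{U}(s)=\xi_1(2s-1)/\xi_1(2s)$. Its non-trivial zeros are $s=(\rho+1)/2$ and its non-trivial poles are $s=\rho/2$, where $\rho$ ranges over the non-trivial zeros of $\zeta$. Proposition 1 is therefore equivalent to the Riemann hypothesis.
   Formalization: The zeros and poles of U(s) on the boundary lines Re(s)=3/4 and Re(s)=1/4, where the logarithmic derivative is undefined, are excluded by assuming ξ₁(2s−1)≠0 and ξ₁(2s)≠0. *)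

theory Defs
  imports "HOL-Complex_Analysis.Complex_Analysis"
begin

text \<open>Riemann zeta function: the analytic continuation to the punctured plane of the
Dirichlet series sum over n of n to the power -s (Re s > 1). By the identity theorem such a
continuation is unique on C minus 1; its value at the pole s = 1 is left unspecified.\<close>
definition riemann_zeta :: "complex \<Rightarrow> complex" where
  "riemann_zeta = (SOME f. f holomorphic_on (- {1}) \<and>
      (\<forall>s. 1 < Re s \<longrightarrow> f s = (\<Sum>n. 1 / (of_nat (Suc n)) powr s)))"

definition xi1 :: "complex \<Rightarrow> complex" where
  "xi1 s = (of_real pi) powr (- s / 2) * Gamma (s / 2) * riemann_zeta s"

definition U :: "complex \<Rightarrow> complex" where
  "U s = xi1 (2 * s - 1) / xi1 (2 * s)"

end

theory Submission
  imports Defs "HOL-Probability.Probability"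
begin

text \<open>
  Write \<open>xi1 s = Xi ((s - 1/2)\<^sup>2) / (s (s - 1))\<close>. The theta transformation exhibits \<open>Xi\<close> as an entire
  function of order at most 3/4, so by Borel--Caratheodory its logarithmic derivative is the limit of
  the sums of \<open>1 / (v - v\<^sub>n)\<close> over its zeros, and under the hypothesis every zero is \<open>- \<gamma>\<^sup>2\<close> with \<open>\<gamma>\<close> real.
  With \<open>w = 2 s\<close> and \<open>y = Im w\<close>, each zero then contributes to \<open>- Re (U' / U) / 2\<close> at least
  \<open>1 / (1 + (y - \<gamma>)\<^sup>2) + 1 / (1 + (y + \<gamma>)\<^sup>2)\<close>, while the poles of \<open>xi1\<close> at 0 and 1 cost at most
  \<open>2 / (1 + y\<^sup>2)\<close>. A single zero with \<open>\<gamma>\<^sup>2 < 3 y\<^sup>2 - 1\<close> already outweighs the poles. If there is none, all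
  zeros together do: the sum of \<open>2 / \<gamma>\<^sup>2\<close> is at least \<open>ln (pi / 3)\<close>, because the values of \<open>Xi\<close> at 1/4 and
  9/4 (that is, of the completed zeta function at 1 and 2) are 1 and \<open>pi / 3\<close>. So no numerical
  information on the zeros is needed.
\<close>

section \<open>The theta functional equation\<close>

text \<open>Passing from \<open>s\<close> to \<open>v = (s - 1/2)^2\<close> halves the order of
  growth. Order below 1 is what makes the logarithmic derivative a plain sum over the zeros, without
  convergence factors. No infinite product is formed: for each \<open>R\<close> the zeros in the
  disc of radius \<open>R\<close> are divided out, which leaves an error of size
  \<open>R powr (-1/4)\<close>. Two obstacles precede this. \<open>riemann_zeta\<close> is a choice
  by \<open>SOME\<close>, so nothing is known of it until a continuation is exhibited; the theta
  transform supplies one. And the hypothesis speaks only of zeros with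
  \<open>0 < Re \<rho> < 1\<close>, so zeros with \<open>Re \<rho> >= 1\<close> have to be excluded,
  by the Euler product and, on the boundary line, by the 3-4-1 inequality. The contribution of a
  zero is free of \<open>Re s\<close> because \<open>U\<close> evaluates \<open>Xi\<close> at the
  squares of \<open>2 s - 1/2\<close> and \<open>3/2 - 2 s\<close>, whose real parts are nonnegative
  with sum 1 and whose imaginary parts are opposite.\<close>

lemma gaussian_fourier:
  fixes t b :: real
  assumes t: "t > 0"
  shows "has_bochner_integral lborel (\<lambda>x. exp (of_real (- pi * t * x\<^sup>2) + 2 * of_real pi * \<i> * of_real (b * x)))
           (complex_of_real (exp (- pi * b\<^sup>2 / t) / sqrt t))"
proof -
  \<comment> \<open>With this scale \<open>(k * x)^2 / 2 = pi * t * x^2\<close>, so the integrand is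
    a standard normal density in \<open>k * x\<close> and the integral is its characteristic
    function at \<open>c\<close>.\<close>
  define k where "k = sqrt (2 * pi * t)"
  define c where "c = 2 * pi * b / k"
  have k: "k > 0" "k\<^sup>2 = 2 * pi * t" using t by (auto simp: k_def)
  let ?f = "\<lambda>x. std_normal_density x *\<^sub>R iexp (c * x)"
  have int: "integrable lborel ?f"
    by (rule Bochner_Integration.integrable_bound[OF integrable_normal_density[of 1 0]])
      (auto intro!: AE_I2)
  have "integral\<^sup>L lborel ?f = char std_normal_distribution c"
    unfolding char_def by (subst integral_density) auto
  also have "\<dots> = of_real (exp (- (c\<^sup>2) / 2))" by (simp add: char_std_normal_distribution)
  also have "- (c\<^sup>2) / 2 = - pi * b\<^sup>2 / t"
    using k t by (simp add: c_def power_divide power_mult_distrib) (simp add: field_simps power2_eq_square)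
  finally have "has_bochner_integral lborel ?f (of_real (exp (- pi * b\<^sup>2 / t)))"
    using int by (simp add: has_bochner_integral_iff)
  then have "has_bochner_integral lborel (\<lambda>x. ?f (0 + k * x)) (of_real (exp (- pi * b\<^sup>2 / t)) /\<^sub>R \<bar>k\<bar>)"
    using k by (subst (asm) lborel_has_bochner_integral_real_affine_iff[of k _ _ 0]) auto
  then have "has_bochner_integral lborel (\<lambda>x. of_real (sqrt (2 * pi)) * ?f (0 + k * x))
      (of_real (sqrt (2 * pi)) * (of_real (exp (- pi * b\<^sup>2 / t)) /\<^sub>R \<bar>k\<bar>))"
    by (rule has_bochner_integral_mult_right)
  also have "(\<lambda>x. of_real (sqrt (2 * pi)) * ?f (0 + k * x)) =
     (\<lambda>x. exp (of_real (- pi * t * x\<^sup>2) + 2 * of_real pi * \<i> * of_real (b * x)))"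
  proof
    fix x
    have e1: "- (k * x)\<^sup>2 / 2 = - pi * t * x\<^sup>2" using k by (simp add: power_mult_distrib)
    have e2: "c * (k * x) = 2 * pi * (b * x)" using k by (simp add: c_def)
    have "?f (0 + k * x) = ((1 / sqrt (2 * pi)) * exp (- pi * t * x\<^sup>2)) *\<^sub>R iexp (2 * pi * (b * x))"
      unfolding std_normal_density_def add_0 e1 e2 ..
    then have "of_real (sqrt (2 * pi)) * ?f (0 + k * x)
       = of_real (exp (- pi * t * x\<^sup>2)) * iexp (2 * pi * (b * x))"
      by (simp add: scaleR_conv_of_real)
    also have "\<dots> = exp (of_real (- pi * t * x\<^sup>2)) * exp (2 * of_real pi * \<i> * of_real (b * x))"
      unfolding exp_of_real by (simp add: mult_ac)
    finally show "of_real (sqrt (2 * pi)) * ?f (0 + k * x) =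
      exp (of_real (- pi * t * x\<^sup>2) + 2 * of_real pi * \<i> * of_real (b * x))"
      unfolding exp_add .
  qed
  also have "of_real (sqrt (2 * pi)) * (of_real (exp (- pi * b\<^sup>2 / t)) /\<^sub>R \<bar>k\<bar>)
     = complex_of_real (exp (- pi * b\<^sup>2 / t) / sqrt t)"
    using t k(1) by (simp add: k_def real_sqrt_mult scaleR_conv_of_real field_simps)
  finally show ?thesis .
qed

lemma summable_exp_gaussian:
  fixes t :: real
  assumes "t > 0"
  shows "summable (\<lambda>n. exp (- pi * (real (n + m))\<^sup>2 * t))"
proof (rule summable_comparison_test[OF _ summable_geometric[of "exp (- pi * t)"]])
  show "\<exists>N. \<forall>n\<ge>N. norm (exp (- pi * (real (n + m))\<^sup>2 * t)) \<le> exp (- pi * t) ^ n"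
  proof (intro exI[of _ 0] allI impI)
    fix n :: nat
    have "real n \<le> (real (n + m))\<^sup>2"
      by (metis le_add1 of_nat_le_iff of_nat_power order_trans self_le_power zero_less_numeral le_square power2_eq_square)
    then have "pi * t * real n \<le> pi * t * (real (n + m))\<^sup>2" using assms by (intro mult_left_mono) auto
    then show "norm (exp (- pi * (real (n + m))\<^sup>2 * t)) \<le> exp (- pi * t) ^ n"
      by (simp add: exp_of_nat_mult[symmetric] mult_ac)
  qed
qed (use assms in auto)

text \<open>
  For \<open>e = -1\<close>, \<open>m = 1\<close> and for \<open>e = 1\<close>, \<open>m = 0\<close> the integrand is, up to sign, the kernel whose residues at the
  integers are the terms of the theta series, restricted to the line \<open>Im z = e\<close>.
\<close>
lemma horizontal_gaussian_geometric:
  fixes t e :: real and m :: nat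
  assumes t: "t > 0" and e: "e\<^sup>2 = 1"
  defines "z \<equiv> (\<lambda>x::real. of_real x + of_real e * \<i>)"
  defines "q \<equiv> (\<lambda>x. exp (2 * of_real pi * \<i> * of_real e * z x))"
  shows "has_bochner_integral lborel (\<lambda>x. exp (- of_real (pi * t) * (z x)\<^sup>2) * (q x ^ m / (1 - q x)))
           (of_real ((\<Sum>k. exp (- pi * (real (k + m))\<^sup>2 / t)) / sqrt t))"
proof -
  define T where "T = (\<lambda>(k::nat) x. exp (- of_real (pi * t) * (z x)\<^sup>2) * q x ^ (k + m))"
  \<comment> \<open>On the line \<open>Im z = e\<close> each term of the geometric expansion is a
    constant times a Gaussian of frequency \<open>e * (n - t)\<close>, with
    \<open>n = k + m\<close>. Its transform has exponent \<open>- pi * (n - t)^2 / t\<close>, of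
    which the constant \<open>pi * t - 2 * pi * n\<close> leaves exactly
    \<open>- pi * n^2 / t\<close>.\<close>
  have T_eq: "T k x = of_real (exp (pi * t - 2 * pi * real (k + m))) *
       exp (of_real (- pi * t * x\<^sup>2) + 2 * of_real pi * \<i> * of_real (e * (real (k + m) - t) * x))" for k x
  proof -
    define n where "n = real (k + m)"
    have "T k x = exp (- of_real (pi * t) * (z x)\<^sup>2 + of_real n * (2 * of_real pi * \<i> * of_real e * z x))"
      unfolding exp_add by (simp add: T_def q_def exp_of_nat_mult[symmetric] n_def)
    also have "- of_real (pi * t) * (z x)\<^sup>2 + of_real n * (2 * of_real pi * \<i> * of_real e * z x)
       = of_real (pi * t - 2 * pi * n) + (of_real (- pi * t * x\<^sup>2) + 2 * of_real pi * \<i> * of_real (e * (n - t) * x))"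
    proof -
      have e1: "of_real e * of_real e = (1::complex)"
        using e by (metis of_real_1 of_real_mult power2_eq_square)
      have z2: "(z x)\<^sup>2 = of_real x * of_real x - 1 + 2 * \<i> * of_real e * of_real x"
      proof -
        have "(z x)\<^sup>2 = of_real x * of_real x + (of_real e * of_real e) * (\<i> * \<i>) + 2 * \<i> * of_real e * of_real x"
          unfolding z_def power2_eq_square by (simp add: algebra_simps)
        then show ?thesis unfolding e1 by simp
      qed
      have "\<i> * of_real e * z x = \<i> * of_real e * of_real x - 1"
      proof -
        have "\<i> * of_real e * z x = \<i> * of_real e * of_real x + (of_real e * of_real e) * (\<i> * \<i>)"
          unfolding z_def by (simp add: algebra_simps)
        then show ?thesis unfolding e1 by simp
      qed
      then have z1: "2 * of_real pi * \<i> * of_real e * z x = 2 * of_real pi * (\<i> * of_real e * of_real x - 1)"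
        by (simp add: mult.assoc)
      show ?thesis unfolding z2 z1
        by (simp add: algebra_simps power2_eq_square)
    qed
    finally show ?thesis unfolding n_def exp_of_real[symmetric] exp_add[symmetric] .
  qed
  have intT: "has_bochner_integral lborel (T k) (of_real (exp (- pi * (real (k + m))\<^sup>2 / t) / sqrt t))" for k
  proof -
    define n where "n = real (k + m)"
    have "has_bochner_integral lborel (T k) (of_real (exp (pi * t - 2 * pi * n)) *
        complex_of_real (exp (- pi * (e * (n - t))\<^sup>2 / t) / sqrt t))"
      unfolding T_eq n_def by (intro has_bochner_integral_mult_right gaussian_fourier t)
    also have "of_real (exp (pi * t - 2 * pi * n)) * complex_of_real (exp (- pi * (e * (n - t))\<^sup>2 / t) / sqrt t)
      = of_real ((exp (pi * t - 2 * pi * n) * exp (- pi * (e * (n - t))\<^sup>2 / t)) / sqrt t)" by simp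
    also have "exp (pi * t - 2 * pi * n) * exp (- pi * (e * (n - t))\<^sup>2 / t) = exp (- pi * n\<^sup>2 / t)"
      unfolding exp_add[symmetric] power_mult_distrib e
      using t by (simp add: power2_eq_square field_simps)
    finally show ?thesis by (simp add: n_def)
  qed
  have nT: "norm (T k x) = exp (pi * t - 2 * pi * real (k + m)) * exp (- pi * t * x\<^sup>2)" for k x
    unfolding T_eq norm_mult by simp
  have geo: "summable (\<lambda>k. exp (pi * t - 2 * pi * real (k + m)))"
  proof -
    have "summable (\<lambda>k. exp (pi * t - 2 * pi * real m) * exp (- 2 * pi) ^ k)"
      by (intro summable_mult summable_geometric) auto
    then show ?thesis
      by (simp add: exp_of_nat_mult[symmetric] exp_add[symmetric] algebra_simps)
  qed
  have A1: "\<And>k. integrable lborel (T k)" using intT by (auto simp: has_bochner_integral_iff)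
  have A2: "summable (\<lambda>k. norm (T k x))" for x unfolding nT by (intro summable_mult2 geo)
  have A3: "summable (\<lambda>k. \<integral>x. norm (T k x) \<partial>lborel)"
    unfolding nT integral_mult_right_zero by (rule summable_mult2[OF geo])
  have S: "(\<Sum>k. T k x) = exp (- of_real (pi * t) * (z x)\<^sup>2) * (q x ^ m / (1 - q x))" for x
  proof -
    \<comment> \<open>The sign \<open>e\<close> in \<open>q\<close> matches the side of the real
      axis: \<open>e * Im (z x) = e^2 = 1\<close>, so \<open>q\<close> has modulus
      \<open>exp (- 2 * pi)\<close> on either line.\<close>
    have "norm (q x) < 1"
    proof -
      have "Re (2 * of_real pi * \<i> * of_real e * z x) = - 2 * pi * (e * e)"
        by (simp add: z_def)
      then have "norm (q x) = exp (- 2 * pi)" using e by (simp only: q_def norm_exp_eq_Re power2_eq_square mult_1_right)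
      then show ?thesis by simp
    qed
    then have "(\<lambda>k. exp (- of_real (pi * t) * (z x)\<^sup>2) * q x ^ m * q x ^ k) sums
      (exp (- of_real (pi * t) * (z x)\<^sup>2) * q x ^ m * (1 / (1 - q x)))"
      by (intro sums_mult geometric_sums)
    then show ?thesis by (intro sums_unique[symmetric]) (simp add: T_def power_add mult_ac)
  qed
  have "(\<lambda>k. complex_of_real (exp (- pi * (real (k + m))\<^sup>2 / t) / sqrt t)) sums integral\<^sup>L lborel (\<lambda>x. \<Sum>k. T k x)"
    using sums_integral[of lborel T, OF A1 AE_I2[OF A2] A3] intT by (simp add: has_bochner_integral_iff)
  moreover have "(\<lambda>k. complex_of_real (exp (- pi * (real (k + m))\<^sup>2 / t) / sqrt t)) sums
      of_real ((\<Sum>k. exp (- pi * (real (k + m))\<^sup>2 / t)) / sqrt t)"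
    using summable_exp_gaussian[of "1/t" m] t
    by (intro sums_of_real sums_divide summable_sums) auto
  ultimately have "integral\<^sup>L lborel (\<lambda>x. \<Sum>k. T k x) = of_real ((\<Sum>k. exp (- pi * (real (k + m))\<^sup>2 / t)) / sqrt t)"
    using sums_unique2 by blast
  moreover have "integrable lborel (\<lambda>x. \<Sum>k. T k x)"
    by (rule integrable_suminf[OF A1 AE_I2[OF A2] A3])
  ultimately show ?thesis unfolding S by (simp add: has_bochner_integral_iff)
qed

section \<open>Residues of the theta kernel in growing rectangles\<close>

lemma contour_integral_linepath_same_Im:
  assumes "a < b"
  shows "contour_integral (linepath (Complex a c) (Complex b c)) f = integral {a..b} (\<lambda>x. f (Complex x c))"
proof -
  define g where "g = (\<lambda>w. f (w + \<i> * of_real c))"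
  have eq: "linepath (Complex a c) (Complex b c) x = linepath (of_real a) (of_real b) x + \<i> * of_real c" for x
    by (simp add: linepath_def Complex_eq scaleR_conv_of_real algebra_simps)
  have "contour_integral (linepath (Complex a c) (Complex b c)) f
      = contour_integral (linepath (of_real a) (of_real b)) g"
    unfolding contour_integral_integral g_def eq vector_derivative_linepath_at
    by (simp add: Complex_eq)
  also have "\<dots> = integral {a..b} (\<lambda>x. g (of_real x))"
    by (subst contour_integral_linepath_Reals_eq) (use assms in auto)
  finally show ?thesis by (simp add: g_def Complex_eq)
qed

lemma exp_2_pi_i_eq_1_iff: "exp (2 * of_real pi * \<i> * z) = 1 \<longleftrightarrow> z \<in> \<int>"
proof -
  have "exp (2 * of_real pi * \<i> * z) = 1 \<longleftrightarrow> (Im z = 0 \<and> (\<exists>n::int. 2 * pi * Re z = of_int (2 * n) * pi))"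
    unfolding exp_eq_1 by simp
  also have "\<dots> \<longleftrightarrow> (Im z = 0 \<and> (\<exists>n::int. Re z = of_int n))"
  proof -
    have "2 * pi * Re z = of_int (2 * n) * pi \<longleftrightarrow> Re z = of_int n" for n
      by (simp add: field_simps)
    then show ?thesis by simp
  qed
  also have "\<dots> \<longleftrightarrow> z \<in> \<int>"
    by (auto simp: Ints_def image_iff complex_eq_iff)
  finally show ?thesis .
qed

definition theta_kernel :: "real \<Rightarrow> complex \<Rightarrow> complex" where
  "theta_kernel t z = exp (- of_real (pi * t) * z\<^sup>2) / (exp (2 * of_real pi * \<i> * z) - 1)"

lemma theta_kernel_holomorphic: "theta_kernel t holomorphic_on - \<int>"
  unfolding theta_kernel_def[abs_def] using exp_2_pi_i_eq_1_iff
  by (intro holomorphic_intros) auto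

lemma residue_theta_kernel:
  "residue (theta_kernel t) (of_int n) = of_real (exp (- pi * (real_of_int n)\<^sup>2 * t)) / (2 * of_real pi * \<i>)"
proof -
  have "residue (\<lambda>w. exp (- of_real (pi * t) * w\<^sup>2) / (exp (2 * of_real pi * \<i> * w) - 1)) (of_int n)
      = exp (- of_real (pi * t) * (of_int n)\<^sup>2) / (2 * of_real pi * \<i>)"
  proof (rule residue_simple_pole_deriv[where s = UNIV])
    have "exp (2 * of_real pi * \<i> * of_int n) = 1" using exp_2_pi_i_eq_1_iff by auto
    then show "((\<lambda>w. exp (2 * of_real pi * \<i> * w) - 1) has_field_derivative 2 * of_real pi * \<i>) (at (of_int n))"
      "exp (2 * of_real pi * \<i> * of_int n) - 1 = 0"
      by (auto intro!: derivative_eq_intros)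
  qed (auto intro!: holomorphic_intros)
  also have "exp (- of_real (pi * t) * (of_int n)\<^sup>2) = complex_of_real (exp (- pi * (real_of_int n)\<^sup>2 * t))"
    unfolding exp_of_real[symmetric] by (simp add: mult_ac)
  finally show ?thesis by (simp add: theta_kernel_def[abs_def])
qed

text \<open>The residue theorem on a rectangle whose vertical sides stand at half-integers, away
  from the poles. The denominator of the kernel has derivative \<open>2 * pi * i\<close> at every
  integer, which cancels the factor in front of the residue sum. The vertical sides stay contour
  integrals because they only have to vanish in the limit.\<close>

lemma theta_kernel_contour:
  fixes N :: nat and t :: real
  defines "X \<equiv> real N + 1 / 2"
  shows "of_real (\<Sum>n\<in>{- int N..int N}. exp (- pi * (real_of_int n)\<^sup>2 * t)) =
      integral {-X..X} (\<lambda>x. theta_kernel t (Complex x (-1))) - integral {-X..X} (\<lambda>x. theta_kernel t (Complex x 1))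
      + (contour_integral (linepath (Complex X (-1)) (Complex X 1)) (theta_kernel t)
         + contour_integral (linepath (Complex (-X) 1) (Complex (-X) (-1))) (theta_kernel t))"
proof -
  let ?G = "theta_kernel t"
  define a1 a2 a3 a4 where "a1 = Complex (-X) (-1)" "a2 = Complex X (-1)" "a3 = Complex X 1" "a4 = Complex (-X) 1"
  note a = this
  define pts where "pts = (of_int ` {- int N..int N} :: complex set)"
  \<comment> \<open>A strip whose only integers are those inside the rectangle, so that
    \<open>pts\<close> contains every singularity in the domain.\<close>
  define S where "S = {z. Re z < real N + 1} \<inter> {z. Re z > - (real N + 1)}"
  have X: "X > 0" by (simp add: X_def)
  have XZ: "X \<notin> \<int>" "- X \<notin> \<int>"
  proof -
    show "X \<notin> \<int>"
    proof
      assume "X \<in> \<int>"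
      then have "X - of_nat N \<in> \<int>" by (intro Ints_diff) auto
      then have "(1/2::real) \<in> \<int>" by (simp add: X_def)
      then show False by (auto elim!: Ints_cases)
    qed
    then show "- X \<notin> \<int>" by simp
  qed
  have notZ: "z \<notin> \<int>" if "Re z \<in> {-X, X} \<or> Im z \<in> {-1, 1}" for z :: complex
  proof
    assume "z \<in> \<int>"
    then obtain n where "z = of_int n" by (auto elim: Ints_cases)
    then have "Re z \<in> \<int>" "Im z = 0" by auto
    then show False using that XZ by auto
  qed
  have contG: "continuous_on T ?G" if "T \<inter> \<int> = {}" for T
    using theta_kernel_holomorphic that
    by (intro holomorphic_on_imp_continuous_on[OF holomorphic_on_subset]) auto
  have seg: "closed_segment a1 a2 \<inter> \<int> = {}" "closed_segment a2 a3 \<inter> \<int> = {}"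
       "closed_segment a3 a4 \<inter> \<int> = {}" "closed_segment a4 a1 \<inter> \<int> = {}"
    using notZ by (auto simp: a closed_segment_same_Re closed_segment_same_Im)
  have ci: "?G contour_integrable_on linepath a1 a2" "?G contour_integrable_on linepath a2 a3"
     "?G contour_integrable_on linepath a3 a4" "?G contour_integrable_on linepath a4 a1"
    by (intro contour_integrable_continuous_linepath contG seg)+
  have rp: "rectpath a1 a3 = linepath a1 a2 +++ linepath a2 a3 +++ linepath a3 a4 +++ linepath a4 a1"
    by (simp add: rectpath_def a Let_def)
  have "contour_integral (rectpath a1 a3) ?G =
      contour_integral (linepath a1 a2) ?G + (contour_integral (linepath a2 a3) ?G
     + (contour_integral (linepath a3 a4) ?G + contour_integral (linepath a4 a1) ?G))"
    unfolding rp
    by (subst contour_integral_join | simp add: ci contour_integrable_joinI valid_path_join)+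
  also have "contour_integral (linepath a3 a4) ?G = - contour_integral (linepath a4 a3) ?G"
    by (intro contour_integral_reverse_linepath contG seg)
  also have "contour_integral (linepath a4 a3) ?G = integral {-X..X} (\<lambda>x. ?G (Complex x 1))"
    unfolding a by (rule contour_integral_linepath_same_Im) (use X in simp)
  also have "contour_integral (linepath a1 a2) ?G = integral {-X..X} (\<lambda>x. ?G (Complex x (-1)))"
    unfolding a by (rule contour_integral_linepath_same_Im) (use X in simp)
  finally have 1: "contour_integral (rectpath a1 a3) ?G =
      integral {-X..X} (\<lambda>x. ?G (Complex x (-1))) - integral {-X..X} (\<lambda>x. ?G (Complex x 1))
     + (contour_integral (linepath a2 a3) ?G + contour_integral (linepath a4 a1) ?G)"
    by simp
  have "contour_integral (rectpath a1 a3) ?G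
     = 2 * pi * \<i> * (\<Sum>p\<in>pts. winding_number (rectpath a1 a3) p * residue ?G p)"
  proof (rule Residue_theorem)
    show "open S" unfolding S_def by (intro open_Int open_halfspace_Re_lt open_halfspace_Re_gt)
    show "connected S" unfolding S_def
      by (intro convex_connected convex_Int convex_halfspace_Re_lt convex_halfspace_Re_gt)
    show "finite pts" by (simp add: pts_def)
    have "S - pts \<subseteq> - \<int>"
    proof
      fix z assume z: "z \<in> S - pts"
      show "z \<in> - \<int>"
      proof
        assume "z \<in> \<int>"
        then obtain n where n: "z = of_int n" by (auto elim: Ints_cases)
        then have "real_of_int n < real N + 1" "real_of_int n > - (real N + 1)" using z by (auto simp: S_def)
        then have "n \<in> {- int N..int N}" by auto
        then show False using z n by (auto simp: pts_def)
      qed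
    qed
    then show "?G holomorphic_on S - pts" using theta_kernel_holomorphic holomorphic_on_subset by blast
    have "z \<notin> \<int>" if "z \<in> path_image (rectpath a1 a3)" for z
      using that X by (intro notZ, subst (asm) path_image_rectpath) (auto simp: a)
    then have "path_image (rectpath a1 a3) \<inter> \<int> = {}" by blast
    moreover have "path_image (rectpath a1 a3) \<subseteq> S"
      using X by (subst path_image_rectpath) (auto simp: a S_def X_def)
    moreover have "pts \<subseteq> \<int>" by (auto simp: pts_def)
    ultimately show "path_image (rectpath a1 a3) \<subseteq> S - pts" by blast
    show "\<forall>z. z \<notin> S \<longrightarrow> winding_number (rectpath a1 a3) z = 0"
    proof (intro allI impI winding_number_rectpath_outside)
      fix z assume "z \<notin> S"
      then show "z \<notin> cbox a1 a3" by (auto simp: in_cbox_complex_iff a S_def X_def)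
    qed (use X in \<open>auto simp: a\<close>)
  qed auto
  also have "(\<Sum>p\<in>pts. winding_number (rectpath a1 a3) p * residue ?G p)
     = (\<Sum>n\<in>{- int N..int N}. of_real (exp (- pi * (real_of_int n)\<^sup>2 * t)) / (2 * of_real pi * \<i>))"
    unfolding pts_def
  proof (subst sum.reindex)
    show "sum ((\<lambda>p. winding_number (rectpath a1 a3) p * residue ?G p) \<circ> of_int) {- int N..int N} =
        (\<Sum>n\<in>{- int N..int N}. of_real (exp (- pi * (real_of_int n)\<^sup>2 * t)) / (2 * of_real pi * \<i>))"
    proof (rule sum.cong)
      fix n assume n: "n \<in> {- int N..int N}"
      have "of_int n \<in> box a1 a3" using n by (auto simp: in_box_complex_iff a X_def)
      then show "((\<lambda>p. winding_number (rectpath a1 a3) p * residue ?G p) \<circ> of_int) n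
         = of_real (exp (- pi * (real_of_int n)\<^sup>2 * t)) / (2 * of_real pi * \<i>)"
        by (simp add: winding_number_rectpath residue_theta_kernel del: of_real_exp)
    qed simp
  qed (auto simp: inj_on_def)
  also have "2 * pi * \<i> * \<dots> = of_real (\<Sum>n\<in>{- int N..int N}. exp (- pi * (real_of_int n)\<^sup>2 * t))"
    by (simp add: sum_distrib_left)
  finally show ?thesis using 1 by (simp add: a)
qed

text \<open>Above a half-integer \<open>exp (2 * pi * i * z)\<close> is a negative real number, so
  the denominator has modulus at least 1 and the Gaussian decides. The crude \<open>X^2 >= N\<close>
  already makes the decay geometric in \<open>N\<close>.\<close>

lemma theta_kernel_vertical:
  fixes N :: nat and t X :: real
  assumes t: "t > 0" and X: "\<bar>X\<bar> = real N + 1 / 2" and Y: "\<bar>y\<bar> \<le> 1"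
  shows "norm (theta_kernel t (Complex X y)) \<le> exp (pi * t - pi * t * real N)"
proof -
  have "exp (2 * of_real pi * \<i> * Complex X y) = - of_real (exp (- 2 * pi * y))"
  proof -
    have c: "cos (2 * pi * X) = -1"
    proof -
      have "cos (2 * pi * X) = cos (2 * pi * \<bar>X\<bar>)" by (cases "X \<ge> 0") auto
      also have "2 * pi * \<bar>X\<bar> = pi + 2 * pi * real N" unfolding X by (simp add: algebra_simps)
      also have "cos \<dots> = -1" using cos_2npi[of N] sin_2npi[of N] by (simp add: cos_add mult_ac)
      finally show ?thesis .
    qed
    then have s: "sin (2 * pi * X) = 0" using sin_cos_squared_add[of "2 * pi * X"] by simp
    show ?thesis by (simp add: complex_eq_iff Re_exp Im_exp c s)
  qed
  then have "norm (exp (2 * of_real pi * \<i> * Complex X y) - 1) = norm (of_real (- (exp (- 2 * pi * y) + 1)) :: complex)"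
    by simp
  also have "\<dots> = exp (- 2 * pi * y) + 1" unfolding norm_of_real using exp_gt_zero[of "- 2 * pi * y"] by linarith
  finally have den: "norm (exp (2 * of_real pi * \<i> * Complex X y) - 1) \<ge> 1" by simp
  have "Re (- of_real (pi * t) * (Complex X y)\<^sup>2) = pi * t * (y\<^sup>2 - X\<^sup>2)"
    by (simp add: power2_eq_square algebra_simps)
  then have num: "norm (exp (- of_real (pi * t) * (Complex X y)\<^sup>2)) = exp (pi * t * (y\<^sup>2 - X\<^sup>2))" by simp
  have "norm (theta_kernel t (Complex X y)) \<le> exp (pi * t * (y\<^sup>2 - X\<^sup>2))"
    unfolding theta_kernel_def norm_divide num using den
    by (metis div_by_1 exp_ge_zero frac_le order_refl zero_less_one)
  also have "\<dots> \<le> exp (pi * t - pi * t * real N)"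
  proof -
    have "y\<^sup>2 \<le> 1" using Y abs_le_square_iff[of y 1] by simp
    moreover have "X\<^sup>2 \<ge> real N"
    proof -
      have "X\<^sup>2 = (real N + 1/2)\<^sup>2" using X by (metis power2_abs)
      also have "\<dots> = (real N)\<^sup>2 + real N + 1/4" by (simp add: power2_eq_square algebra_simps)
      finally show ?thesis by simp
    qed
    ultimately have "pi * t * (y\<^sup>2 - X\<^sup>2) \<le> pi * t * (1 - real N)"
      using t by (intro mult_left_mono) auto
    then show ?thesis by (simp add: algebra_simps)
  qed
  finally show ?thesis .
qed


text \<open>The link between two kinds of integral: contours give integrals over bounded intervals,
  the Fourier computation gives Lebesgue integrals over the line. It is dominated convergence with
  \<open>norm (f x)\<close> as majorant.\<close>

lemma integral_symmetric_interval_LIMSEQ: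
  fixes f :: "real \<Rightarrow> complex"
  assumes f: "has_bochner_integral lborel f I" and X: "filterlim X at_top sequentially"
  shows "(\<lambda>N. integral {- X N..X N} f) \<longlonglongrightarrow> I"
proof -
  have int: "integrable lborel f" using f by (simp add: has_bochner_integral_iff)
  have meas[measurable]: "f \<in> borel_measurable lborel" using int by simp
  have eq: "integral {- X N..X N} f = (\<integral>x. indicator {- X N..X N} x *\<^sub>R f x \<partial>lborel)" for N
    using set_borel_integral_eq_integral(2)[of "{- X N..X N}" f] integrable_mult_indicator[OF _ int]
    by (simp add: set_integrable_def set_lebesgue_integral_def)
  have "(\<lambda>N. \<integral>x. indicator {- X N..X N} x *\<^sub>R f x \<partial>lborel) \<longlonglongrightarrow> integral\<^sup>L lborel f"
  proof (rule integral_dominated_convergence[where w = "\<lambda>x. norm (f x)"])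
    show "AE x in lborel. (\<lambda>N. indicator {- X N..X N} x *\<^sub>R f x) \<longlonglongrightarrow> f x"
    proof (intro AE_I2)
      fix x :: real
      have "eventually (\<lambda>N. X N \<ge> \<bar>x\<bar>) sequentially"
        using X by (auto simp: filterlim_at_top)
      then have "eventually (\<lambda>N. indicator {- X N..X N} x *\<^sub>R f x = f x) sequentially"
        by eventually_elim (auto simp: indicator_def)
      then show "(\<lambda>N. indicator {- X N..X N} x *\<^sub>R f x) \<longlonglongrightarrow> f x"
        by (rule tendsto_eventually)
    qed
  qed (auto intro!: integrable_norm int AE_I2 simp: indicator_def)
  then show ?thesis using f by (simp add: eq has_bochner_integral_iff)
qed

lemma sum_symmetric_int:
  fixes f :: "real \<Rightarrow> real"
  shows "(\<Sum>n\<in>{- int N..int N}. f ((real_of_int n)\<^sup>2)) = f 0 + 2 * (\<Sum>k<N. f ((real (k + 1))\<^sup>2))"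
proof (induction N)
  case (Suc N)
  have "{- int (Suc N)..int (Suc N)} = insert (- int (Suc N)) (insert (int (Suc N)) {- int N..int N})"
    by auto
  then have "(\<Sum>n\<in>{- int (Suc N)..int (Suc N)}. f ((real_of_int n)\<^sup>2))
     = f ((real (N + 1))\<^sup>2) + (f ((real (N + 1))\<^sup>2) + (\<Sum>n\<in>{- int N..int N}. f ((real_of_int n)\<^sup>2)))"
    by (simp add: power2_eq_square algebra_simps)
  then show ?case using Suc.IH by simp
qed simp

text \<open>Poisson summation by residues. Below the real axis
  \<open>E = exp (2 * pi * i * z)\<close> is large and \<open>1 / (E - 1)\<close> expands in powers
  of \<open>1 / E\<close> from exponent 1 on; above the axis \<open>E\<close> is small and the
  expansion starts at exponent 0. The two lines thus give \<open>w / sqrt t\<close> and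
  \<open>(1 + w) / sqrt t\<close>, and this shift by one is the constant term of theta on the
  right.\<close>

theorem theta_functional_equation:
  fixes t :: real
  assumes t: "t > 0"
  shows "1 + 2 * (\<Sum>k. exp (- pi * (real (k + 1))\<^sup>2 * t))
       = (1 + 2 * (\<Sum>k. exp (- pi * (real (k + 1))\<^sup>2 / t))) / sqrt t"
proof -
  define w where "w = (\<Sum>k. exp (- pi * (real (k + 1))\<^sup>2 / t))"
  define X where "X = (\<lambda>N. real N + 1 / 2)"
  have X: "filterlim X at_top sequentially" unfolding X_def
    by (intro filterlim_tendsto_add_at_top filterlim_real_sequentially tendsto_const
        filterlim_at_top_mono[OF filterlim_real_sequentially]) auto
  have low: "has_bochner_integral lborel (\<lambda>x. theta_kernel t (Complex x (-1))) (of_real (w / sqrt t))"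
  proof -
    have "exp (- of_real (pi * t) * (of_real x + of_real (-1) * \<i>)\<^sup>2) *
       (exp (2 * of_real pi * \<i> * of_real (-1) * (of_real x + of_real (-1) * \<i>)) ^ 1
          / (1 - exp (2 * of_real pi * \<i> * of_real (-1) * (of_real x + of_real (-1) * \<i>))))
       = theta_kernel t (Complex x (-1))" for x
    proof -
      define z where "z = Complex x (-1)"
      define E where "E = exp (2 * of_real pi * \<i> * z)"
      have z: "of_real x + of_real (-1) * \<i> = z" by (simp add: z_def Complex_eq)
      have q: "exp (2 * of_real pi * \<i> * of_real (-1) * z) = inverse E"
        by (simp add: E_def exp_minus[symmetric])
      have "E \<noteq> 1" unfolding E_def exp_2_pi_i_eq_1_iff by (auto simp: z_def elim!: Ints_cases simp: complex_eq_iff)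
      then have "inverse E ^ 1 / (1 - inverse E) = 1 / (E - 1)"
        by (simp add: E_def field_simps)
      then show ?thesis unfolding z q theta_kernel_def z_def[symmetric] E_def[symmetric] by simp
    qed
    then show ?thesis using horizontal_gaussian_geometric[OF t, of "-1" 1]
      by (simp only: w_def) (simp add: power2_eq_square)
  qed
  have up: "has_bochner_integral lborel (\<lambda>x. - theta_kernel t (Complex x 1)) (of_real ((1 + w) / sqrt t))"
  proof -
    have "exp (- of_real (pi * t) * (of_real x + of_real 1 * \<i>)\<^sup>2) *
       (exp (2 * of_real pi * \<i> * of_real 1 * (of_real x + of_real 1 * \<i>)) ^ 0
          / (1 - exp (2 * of_real pi * \<i> * of_real 1 * (of_real x + of_real 1 * \<i>))))
       = - theta_kernel t (Complex x 1)" for x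
    proof -
      define z where "z = Complex x 1"
      have z: "of_real x + of_real 1 * \<i> = z" by (simp add: z_def Complex_eq)
      show ?thesis unfolding z theta_kernel_def z_def[symmetric]
        by (simp add: minus_divide_right)
    qed
    moreover have "(\<Sum>k. exp (- pi * (real (k + 0))\<^sup>2 / t)) = 1 + w"
      using suminf_split_head[of "\<lambda>k. exp (- pi * (real (k + 0))\<^sup>2 / t)"] summable_exp_gaussian[of "1/t" 0] t
      by (simp add: w_def)
    ultimately show ?thesis using horizontal_gaussian_geometric[OF t, of 1 0]
      by (simp only:) simp
  qed
  have lim1: "(\<lambda>N. integral {- X N..X N} (\<lambda>x. theta_kernel t (Complex x (-1)))) \<longlonglongrightarrow> of_real (w / sqrt t)"
    by (rule integral_symmetric_interval_LIMSEQ[OF low X])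
  have lim2: "(\<lambda>N. integral {- X N..X N} (\<lambda>x. - theta_kernel t (Complex x 1))) \<longlonglongrightarrow> of_real ((1 + w) / sqrt t)"
    by (rule integral_symmetric_interval_LIMSEQ[OF up X])
  define V where "V = (\<lambda>N. contour_integral (linepath (Complex (X N) (-1)) (Complex (X N) 1)) (theta_kernel t)
         + contour_integral (linepath (Complex (- X N) 1) (Complex (- X N) (-1))) (theta_kernel t))"
  have S: "of_real (\<Sum>n\<in>{- int N..int N}. exp (- pi * (real_of_int n)\<^sup>2 * t)) =
      integral {- X N..X N} (\<lambda>x. theta_kernel t (Complex x (-1)))
      + integral {- X N..X N} (\<lambda>x. - theta_kernel t (Complex x 1)) + V N" for N
    using theta_kernel_contour[where N = N and t = t] by (simp add: X_def V_def)
  have cint: "theta_kernel t contour_integrable_on linepath (Complex a b) (Complex a c)"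
    if "\<bar>a\<bar> = X N" for a b c N
  proof (intro contour_integrable_continuous_linepath)
    \<comment> \<open>Parity: an even integer cannot have modulus \<open>2 * N + 1\<close>.\<close>
    have "2 * a \<noteq> 2 * real_of_int n" for n
    proof
      assume "2 * a = 2 * real_of_int n"
      then have "2 * \<bar>a\<bar> = real_of_int \<bar>2 * n\<bar>" by auto
      then have "real_of_int (2 * int N + 1) = real_of_int \<bar>2 * n\<bar>" using that by (simp add: X_def)
      then have "2 * int N + 1 = \<bar>2 * n\<bar>" by (simp only: of_int_eq_iff)
      then show False by presburger
    qed
    then have na: "a \<noteq> real_of_int n" for n by auto
    have "closed_segment (Complex a b) (Complex a c) \<subseteq> - \<int>"
    proof
      fix z assume "z \<in> closed_segment (Complex a b) (Complex a c)"
      then have "Re z = a" by (auto simp: closed_segment_same_Re)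
      then show "z \<in> - \<int>" using na by (metis ComplI Ints_cases complex_Re_of_int)
    qed
    then show "continuous_on (closed_segment (Complex a b) (Complex a c)) (theta_kernel t)"
      using theta_kernel_holomorphic holomorphic_on_imp_continuous_on holomorphic_on_subset by blast
  qed
  have side: "norm (contour_integral (linepath (Complex a b) (Complex a c)) (theta_kernel t))
     \<le> exp (pi * t - pi * t * real N) * norm (Complex a c - Complex a b)"
    if "\<bar>a\<bar> = X N" "b \<in> {-1, 1}" "c \<in> {-1, 1}" for a b c N
  proof (rule contour_integral_bound_linepath)
    fix z assume "z \<in> closed_segment (Complex a b) (Complex a c)"
    then have "z = Complex a (Im z)" "\<bar>Im z\<bar> \<le> 1"
      using that by (auto simp: closed_segment_same_Re closed_segment_eq_real_ivl complex_eq_iff split: if_splits)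
    then show "norm (theta_kernel t z) \<le> exp (pi * t - pi * t * real N)"
      using theta_kernel_vertical[OF t, where X = a and N = N and y = "Im z"] that by (simp add: X_def)
  qed (use cint[OF that(1)] in auto)
  have Vb: "norm (V N) \<le> 4 * exp (pi * t) * exp (- (pi * t)) ^ N" for N
  proof -
    have "norm (V N) \<le> exp (pi * t - pi * t * real N) * 2 + exp (pi * t - pi * t * real N) * 2"
      unfolding V_def
      using side[of "X N" N "-1" 1] side[of "- X N" N 1 "-1"]
      by (intro norm_triangle_mono) (auto simp: X_def cmod_def)
    also have "\<dots> = 4 * exp (pi * t) * exp (- (pi * t)) ^ N"
      by (simp add: exp_diff exp_of_nat_mult[symmetric] exp_minus field_simps)
    finally show ?thesis .
  qed
  have "(\<lambda>N. 4 * exp (pi * t) * exp (- (pi * t)) ^ N) \<longlonglongrightarrow> 4 * exp (pi * t) * 0"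
    using t by (intro tendsto_intros LIMSEQ_realpow_zero) auto
  then have lim3: "V \<longlonglongrightarrow> 0"
    by (intro Lim_null_comparison[of V "\<lambda>N. 4 * exp (pi * t) * exp (- (pi * t)) ^ N"]) (use Vb in auto)
  have "(\<lambda>N. complex_of_real (\<Sum>n\<in>{- int N..int N}. exp (- pi * (real_of_int n)\<^sup>2 * t)))
     \<longlonglongrightarrow> of_real (w / sqrt t) + of_real ((1 + w) / sqrt t) + 0"
    unfolding S by (intro tendsto_add lim1 lim2 lim3)
  moreover have "of_real (w / sqrt t) + of_real ((1 + w) / sqrt t) + 0 = complex_of_real ((1 + 2 * w) / sqrt t)"
    by (simp add: add_divide_distrib)
  ultimately have "(\<lambda>N. complex_of_real (\<Sum>n\<in>{- int N..int N}. exp (- pi * (real_of_int n)\<^sup>2 * t)))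
     \<longlonglongrightarrow> of_real ((1 + 2 * w) / sqrt t)" by (simp only:)
  then have "(\<lambda>N. \<Sum>n\<in>{- int N..int N}. exp (- pi * (real_of_int n)\<^sup>2 * t)) \<longlonglongrightarrow> (1 + 2 * w) / sqrt t"
    by (simp only: tendsto_of_real_iff)
  moreover have "(\<lambda>N. \<Sum>n\<in>{- int N..int N}. exp (- pi * (real_of_int n)\<^sup>2 * t))
     \<longlonglongrightarrow> 1 + 2 * (\<Sum>k. exp (- pi * (real (k + 1))\<^sup>2 * t))"
  proof -
    have "(\<lambda>N. 1 + 2 * (\<Sum>k<N. exp (- pi * (real (k + 1))\<^sup>2 * t)))
       \<longlonglongrightarrow> 1 + 2 * (\<Sum>k. exp (- pi * (real (k + 1))\<^sup>2 * t))"
      by (intro tendsto_intros summable_LIMSEQ summable_exp_gaussian t)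
    then show ?thesis
      using sum_symmetric_int[of "\<lambda>y. exp (- pi * y * t)"] by simp
  qed
  ultimately show ?thesis using LIMSEQ_unique unfolding w_def by blast
qed

section \<open>Non-vanishing of the zeta series\<close>

definition dirichlet_zeta :: "complex \<Rightarrow> complex" where
  "dirichlet_zeta s = (\<Sum>n. 1 / of_nat (Suc n) powr s)"

lemma norm_nat_powr: "norm (of_nat n powr (- s) :: complex) = real n powr (- Re s)"
  using norm_powr_real_powr[of "of_nat n" "- s"] by simp

lemma nat_powr_mult: "(of_nat (m * n) powr s :: complex) = of_nat m powr s * of_nat n powr s"
  using powr_times_real[of "of_nat m" "of_nat n" s] by simp

lemma summable_nat_powr:
  assumes "Re s > 1"
  shows "summable (\<lambda>n. norm (of_nat n powr (- s) :: complex))"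
  unfolding norm_nat_powr using assms by (simp add: summable_real_powr_iff)

lemma nat_powr_summable_on:
  assumes "Re s > 1"
  shows "(\<lambda>n. of_nat n powr (- s) :: complex) summable_on A"
  using norm_summable_imp_summable_on[OF summable_nat_powr[OF assms]] summable_on_subset_banach
  by blast

lemma dirichlet_zeta_sums:
  assumes "Re s > 1"
  shows "(\<lambda>n. 1 / of_nat (Suc n) powr s) sums dirichlet_zeta s"
proof -
  have "summable (\<lambda>n. of_nat n powr (- s) :: complex)"
    using summable_nat_powr[OF assms] by (rule summable_norm_cancel)
  then have "summable (\<lambda>n. of_nat (Suc n) powr (- s) :: complex)"
    using summable_Suc_iff[of "\<lambda>n. of_nat n powr (- s) :: complex"] by simp
  then show ?thesis
    by (simp add: dirichlet_zeta_def powr_minus field_simps summable_sums)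
qed

lemma dirichlet_zeta_infsum:
  assumes "Re s > 1"
  shows "dirichlet_zeta s = (\<Sum>\<^sub>\<infinity>n\<in>{0<..}. of_nat n powr (- s))"
proof -
  have "(\<lambda>n. of_nat (Suc n) powr (- s)) sums dirichlet_zeta s"
    using dirichlet_zeta_sums[OF assms] by (simp add: powr_minus field_simps)
  then have "(\<lambda>n. of_nat n powr (- s)) sums dirichlet_zeta s"
    using sums_Suc_iff[of "\<lambda>n. of_nat n powr (- s)"] by simp
  then have "((\<lambda>n. of_nat n powr (- s)) has_sum dirichlet_zeta s) UNIV"
    using summable_nat_powr[OF assms] by (intro norm_summable_imp_has_sum)
  then have "((\<lambda>n. of_nat n powr (- s)) has_sum dirichlet_zeta s) {0<..}"
    by (rule has_sum_cong_neutral[THEN iffD1, rotated -1]) auto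
  then show ?thesis by (simp add: infsumI)
qed

text \<open>Among the integers that survive \<open>P\<close>, the multiples of a new prime
  \<open>q\<close> are exactly \<open>q\<close> times the survivors of \<open>P\<close>, so they
  carry \<open>q powr (- s)\<close> times the whole sum. Removing them multiplies the sum by
  \<open>1 - q powr (- s)\<close>.\<close>

lemma sieve_infsum:
  assumes s: "Re s > 1" and "finite P" and "\<And>p. p \<in> P \<Longrightarrow> prime p"
  shows "(\<Sum>\<^sub>\<infinity>n\<in>{n. 0 < n \<and> (\<forall>p\<in>P. \<not> p dvd n)}. of_nat n powr (- s))
           = (\<Prod>p\<in>P. 1 - of_nat p powr (- s)) * dirichlet_zeta s"
  using \<open>finite P\<close> assms(3)
proof (induction P rule: finite_induct)
  case empty
  then show ?case by (simp add: dirichlet_zeta_infsum[OF s] greaterThan_def)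
next
  case (insert q P)
  let ?a = "\<lambda>n::nat. of_nat n powr (- s) :: complex"
  define A where "A = {n::nat. 0 < n \<and> (\<forall>p\<in>P. \<not> p dvd n)}"
  define B where "B = {n::nat. 0 < n \<and> (\<forall>p\<in>insert q P. \<not> p dvd n)}"
  have q: "prime q" using insert.prems by auto
  have q0: "q > 0" using q prime_gt_0_nat by blast
  have dvd: "p dvd q * n \<longleftrightarrow> p dvd n" if "p \<in> P" for p n
  proof -
    have "prime p" using insert.prems that by auto
    moreover have "p \<noteq> q" using insert.hyps that by auto
    ultimately show ?thesis
      using q by (metis dvd_mult prime_dvd_mult_iff primes_dvd_imp_eq)
  qed
  have AB: "A = B \<union> (*) q ` A"
  proof (intro equalityI subsetI)
    fix n assume n: "n \<in> A"
    show "n \<in> B \<union> (*) q ` A"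
    proof (cases "q dvd n")
      case True
      then obtain k where "n = q * k" by blast
      then have "k \<in> A" using n dvd by (auto simp: A_def)
      then show ?thesis using \<open>n = q * k\<close> by blast
    qed (use n in \<open>auto simp: A_def B_def\<close>)
  next
    fix n assume "n \<in> B \<union> (*) q ` A"
    then show "n \<in> A" using dvd q0 by (auto simp: A_def B_def)
  qed
  have "infsum ?a A = infsum ?a B + infsum ?a ((*) q ` A)"
    by (subst AB, rule infsum_Un_disjoint) (auto intro!: nat_powr_summable_on s simp: B_def)
  also have "infsum ?a ((*) q ` A) = infsum (\<lambda>n. ?a (q * n)) A"
    using q0 by (subst infsum_reindex) (auto simp: inj_on_def o_def)
  also have "\<dots> = ?a q * infsum ?a A"
    unfolding nat_powr_mult by (rule infsum_cmult_right) (auto intro: nat_powr_summable_on s)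
  finally have "infsum ?a B = (1 - ?a q) * infsum ?a A" by (simp add: algebra_simps)
  also have "infsum ?a A = (\<Prod>p\<in>P. 1 - ?a p) * dirichlet_zeta s"
    unfolding A_def using insert by auto
  finally show ?case using insert.hyps by (simp add: B_def mult.assoc)
qed

text \<open>Sieving by the primes up to \<open>N\<close> leaves 1 and integers beyond
  \<open>N\<close>, so the distance to 1 is at most a tail of an absolutely convergent series. With
  the finite product multiplied onto zeta, no infinite product has to be discussed, and a zero of
  zeta would contradict the limit at once.\<close>

lemma euler_product_LIMSEQ:
  assumes s: "Re s > 1"
  shows "(\<lambda>N. (\<Prod>p\<in>{p. prime p \<and> p \<le> N}. 1 - of_nat p powr (- s)) * dirichlet_zeta s) \<longlonglongrightarrow> 1"
proof -
  let ?a = "\<lambda>n::nat. of_nat n powr (- s) :: complex"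
  define Q where "Q = (\<lambda>N. (\<Prod>p\<in>{p. prime p \<and> p \<le> N}. 1 - ?a p) * dirichlet_zeta s)"
  let ?b = "\<lambda>n. norm (?a n)"
  have sb: "?b summable_on A" for A
  proof -
    have "?b summable_on UNIV"
      by (rule summable_nonneg_imp_summable_on[OF summable_nat_powr[OF s]]) auto
    then show ?thesis by (rule summable_on_subset_banach) auto
  qed
  have bound: "norm (Q N - 1) \<le> (\<Sum>n. ?b (n + Suc N))" for N
  proof -
    define P where "P = {p::nat. prime p \<and> p \<le> N}"
    define A where "A = {n::nat. 0 < n \<and> (\<forall>p\<in>P. \<not> p dvd n)}"
    have finP: "finite P" by (rule finite_subset[of _ "{..N}"]) (auto simp: P_def)
    have "Q N = infsum ?a A"
      unfolding Q_def A_def P_def[symmetric]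
      by (rule sieve_infsum[symmetric, OF s finP]) (auto simp: P_def)
    also have "A = insert 1 (A - {1})" by (auto simp: A_def P_def)
    also have "infsum ?a \<dots> = ?a 1 + infsum ?a (A - {1})"
      by (rule infsum_insert) (auto intro: nat_powr_summable_on s)
    finally have "norm (Q N - 1) = norm (infsum ?a (A - {1}))" by simp
    also have "\<dots> \<le> infsum ?b (A - {1})"
      by (rule norm_infsum_bound) (rule sb)
    also have "\<dots> \<le> infsum ?b {Suc N..}"
    proof (rule infsum_mono_neutral)
      fix n assume n: "n \<in> (A - {1}) - {Suc N..}"
      then have "n \<noteq> 1" "0 < n" "n \<le> N" by (auto simp: A_def)
      then obtain p where p: "prime p" "p dvd n" using prime_factor_nat by blast
      then have "p \<le> N" using \<open>n \<le> N\<close> \<open>0 < n\<close> dvd_imp_le le_trans by blast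
      then show "?b n \<le> 0" using p n by (auto simp: A_def P_def)
    qed (auto intro: sb)
    also have "\<dots> = infsum (\<lambda>n. ?b (n + Suc N)) UNIV"
      by (subst infsum_reindex[symmetric, of "\<lambda>n. n + Suc N" UNIV ?b, unfolded o_def])
        (auto simp: inj_on_def image_def intro!: infsum_cong arg_cong2[where f = infsum]
          dest: le_Suc_ex simp: add.commute)
    also have "\<dots> = (\<Sum>n. ?b (n + Suc N))"
      using summable_iff_shift[of ?b "Suc N"] summable_nat_powr[OF s]
      by (intro infsumI norm_summable_imp_has_sum) (auto simp: summable_sums)
    finally show ?thesis .
  qed
  have "(\<lambda>N. (\<Sum>n. ?b (n + Suc N))) \<longlonglongrightarrow> 0"
    using suminf_exist_split2[OF summable_nat_powr[OF s]] by (rule LIMSEQ_Suc)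
  then have "(\<lambda>N. Q N - 1) \<longlonglongrightarrow> 0"
    by (rule Lim_null_comparison[rotated]) (use bound in auto)
  then show ?thesis unfolding Q_def by (simp add: LIM_zero_iff)
qed

lemma dirichlet_zeta_nonzero:
  assumes "Re s > 1"
  shows "dirichlet_zeta s \<noteq> 0"
  using euler_product_LIMSEQ[OF assms] by (auto simp: LIMSEQ_const_iff)

section \<open>The 3-4-1 inequality and the line \<open>Re s = 1\<close>\<close>

text \<open>The logarithm of the product is a sum of terms
  \<open>- (r^n / n) * (3 + 4 * c + (2 * c^2 - 1))\<close> with \<open>c = Re (u^n)\<close>, and the
  bracket is \<open>2 * (1 + c)^2\<close>.\<close>

lemma three_four_one:
  fixes r :: real and u :: complex
  assumes r: "0 < r" "r < 1" and u: "norm u = 1"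
  shows "norm (1 - of_real r :: complex) ^ 3 * norm (1 - of_real r * u) ^ 4 * norm (1 - of_real r * u\<^sup>2) \<le> 1"
proof -
  \<comment> \<open>The index starts at 0; that term is 0 because division by 0 yields 0.\<close>
  have L: "(\<lambda>n. - (w ^ n) / of_nat n) sums Ln (1 - w)" if "norm w < 1" for w :: complex
    using Ln_series'[of "- w"] that by simp
  define v where "v = (\<lambda>k::nat. of_real r * u ^ k)"
  have nv: "norm (v k) < 1" for k using r u by (simp add: v_def norm_mult norm_power)
  have Lv: "(\<lambda>n. Re (- (v k ^ n) / of_nat n)) sums ln (norm (1 - v k))" for k
  proof -
    have "v k \<noteq> 1" using nv[of k] by auto
    then have "Re (Ln (1 - v k)) = ln (norm (1 - v k))" by (subst Re_Ln) auto
    then show ?thesis using sums_Re[OF L[OF nv[of k]]] by simp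
  qed
  have sm: "(\<lambda>n. 3 * Re (- (v 0 ^ n) / of_nat n) + 4 * Re (- (v 1 ^ n) / of_nat n) + Re (- (v 2 ^ n) / of_nat n))
     sums (3 * ln (norm (1 - v 0)) + 4 * ln (norm (1 - v 1)) + ln (norm (1 - v 2)))"
    by (intro sums_add sums_mult Lv)
  have np: "3 * Re (- (v 0 ^ n) / of_nat n) + 4 * Re (- (v 1 ^ n) / of_nat n) + Re (- (v 2 ^ n) / of_nat n) \<le> 0" for n
  proof -
    define c where "c = Re (u ^ n)"
    have nn: "norm (u ^ n) = 1" using u by (simp add: norm_power)
    have "c\<^sup>2 + (Im (u ^ n))\<^sup>2 = 1" unfolding c_def using nn cmod_power2[of "u ^ n"] by simp
    then have sq: "Re (u ^ n * u ^ n) = 2 * c\<^sup>2 - 1"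
      by (simp add: c_def power2_eq_square)
    have e: "v k ^ n = of_real (r ^ n) * (u ^ n) ^ k" for k
      by (simp add: v_def power_mult_distrib power_mult[symmetric] mult.commute)
    have "3 * Re (- (v 0 ^ n) / of_nat n) + 4 * Re (- (v 1 ^ n) / of_nat n) + Re (- (v 2 ^ n) / of_nat n)
        = - (r ^ n / real n) * (3 + 4 * c + Re (u ^ n * u ^ n))"
      unfolding e Re_divide_of_nat uminus_complex.sel by (simp add: c_def power2_eq_square add_divide_distrib diff_divide_distrib algebra_simps)
    also have "\<dots> = - (r ^ n / real n) * (2 * (1 + c)\<^sup>2)"
      unfolding sq by (simp add: power2_eq_square algebra_simps)
    also have "\<dots> \<le> 0" using r by (intro mult_nonpos_nonneg) auto
    finally show ?thesis .
  qed
  have le: "3 * ln (norm (1 - v 0)) + 4 * ln (norm (1 - v 1)) + ln (norm (1 - v 2)) \<le> 0"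
    by (rule sums_le[OF np sm sums_zero])
  have pos: "norm (1 - v k) > 0" for k using nv[of k] by auto
  have "ln (norm (1 - v 0) ^ 3 * norm (1 - v 1) ^ 4 * norm (1 - v 2))
      = 3 * ln (norm (1 - v 0)) + 4 * ln (norm (1 - v 1)) + ln (norm (1 - v 2))"
    using pos by (simp add: ln_mult ln_realpow)
  also have "\<dots> \<le> ln 1" using le by simp
  finally have "norm (1 - v 0) ^ 3 * norm (1 - v 1) ^ 4 * norm (1 - v 2) \<le> 1"
    using pos by (subst (asm) ln_le_cancel_iff) auto
  then show ?thesis by (simp add: v_def)
qed

text \<open>Each prime satisfies \<open>three_four_one\<close> with
  \<open>r = p powr (- \<sigma>)\<close> and \<open>u = p powr (- i * t)\<close>. Hence the finite
  products of the factors \<open>1 - p powr (- s)\<close>, multiplied by \<open>W\<close>, never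
  exceed \<open>W\<close>, while they tend to 1.\<close>

lemma dirichlet_zeta_341:
  fixes \<sigma> t :: real
  assumes "\<sigma> > 1"
  shows "norm (dirichlet_zeta (of_real \<sigma>)) ^ 3 * norm (dirichlet_zeta (of_real \<sigma> + \<i> * t)) ^ 4
           * norm (dirichlet_zeta (of_real \<sigma> + 2 * \<i> * t)) \<ge> 1"
proof -
  define Q where "Q = (\<lambda>N s. \<Prod>p\<in>{p::nat. prime p \<and> p \<le> N}. 1 - of_nat p powr (- s) :: complex)"
  define s where "s = (\<lambda>k::nat. of_real \<sigma> + of_nat k * \<i> * of_real t)"
  define W where "W = norm (dirichlet_zeta (s 0)) ^ 3 * norm (dirichlet_zeta (s 1)) ^ 4 * norm (dirichlet_zeta (s 2))"
  have res: "Re (s k) > 1" for k using assms by (simp add: s_def)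
  have lim: "(\<lambda>N. norm (Q N (s k)) * norm (dirichlet_zeta (s k))) \<longlonglongrightarrow> 1" for k
    using tendsto_norm[OF euler_product_LIMSEQ[OF res[of k]]] by (simp add: Q_def norm_mult)
  have "(\<lambda>N. (norm (Q N (s 0)) * norm (dirichlet_zeta (s 0))) ^ 3
       * (norm (Q N (s 1)) * norm (dirichlet_zeta (s 1))) ^ 4
       * (norm (Q N (s 2)) * norm (dirichlet_zeta (s 2)))) \<longlonglongrightarrow> 1 ^ 3 * 1 ^ 4 * 1"
    by (intro tendsto_intros lim)
  moreover have "(norm (Q N (s 0)) * norm (dirichlet_zeta (s 0))) ^ 3
       * (norm (Q N (s 1)) * norm (dirichlet_zeta (s 1))) ^ 4
       * (norm (Q N (s 2)) * norm (dirichlet_zeta (s 2))) \<le> W" for N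
  proof -
    have le1: "norm (Q N (s 0)) ^ 3 * norm (Q N (s 1)) ^ 4 * norm (Q N (s 2)) \<le> 1"
      unfolding Q_def prod_norm[symmetric] prod_power_distrib prod.distrib[symmetric]
    proof (intro prod_le_1 conjI)
      fix p :: nat assume "p \<in> {p. prime p \<and> p \<le> N}"
      then have p: "p > 1" using prime_gt_1_nat by auto
      define r where "r = real p powr (- \<sigma>)"
      define u where "u = (of_nat p powr (- (\<i> * of_real t)) :: complex)"
      have "of_nat p powr (- s k) = of_real r * u ^ k" for k
      proof -
        have "of_nat p powr (- s k) = (of_nat p powr (- of_real \<sigma>) * of_nat p powr (of_nat k * (- (\<i> * of_real t))) :: complex)"
          by (simp add: s_def powr_add[symmetric] algebra_simps)
        also have "(of_nat p powr (- of_real \<sigma>) :: complex) = of_real r"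
          unfolding r_def using p by (simp add: powr_of_real[symmetric])
        also have "(of_nat p powr (of_nat k * (- (\<i> * of_real t))) :: complex) = u ^ k"
          unfolding u_def using p by (simp add: powr_def exp_of_nat_mult[symmetric] mult_ac)
        finally show ?thesis .
      qed
      moreover have "norm u = 1" unfolding u_def using norm_nat_powr[of p "\<i> * of_real t"] p by simp
      moreover have "0 < r" "r < 1" unfolding r_def using p assms by (auto simp: powr_less_one)
      ultimately show "norm (1 - of_nat p powr - s 0) ^ 3 * norm (1 - of_nat p powr - s 1) ^ 4 *
            norm (1 - of_nat p powr - s 2) \<le> 1"
        using three_four_one[of r u] by simp
    qed auto
    have "(norm (Q N (s 0)) ^ 3 * norm (Q N (s 1)) ^ 4 * norm (Q N (s 2))) * W \<le> 1 * W"
      by (rule mult_right_mono[OF le1]) (simp add: W_def)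
    then show ?thesis by (simp add: W_def power_mult_distrib mult_ac)
  qed
  ultimately have "1 \<le> W" using LIMSEQ_le_const2 by fastforce
  then show ?thesis by (simp add: W_def s_def)
qed

text \<open>At distance \<open>e\<close> to the right of the line, a zero at
  \<open>1 + i * t\<close> makes the fourth power of order \<open>e^4\<close>, the pole costs at
  most \<open>e^(-3)\<close>, and the value near \<open>1 + 2 * i * t\<close> stays bounded. One
  factor \<open>e\<close> survives, so the product tends to 0 although
  \<open>dirichlet_zeta_341\<close> keeps it at least 1. \<open>Z\<close> is arbitrary because no
  continuation has been constructed at this point.\<close>

lemma zeta_nonzero_Re_1:
  fixes Z :: "complex \<Rightarrow> complex" and t :: real
  assumes Z: "Z holomorphic_on - {1}" and ZD: "\<And>s. Re s > 1 \<Longrightarrow> Z s = dirichlet_zeta s"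
    and pole: "((\<lambda>s. (s - 1) * Z s) \<longlongrightarrow> L) (at 1)" and t: "t \<noteq> 0"
  shows "Z (1 + \<i> * t) \<noteq> 0"
proof
  assume Z0: "Z (1 + \<i> * t) = 0"
  define w where "w = 1 + \<i> * of_real t"
  define w2 where "w2 = 1 + 2 * \<i> * of_real t"
  have F: "filterlim (\<lambda>e::real. c + of_real e) (at c) (at_right 0)" for c :: complex
  proof -
    have "((\<lambda>e::real. c + of_real e) \<longlongrightarrow> c + of_real 0) (at_right 0)"
      by (intro tendsto_intros)
    then show ?thesis
      by (auto simp: filterlim_at eventually_at_filter)
  qed
  have l1: "((\<lambda>e::real. (1 + of_real e - 1) * Z (1 + of_real e)) \<longlongrightarrow> L) (at_right 0)"
    using filterlim_compose[OF pole F[of 1]] .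
  have w1: "w \<noteq> 1" "w2 \<noteq> 1" using t by (auto simp: w_def w2_def)
  then have "(Z has_field_derivative deriv Z w) (at w)"
    using holomorphic_derivI[OF Z] by auto
  then have "((\<lambda>y. (Z y - Z w) / (y - w)) \<longlongrightarrow> deriv Z w) (at w)"
    by (simp add: has_field_derivative_iff)
  from filterlim_compose[OF this F[of w]] Z0
  have l2: "((\<lambda>e::real. Z (w + of_real e) / of_real e) \<longlongrightarrow> deriv Z w) (at_right 0)"
    by (simp add: w_def)
  have "isCont Z w2" using w1 Z
    by (metis Compl_iff holomorphic_on_imp_continuous_on continuous_on_eq_continuous_at open_Compl closed_singleton singletonD)
  then have "(Z \<longlongrightarrow> Z w2) (at w2)" by (simp add: isCont_def)
  from filterlim_compose[OF this F[of w2]]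
  have l3: "((\<lambda>e::real. Z (w2 + of_real e)) \<longlongrightarrow> Z w2) (at_right 0)" .
  have "((\<lambda>e::real. norm ((1 + of_real e - 1) * Z (1 + of_real e)) ^ 3 * norm (Z (w + of_real e) / of_real e) ^ 4
        * norm (Z (w2 + of_real e)) * e) \<longlongrightarrow> norm L ^ 3 * norm (deriv Z w) ^ 4 * norm (Z w2) * 0) (at_right 0)"
    by (intro tendsto_intros l1 l2 l3)
  moreover have "eventually (\<lambda>e::real. 1 \<le> norm ((1 + of_real e - 1) * Z (1 + of_real e)) ^ 3 * norm (Z (w + of_real e) / of_real e) ^ 4
        * norm (Z (w2 + of_real e)) * e) (at_right 0)"
    using eventually_at_right_less[of 0]
  proof eventually_elim
    case (elim e)
    have "1 \<le> norm (Z (1 + of_real e)) ^ 3 * norm (Z (w + of_real e)) ^ 4 * norm (Z (w2 + of_real e))"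
      using dirichlet_zeta_341[of "1 + e" t] elim
      by (simp add: ZD w_def w2_def add_ac)
    also have "\<dots> = norm ((1 + of_real e - 1) * Z (1 + of_real e)) ^ 3 * norm (Z (w + of_real e) / of_real e) ^ 4
        * norm (Z (w2 + of_real e)) * e"
      using elim by (simp add: norm_mult norm_divide power_mult_distrib power_divide power3_eq_cube power4_eq_xxxx)
    finally show ?case .
  qed
  ultimately have "(1::real) \<le> norm L ^ 3 * norm (deriv Z w) ^ 4 * norm (Z w2) * 0"
    by (intro tendsto_lowerbound[where F = "at_right (0::real)"]) auto
  then show False by simp
qed

section \<open>The completed zeta function as a theta transform\<close>

text \<open>Euler's integral after \<open>x = exp u\<close>. In this variable the dilations by
  \<open>pi * n^2\<close> become translations. The substitution is carried out for the real and the
  imaginary part separately.\<close>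

lemma Gamma_integral_exp:
  fixes z :: complex
  assumes z: "Re z > 0"
  shows "has_bochner_integral lborel (\<lambda>u::real. exp (z * of_real u - of_real (exp u))) (Gamma z)"
proof -
  define f where "f = (\<lambda>x::real. complex_of_real x powr (z - 1) / of_real (exp x))"
  define h where "h = (\<lambda>u::real. exp (z * of_real u - of_real (exp u)))"
  have ai: "f absolutely_integrable_on {0<..}"
    unfolding f_def by (rule absolutely_integrable_Gamma_integral'[OF z])
  have hi: "(f has_integral Gamma z) {0<..}"
    unfolding f_def by (rule Gamma_integral_complex'[OF z])
  have hf: "h u = of_real \<bar>exp u\<bar> * f (exp u)" for u :: real
  proof -
    have "complex_of_real (exp u) powr (z - 1) = exp ((z - 1) * of_real u)"
      by (simp add: powr_def Ln_of_real)
    then have "of_real \<bar>exp u\<bar> * f (exp u) = exp (of_real u) * exp ((z - 1) * of_real u) * exp (- of_real (exp u))"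
      by (simp add: f_def exp_of_real[symmetric] exp_minus divide_inverse)
    also have "\<dots> = h u" unfolding h_def exp_add[symmetric] by (simp add: algebra_simps)
    finally show ?thesis ..
  qed
  have range: "range exp = {0::real<..}" by (auto simp: image_iff) (metis exp_ln)
  have part: "(\<lambda>u. \<bar>exp u\<bar> * g (exp u)) absolutely_integrable_on UNIV \<and>
      integral UNIV (\<lambda>u. \<bar>exp u\<bar> * g (exp u)) = b"
    if "g absolutely_integrable_on {0<..}" "integral {0<..} g = b" for g :: "real \<Rightarrow> real" and b
    using has_absolute_integral_change_of_variables_1'[of UNIV exp exp g b] that range
    by (auto intro!: derivative_eq_intros simp: inj_on_def)
  have Re: "(\<lambda>u. Re (h u)) absolutely_integrable_on UNIV \<and> integral UNIV (\<lambda>u. Re (h u)) = Re (Gamma z)"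
  proof -
    have "(\<lambda>x. Re (f x)) absolutely_integrable_on {0<..}"
      using absolutely_integrable_linear[OF ai bounded_linear_Re] by (simp add: o_def)
    moreover have "integral {0<..} (\<lambda>x. Re (f x)) = Re (Gamma z)"
      using has_integral_linear[OF hi bounded_linear_Re] by (simp add: o_def integral_unique)
    ultimately show ?thesis using part[of "\<lambda>x. Re (f x)"] by (simp add: hf)
  qed
  have Im: "(\<lambda>u. Im (h u)) absolutely_integrable_on UNIV \<and> integral UNIV (\<lambda>u. Im (h u)) = Im (Gamma z)"
  proof -
    have "(\<lambda>x. Im (f x)) absolutely_integrable_on {0<..}"
      using absolutely_integrable_linear[OF ai bounded_linear_Im] by (simp add: o_def)
    moreover have "integral {0<..} (\<lambda>x. Im (f x)) = Im (Gamma z)"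
      using has_integral_linear[OF hi bounded_linear_Im] by (simp add: o_def integral_unique)
    ultimately show ?thesis using part[of "\<lambda>x. Im (f x)"] by (simp add: hf)
  qed
  have cont: "continuous_on UNIV h" unfolding h_def by (intro continuous_intros)
  have lb: "has_bochner_integral lborel g b"
    if "g absolutely_integrable_on UNIV \<and> integral UNIV g = b" "continuous_on UNIV g" for g :: "real \<Rightarrow> real" and b
  proof -
    have m: "g \<in> borel_measurable borel" using that borel_measurable_continuous_onI by blast
    have "integrable lebesgue g" using that by (simp add: set_integrable_def)
    then have i: "integrable lborel g" using m integrable_completion[of g lborel] by simp
    then show ?thesis using that integral_lborel[OF i] by (simp add: has_bochner_integral_iff)
  qed
  have "has_bochner_integral lborel (\<lambda>u. Re (h u)) (Re (Gamma z))"
       "has_bochner_integral lborel (\<lambda>u. Im (h u)) (Im (Gamma z))"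
    by (intro lb Re Im continuous_intros cont)+
  then have "has_bochner_integral lborel (\<lambda>u. of_real (Re (h u)) + \<i> * of_real (Im (h u)))
      (of_real (Re (Gamma z)) + \<i> * of_real (Im (Gamma z)))"
    by (intro has_bochner_integral_add has_bochner_integral_mult_right has_bochner_integral_of_real)
  then show ?thesis by (simp add: complex_eq[symmetric] h_def)
qed

text \<open>In the logarithmic variable the modular transformation of theta is the reflection \<open>u \<mapsto> - u\<close>.\<close>
definition theta_tail :: "real \<Rightarrow> real" where
  "theta_tail u = (\<Sum>k. exp (- pi * (real (k + 1))\<^sup>2 * exp (2 * u)))"

lemma summable_theta_tail: "summable (\<lambda>k. exp (- pi * (real (k + 1))\<^sup>2 * exp (2 * u)))"
  by (rule summable_exp_gaussian) simp

lemma theta_tail_nonneg: "theta_tail u \<ge> 0"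
  unfolding theta_tail_def by (intro suminf_nonneg summable_theta_tail) auto

lemma theta_tail_measurable [measurable]: "theta_tail \<in> borel_measurable borel"
  unfolding theta_tail_def[abs_def] by measurable

text \<open>The modular relation at \<open>exp (2 * u)\<close>, solved for the tail at
  \<open>- u\<close>. The two terms without \<open>theta_tail\<close> stem from the constant term of
  theta; in the Mellin integral they become the polar terms \<open>1 / (s - 1)\<close> and
  \<open>1 / s\<close>.\<close>

lemma theta_tail_minus: "theta_tail (- u) = exp u * theta_tail u + exp u / 2 - 1 / 2"
proof -
  have "exp (2 * (- u)) = inverse (exp (2 * u))" by (simp add: exp_minus)
  then have e: "exp (- pi * (real (k + 1))\<^sup>2 * exp (2 * (- u))) = exp (- pi * (real (k + 1))\<^sup>2 / exp (2 * u))" for k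
    by (simp add: divide_inverse)
  have s: "sqrt (exp (2 * u)) = exp u"
    by (rule real_sqrt_unique) (auto simp: exp_double)
  have "1 + 2 * theta_tail u = (1 + 2 * theta_tail (- u)) / exp u"
    using theta_functional_equation[of "exp (2 * u)"]
    unfolding theta_tail_def e s by simp
  then show ?thesis by (simp add: field_simps)
qed

text \<open>Since \<open>(k + 1)^2 * x >= x + k\<close> for \<open>x >= 1\<close>, the tail is
  dominated by a geometric series of ratio \<open>exp (- pi) <= 1/2\<close>, whose sum is at most
  2.\<close>

lemma theta_tail_upper:
  assumes u: "u \<ge> 0"
  shows "theta_tail u \<le> 2 * exp (- pi * exp (2 * u))"
proof -
  define x where "x = exp (2 * u)"
  have x: "x \<ge> 1" using u by (simp add: x_def)
  have q: "exp (- pi) \<le> 1 / 2"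
  proof -
    have "exp pi \<ge> 2" using exp_ge_add_one_self[of pi] pi_gt3 by linarith
    then show ?thesis by (simp add: exp_minus field_simps)
  qed
  have le: "exp (- pi * (real (k + 1))\<^sup>2 * x) \<le> exp (- pi * x) * exp (- pi) ^ k" for k
  proof -
    have "1 * x + real k * 1 \<le> 1 * x + real k * x" using x by (intro add_left_mono mult_left_mono) auto
    also have "\<dots> = (1 + real k) * x" by (simp add: algebra_simps)
    also have "\<dots> \<le> (real (k + 1))\<^sup>2 * x"
      using x by (intro mult_right_mono) (auto simp: power2_eq_square algebra_simps)
    finally have "pi * (x + real k) \<le> pi * ((real (k + 1))\<^sup>2 * x)" by (intro mult_left_mono) auto
    then show ?thesis by (simp add: exp_of_nat_mult[symmetric] exp_add[symmetric] algebra_simps)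
  qed
  have gs: "(\<lambda>k. exp (- pi * x) * exp (- pi) ^ k) sums (exp (- pi * x) * (1 / (1 - exp (- pi))))"
    by (intro sums_mult geometric_sums) (use q in auto)
  have "theta_tail u \<le> (\<Sum>k. exp (- pi * x) * exp (- pi) ^ k)"
    unfolding theta_tail_def x_def[symmetric]
    by (intro suminf_le le sums_summable[OF gs]) (use summable_theta_tail[of u] in \<open>simp add: x_def\<close>)
  also have "\<dots> = exp (- pi * x) * (1 / (1 - exp (- pi)))" using gs by (rule sums_unique[symmetric])
  also have "\<dots> \<le> exp (- pi * x) * 2"
    using q by (intro mult_left_mono) (auto simp: divide_le_eq)
  finally show ?thesis by (simp add: x_def)
qed

text \<open>The Gamma integral at \<open>s / 2\<close> in the variable \<open>L + 2 * u\<close> with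
  \<open>exp L = pi * n^2\<close>: the translation yields the powers of \<open>pi\<close> and of
  \<open>n\<close>, the scaling by 2 the final division by 2.\<close>

lemma mellin_term:
  fixes s :: complex and k :: nat
  assumes s: "Re s > 0"
  shows "has_bochner_integral lborel (\<lambda>u. exp (s * of_real u) * of_real (exp (- pi * (real (k + 1))\<^sup>2 * exp (2 * u))))
           (of_real pi powr (- s / 2) * Gamma (s / 2) * (1 / of_nat (Suc k) powr s) / 2)"
proof -
  define n where "n = real (k + 1)"
  have n: "n > 0" by (simp add: n_def)
  define L where "L = ln (pi * n\<^sup>2)"
  have L: "exp L = pi * n\<^sup>2" using n by (simp add: L_def)
  have "has_bochner_integral lborel (\<lambda>u. exp (s / 2 * of_real (L + 2 * u) - of_real (exp (L + 2 * u)))) (Gamma (s / 2) /\<^sub>R \<bar>2\<bar>)"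
    by (rule lborel_has_bochner_integral_real_affine_iff[THEN iffD1, OF _ Gamma_integral_exp])
      (use s in auto)
  then have "has_bochner_integral lborel (\<lambda>u. exp (- s / 2 * of_real L) * exp (s / 2 * of_real (L + 2 * u) - of_real (exp (L + 2 * u))))
      (exp (- s / 2 * of_real L) * (Gamma (s / 2) /\<^sub>R \<bar>2\<bar>))"
    by (rule has_bochner_integral_mult_right)
  also have "(\<lambda>u. exp (- s / 2 * of_real L) * exp (s / 2 * of_real (L + 2 * u) - of_real (exp (L + 2 * u))))
      = (\<lambda>u. exp (s * of_real u) * of_real (exp (- pi * n\<^sup>2 * exp (2 * u))))"
  proof
    fix u :: real
    have e: "exp (L + 2 * u) = pi * n\<^sup>2 * exp (2 * u)" by (simp add: exp_add L)
    show "exp (- s / 2 * of_real L) * exp (s / 2 * of_real (L + 2 * u) - of_real (exp (L + 2 * u))) =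
      exp (s * of_real u) * of_real (exp (- pi * n\<^sup>2 * exp (2 * u)))"
      unfolding e exp_of_real[symmetric] exp_add[symmetric] by (simp add: algebra_simps)
  qed
  also have "exp (- s / 2 * of_real L) = of_real pi powr (- s / 2) * (1 / of_nat (Suc k) powr s)"
  proof -
    have "L = ln pi + 2 * ln n" using n by (simp add: L_def ln_mult ln_realpow)
    then have "exp (- s / 2 * of_real L) = exp (- s / 2 * of_real (ln pi)) * exp (- (s * of_real (ln n)))"
      unfolding exp_add[symmetric] by (simp add: algebra_simps)
    also have "exp (- s / 2 * of_real (ln pi)) = of_real pi powr (- s / 2)"
      by (simp add: powr_def Ln_of_real)
    also have "exp (- (s * of_real (ln n))) = 1 / of_nat (Suc k) powr s"
    proof -
      have "(of_nat (Suc k) :: complex) = of_real n" by (simp add: n_def)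
      then have "of_nat (Suc k) powr s = exp (s * of_real (ln n))"
        using n by (simp add: powr_def Ln_of_real)
      then show ?thesis by (simp add: exp_minus divide_inverse)
    qed
    finally show ?thesis .
  qed
  also have "of_real pi powr (- s / 2) * (1 / of_nat (Suc k) powr s) * (Gamma (s / 2) /\<^sub>R \<bar>2\<bar>)
      = of_real pi powr (- s / 2) * Gamma (s / 2) * (1 / of_nat (Suc k) powr s) / 2"
  proof -
    have "a * b * (g /\<^sub>R \<bar>2\<bar>) = a * g * b / 2" for a b g :: complex
      by (simp add: scaleR_conv_of_real)
    then show ?thesis .
  qed
  finally show ?thesis unfolding n_def .
qed

lemma mellin_theta:
  fixes s :: complex
  assumes s: "Re s > 1"
  shows "has_bochner_integral lborel (\<lambda>u. exp (s * of_real u) * of_real (theta_tail u))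
           (of_real pi powr (- s / 2) * Gamma (s / 2) * dirichlet_zeta s / 2)"
proof -
  define T where "T = (\<lambda>s (k::nat) u. exp (s * of_real u) * complex_of_real (exp (- pi * (real (k + 1))\<^sup>2 * exp (2 * u))))"
  define c where "c = (\<lambda>s::complex. of_real pi powr (- s / 2) * Gamma (s / 2))"
  have T: "has_bochner_integral lborel (T w k) (c w * (1 / of_nat (Suc k) powr w) / 2)" if "Re w > 1" for w k
    unfolding T_def c_def using that by (intro mellin_term) auto
  define r where "r = complex_of_real (Re s)"
  have r: "Re r > 1" using s by (simp add: r_def)
  \<comment> \<open>Taking norms replaces \<open>s\<close> by \<open>Re s\<close>, so the integrals
    of the norms are, up to a constant factor, the terms of the convergent Dirichlet series at
    \<open>Re s\<close>.\<close>
  have nT: "complex_of_real (norm (T s k u)) = T r k u" for k u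
    unfolding T_def norm_mult by (simp add: r_def exp_of_real[symmetric])
  have A1: "\<And>k. integrable lborel (T s k)" using T[OF s] by (auto simp: has_bochner_integral_iff)
  have A2: "summable (\<lambda>k. norm (T s k u))" for u
  proof -
    have "norm (T s k u) = norm (exp (s * of_real u)) * exp (- pi * (real (k + 1))\<^sup>2 * exp (2 * u))" for k
      unfolding T_def norm_mult by simp
    then show ?thesis by (simp only: summable_mult[OF summable_theta_tail])
  qed
  have A3: "summable (\<lambda>k. \<integral>u. norm (T s k u) \<partial>lborel)"
  proof -
    have "complex_of_real (\<integral>u. norm (T s k u) \<partial>lborel) = c r * (1 / of_nat (Suc k) powr r) / 2" for k
      using T[OF r, of k] unfolding integral_complex_of_real[symmetric] nT
      by (simp add: has_bochner_integral_iff)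
    moreover have "summable (\<lambda>k. c r * (1 / of_nat (Suc k) powr r) / 2)"
      by (intro summable_divide summable_mult sums_summable[OF dirichlet_zeta_sums[OF r]])
    ultimately have "summable (\<lambda>k. complex_of_real (\<integral>u. norm (T s k u) \<partial>lborel))" by simp
    then show ?thesis by (simp only: summable_complex_of_real)
  qed
  have S: "(\<Sum>k. T s k u) = exp (s * of_real u) * of_real (theta_tail u)" for u
  proof -
    have "(\<lambda>k. exp (s * of_real u) * complex_of_real (exp (- pi * (real (k + 1))\<^sup>2 * exp (2 * u)))) sums
      (exp (s * of_real u) * of_real (theta_tail u))"
      unfolding theta_tail_def by (intro sums_mult sums_of_real summable_sums summable_theta_tail)
    then show ?thesis unfolding T_def by (rule sums_unique[symmetric])
  qed
  have "(\<lambda>k. c s * (1 / of_nat (Suc k) powr s) / 2) sums integral\<^sup>L lborel (\<lambda>u. \<Sum>k. T s k u)"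
    using sums_integral[of lborel "T s", OF A1 AE_I2[OF A2] A3] T[OF s] by (simp add: has_bochner_integral_iff)
  moreover have "(\<lambda>k. c s * (1 / of_nat (Suc k) powr s) / 2) sums (c s * dirichlet_zeta s / 2)"
    by (intro sums_divide sums_mult dirichlet_zeta_sums s)
  ultimately have "integral\<^sup>L lborel (\<lambda>u. \<Sum>k. T s k u) = c s * dirichlet_zeta s / 2"
    using sums_unique2 by blast
  moreover have "integrable lborel (\<lambda>u. \<Sum>k. T s k u)"
    by (rule integrable_suminf[OF A1 AE_I2[OF A2] A3])
  ultimately show ?thesis unfolding S by (simp add: has_bochner_integral_iff c_def)
qed

section \<open>The even entire transform behind \<open>Xi\<close>\<close>

text \<open>The weight left after folding the Mellin integral at \<open>u = 0\<close>. The factor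
  \<open>exp (u / 2)\<close> centres the exponents at the critical line: \<open>s\<close> enters
  only through \<open>exp (z * u)\<close> and \<open>exp (- z * u)\<close> with
  \<open>z = s - 1/2\<close>.\<close>

definition half_weight :: "real \<Rightarrow> real" where
  "half_weight u = indicator {0..} u * (exp (u / 2) * theta_tail u)"

lemma half_weight_nonneg: "half_weight u \<ge> 0"
  by (simp add: half_weight_def theta_tail_nonneg)

lemma half_weight_measurable [measurable]: "half_weight \<in> borel_measurable borel"
  unfolding half_weight_def[abs_def] by measurable

text \<open>The origin of the order 3/4. The cubic minorant of \<open>exp (2 * u)\<close> leads to
  \<open>r * u - u^3 <= r powr (3/2)\<close>, proved by comparing \<open>u\<close> with
  \<open>sqrt r\<close>; for \<open>r = norm (csqrt v)\<close> the right side is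
  \<open>norm v powr (3/4)\<close>. A quadratic minorant would give exponent 2, hence only order 1
  in \<open>v\<close>. The constant in \<open>exp (- 3)\<close> comes from \<open>pi > 3\<close>,
  and the linear terms pay for the integrable factor \<open>exp (- u)\<close>.\<close>

lemma half_weight_upper:
  assumes r: "r \<ge> 0"
  shows "half_weight u * exp (r * u) \<le> 2 * exp (- 3) * exp (r powr (3/2)) * (indicator {0..} u * exp (- u))"
proof (cases "u \<ge> 0")
  case True
  have cube: "exp (2 * u) \<ge> 1 + 2 * u + u ^ 3"
  proof -
    have "(\<Sum>k<4. (2 * u) ^ k /\<^sub>R fact k) \<le> exp (2 * u)"
      using True unfolding exp_def
      by (intro sum_le_suminf summable_exp_generic) auto
    moreover have "(\<Sum>k<4. (2 * u) ^ k /\<^sub>R fact k) = 1 + 2 * u + 2 * u\<^sup>2 + 4 / 3 * u ^ 3"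
      by (simp add: eval_nat_numeral fact_numeral)
    moreover have "u\<^sup>2 \<ge> 0" "u ^ 3 \<ge> 0" using True by auto
    ultimately show ?thesis by linarith
  qed
  have ru: "r * u - u ^ 3 \<le> r powr (3/2)"
  proof (cases "u\<^sup>2 \<le> r")
    case True': True
    then have "u \<le> sqrt r" using real_le_rsqrt by blast
    then have "r * u \<le> r * sqrt r" using r by (intro mult_left_mono)
    also have "\<dots> = r powr (3/2)"
    proof (cases "r = 0")
      case False
      then have "r powr (3/2) = r powr 1 * r powr (1/2)" unfolding powr_add[symmetric] by simp
      then show ?thesis using r by (simp add: powr_half_sqrt)
    qed auto
    finally show ?thesis using True by (smt (verit) zero_le_power)
  next
    case False
    then have "r * u \<le> u\<^sup>2 * u" using True by (intro mult_right_mono) auto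
    also have "\<dots> = u ^ 3" by (simp add: power2_eq_square power3_eq_cube)
    finally show ?thesis using powr_ge_zero[of r "3/2"] by linarith
  qed
  have "pi * exp (2 * u) \<ge> 3 * (1 + 2 * u + u ^ 3)"
    using cube True pi_gt3 by (intro mult_mono) auto
  moreover have "u ^ 3 \<ge> 0" using True by auto
  moreover have "3 * (1 + 2 * u + u ^ 3) = 3 + 6 * u + 3 * u ^ 3" by simp
  ultimately have e: "u / 2 + - pi * exp (2 * u) + r * u \<le> - 3 + r powr (3/2) + - u"
    using ru True by linarith
  have "half_weight u * exp (r * u) \<le> exp (u / 2) * (2 * exp (- pi * exp (2 * u))) * exp (r * u)"
    using True theta_tail_upper[OF True] by (auto simp: half_weight_def intro!: mult_right_mono mult_left_mono)
  also have "\<dots> = 2 * exp (u / 2 + - pi * exp (2 * u) + r * u)"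
    unfolding exp_add by simp
  also have "\<dots> \<le> 2 * exp (- 3 + r powr (3/2) + - u)" using e by simp
  also have "\<dots> = 2 * exp (- 3) * exp (r powr (3/2)) * exp (- u)" unfolding exp_add by simp
  finally show ?thesis using True by simp
qed (simp add: half_weight_def)

lemma has_bochner_integral_exp_half: "has_bochner_integral lborel (\<lambda>u::real. indicator {0..} u * exp (- u)) 1"
proof -
  have "has_bochner_integral lborel (\<lambda>u::real. u ^ 0 * exp (- u) * indicator {0..} u) (fact 0)"
    by (rule has_bochner_integral_I0i_power_exp_m')
  then show ?thesis by (simp add: mult.commute)
qed

lemma has_bochner_integral_exp_complex_half:
  fixes w :: complex
  assumes w: "Re w > 0"
  shows "has_bochner_integral lborel (\<lambda>u::real. indicator {0..} u *\<^sub>R exp (- w * of_real u)) (1 / w)"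
proof -
  define f where "f = (\<lambda>u::real. indicator {0..} u *\<^sub>R exp (- w * of_real u))"
  have "integrable lborel (\<lambda>u::real. indicator {0..} (0 + Re w * u) * exp (- (0 + Re w * u)))"
    using has_bochner_integral_exp_half w
    by (intro lborel_integrable_real_affine) (auto simp: has_bochner_integral_iff)
  then have int: "integrable lborel f"
    by (rule Bochner_Integration.integrable_bound)
      (use w in \<open>auto simp: f_def indicator_def zero_le_mult_iff\<close>)
  then have "(\<lambda>N. integral {- real N..real N} f) \<longlonglongrightarrow> integral\<^sup>L lborel f"
    by (intro integral_symmetric_interval_LIMSEQ filterlim_real_sequentially has_bochner_integral_integrable)
  moreover have "integral {- real N..real N} f = (1 - exp (- w * of_nat N)) / w" for N
  proof -
    have "((\<lambda>u. exp (- w * of_real u)) has_integral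
        (- exp (- w * of_real (real N)) / w - (- exp (- w * of_real 0) / w))) {0..real N}"
      using w by (intro fundamental_theorem_of_calculus)
        (auto intro!: derivative_eq_intros has_vector_derivative_real_field)
    then have "integral {0..real N} (\<lambda>u. exp (- w * of_real u)) = (1 - exp (- w * of_nat N)) / w"
      by (simp add: integral_unique diff_divide_distrib)
    moreover have "integral {- real N..real N} f = integral {0..real N} (\<lambda>u. exp (- w * of_real u))"
    proof -
      have "f = (\<lambda>u. if u \<in> {0..} then exp (- w * of_real u) else 0)"
        by (auto simp: f_def fun_eq_iff)
      moreover have "{- real N..real N} \<inter> {0..} = {0..real N}" by auto
      ultimately show ?thesis
        using integral_restrict_Int[of "{- real N..real N}" "{0..}" "\<lambda>u. exp (- w * of_real u)"]
        by (simp add: Int_commute)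
    qed
    ultimately show ?thesis by simp
  qed
  moreover have "(\<lambda>N. (1 - exp (- w * of_nat N)) / w) \<longlonglongrightarrow> (1 - 0) / w"
  proof -
    have "norm (exp (- w)) < 1" using w by simp
    then have "(\<lambda>N. exp (- w) ^ N) \<longlonglongrightarrow> 0" by (rule LIMSEQ_power_zero)
    then have "(\<lambda>N. exp (- w * of_nat N)) \<longlonglongrightarrow> 0"
      by (simp add: exp_of_nat_mult[symmetric] mult.commute)
    then show ?thesis by (intro tendsto_intros) (use w in auto)
  qed
  ultimately have "integral\<^sup>L lborel f = 1 / w" using LIMSEQ_unique by fastforce
  then show ?thesis using int by (simp add: f_def has_bochner_integral_iff)
qed

lemma half_weight_integrable:
  assumes [measurable]: "f \<in> borel_measurable borel" and "r \<ge> 0" and le: "\<And>u. u \<ge> 0 \<Longrightarrow> norm (f u) \<le> exp (r * u)"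
  shows "integrable lborel (\<lambda>u. of_real (half_weight u) * (f u :: complex))"
    and "norm (\<integral>u. of_real (half_weight u) * f u \<partial>lborel) \<le> 2 * exp (- 3) * exp (r powr (3/2))"
proof -
  let ?g = "\<lambda>u::real. 2 * exp (- 3) * exp (r powr (3/2)) * (indicator {0..} u * exp (- u))"
  have g: "has_bochner_integral lborel ?g (2 * exp (- 3) * exp (r powr (3/2)) * 1)"
    by (intro has_bochner_integral_mult_right has_bochner_integral_exp_half)
  have bd: "norm (of_real (half_weight u) * f u) \<le> ?g u" for u
  proof -
    have "norm (of_real (half_weight u) * f u) \<le> half_weight u * exp (r * u)"
    proof (cases "u \<ge> 0")
      case True
      then show ?thesis using le[OF True] half_weight_nonneg[of u]
        by (simp add: norm_mult mult_left_mono)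
    qed (simp add: half_weight_def)
    also have "\<dots> \<le> ?g u" by (rule half_weight_upper[OF \<open>r \<ge> 0\<close>])
    finally show ?thesis .
  qed
  have ig: "integrable lborel ?g" using g by (simp add: has_bochner_integral_iff)
  show i: "integrable lborel (\<lambda>u. of_real (half_weight u) * f u)"
    by (rule Bochner_Integration.integrable_bound[OF ig]) (use bd in \<open>auto intro!: AE_I2 order_trans[OF bd]\<close>)
  have "norm (\<integral>u. of_real (half_weight u) * f u \<partial>lborel) \<le> integral\<^sup>L lborel ?g"
    using integral_norm_bound[of lborel "\<lambda>u. of_real (half_weight u) * f u"]
      integral_mono[OF integrable_norm[OF i] ig bd] by linarith
  also have "\<dots> = 2 * exp (- 3) * exp (r powr (3/2))"
    using has_bochner_integral_integral_eq[OF g] by simp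
  finally show "norm (\<integral>u. of_real (half_weight u) * f u \<partial>lborel) \<le> 2 * exp (- 3) * exp (r powr (3/2))" .
qed

text \<open>Four times this is the completed zeta function at \<open>s = 1/2 + z\<close> without its
  polar part \<open>1 / (s - 1) - 1 / s\<close>.\<close>

definition cosh_transform :: "complex \<Rightarrow> complex" where
  "cosh_transform z = (\<integral>u. of_real (half_weight u) * cosh (z * of_real u) \<partial>lborel)"

lemma norm_cosh_le:
  fixes w :: complex
  shows "norm (cosh w) \<le> exp (norm w)"
proof -
  have "norm (exp w + exp (- w)) \<le> exp (norm w) + exp (norm w)"
    using norm_exp[of w] norm_exp[of "- w"] by (intro norm_triangle_mono) auto
  then show ?thesis by (simp add: cosh_def norm_divide scaleR_conv_of_real)
qed

lemma cosh_transform_norm: "norm (cosh_transform z) \<le> 2 * exp (- 3) * exp (norm z powr (3/2))"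
  unfolding cosh_transform_def
proof (rule half_weight_integrable(2))
  fix u :: real assume "u \<ge> 0"
  then show "norm (cosh (z * of_real u)) \<le> exp (norm z * u)"
    using norm_cosh_le[of "z * of_real u"] by (simp add: norm_mult)
qed (auto simp: cosh_def intro!: borel_measurable_continuous_onI continuous_intros)

lemma cosh_even_sums:
  fixes w :: "'a :: {banach, real_normed_field}"
  shows "(\<lambda>k. w ^ (2 * k) / fact (2 * k)) sums cosh w"
proof -
  have "(\<lambda>n. if even n then w ^ n /\<^sub>R fact n else 0) sums cosh w"
    by (rule cosh_converges)
  then have "(\<lambda>k. if even (2 * k) then w ^ (2 * k) /\<^sub>R fact (2 * k) else 0) sums cosh w"
    by (subst sums_mono_reindex[of "\<lambda>k. 2 * k"]) (auto simp: strict_mono_def)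
  then show ?thesis by (simp add: scaleR_conv_of_real field_simps)
qed

definition cosh_moment :: "nat \<Rightarrow> complex" where
  "cosh_moment k = (\<integral>u. of_real (half_weight u) * of_real (u ^ (2 * k) / fact (2 * k)) \<partial>lborel)"

text \<open>Termwise integration of the even power series of cosh exhibits the transform as a power
  series in \<open>z^2\<close>, which is what permits the variable \<open>v\<close>. All partial
  sums of norms lie below \<open>cosh (norm z * u) <= exp (norm z * u)\<close>, so
  \<open>half_weight_upper\<close> provides one majorant for them.\<close>

lemma cosh_transform_sums: "(\<lambda>k. cosh_moment k * (z\<^sup>2) ^ k) sums cosh_transform z"
proof -
  define T where "T = (\<lambda>k u. of_real (half_weight u) * ((z * of_real u) ^ (2 * k) / fact (2 * k)))"
  have le: "(\<Sum>k<n. norm ((z * of_real u) ^ (2 * k) / fact (2 * k))) \<le> exp (norm z * u)" if "u \<ge> 0" for u :: real and n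
  proof -
    have "(\<Sum>k<n. norm ((z * of_real u) ^ (2 * k) / fact (2 * k))) = (\<Sum>k<n. (norm z * u) ^ (2 * k) / fact (2 * k))"
      using that by (simp add: norm_divide norm_power norm_mult)
    also have "\<dots> \<le> cosh (norm z * u)"
      using cosh_even_sums[of "norm z * u"] that
      by (subst sums_unique[OF cosh_even_sums]) (auto intro!: sum_le_suminf sums_summable)
    also have "\<dots> \<le> exp (norm z * u)" using that by (simp add: cosh_def)
    finally show ?thesis .
  qed
  have A1: "integrable lborel (T k)" for k
    unfolding T_def
  proof (rule half_weight_integrable(1))
    show "norm ((z * of_real u) ^ (2 * k) / fact (2 * k)) \<le> exp (norm z * u)" if "u \<ge> 0" for u :: real
      using le[OF that, of "Suc k"] sum_nonneg[of "{..<k}" "\<lambda>k. norm ((z * of_real u) ^ (2 * k) / fact (2 * k))"]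
      by simp
  qed auto
  have A2: "summable (\<lambda>k. norm (T k u))" for u
  proof -
    have "summable (\<lambda>k. norm (half_weight u) * ((norm z * \<bar>u\<bar>) ^ (2 * k) / fact (2 * k)))"
      by (intro summable_mult sums_summable[OF cosh_even_sums])
    then show ?thesis by (simp add: T_def norm_mult norm_divide norm_power)
  qed
  have A3: "summable (\<lambda>k. \<integral>u. norm (T k u) \<partial>lborel)"
  proof (rule summableI_nonneg_bounded)
    let ?g = "\<lambda>u::real. 2 * exp (- 3) * exp (norm z powr (3/2)) * (indicator {0..} u * exp (- u))"
    have g: "has_bochner_integral lborel ?g (2 * exp (- 3) * exp (norm z powr (3/2)) * 1)"
      by (intro has_bochner_integral_mult_right has_bochner_integral_exp_half)
    fix n
    have "(\<Sum>k<n. \<integral>u. norm (T k u) \<partial>lborel) = (\<integral>u. (\<Sum>k<n. norm (T k u)) \<partial>lborel)"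
      by (intro Bochner_Integration.integral_sum[symmetric] integrable_norm A1)
    also have "\<dots> \<le> integral\<^sup>L lborel ?g"
    proof (rule integral_mono)
      fix u :: real
      have "(\<Sum>k<n. norm (T k u)) = half_weight u * (\<Sum>k<n. norm ((z * of_real u) ^ (2 * k) / fact (2 * k)))"
        unfolding T_def norm_mult sum_distrib_left using half_weight_nonneg[of u] by simp
      also have "\<dots> \<le> half_weight u * exp (norm z * u)"
      proof (cases "u \<ge> 0")
        case True
        then show ?thesis by (intro mult_left_mono le half_weight_nonneg)
      qed (simp add: half_weight_def)
      also have "\<dots> \<le> ?g u" by (rule half_weight_upper) simp
      finally show "(\<Sum>k<n. norm (T k u)) \<le> ?g u" .
    qed (use g A1 in \<open>auto simp: has_bochner_integral_iff\<close>)
    also have "\<dots> = 2 * exp (- 3) * exp (norm z powr (3/2)) * 1"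
      by (rule has_bochner_integral_integral_eq[OF g])
    finally show "(\<Sum>k<n. \<integral>u. norm (T k u) \<partial>lborel) \<le> 2 * exp (- 3) * exp (norm z powr (3/2)) * 1" .
  qed auto
  have S: "(\<Sum>k. T k u) = of_real (half_weight u) * cosh (z * of_real u)" for u
    unfolding T_def by (intro sums_unique[symmetric] sums_mult cosh_even_sums)
  have M: "integral\<^sup>L lborel (T k) = cosh_moment k * (z\<^sup>2) ^ k" for k
  proof -
    have "T k = (\<lambda>u. of_real (half_weight u) * of_real (u ^ (2 * k) / fact (2 * k)) * (z\<^sup>2) ^ k)"
      by (auto simp: T_def fun_eq_iff power_mult_distrib power_mult[symmetric])
    then show ?thesis by (simp add: cosh_moment_def)
  qed
  show ?thesis
    using sums_integral[of lborel T, OF A1 AE_I2[OF A2] A3] unfolding S M cosh_transform_def .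
qed

text \<open>
  \<open>cosh_transform\<close> is even, so the branch of the square root is immaterial and \<open>Xi\<close> is entire.
\<close>
definition Xi :: "complex \<Rightarrow> complex" where
  "Xi v = 1 + (v - 1 / 4) * (4 * cosh_transform (csqrt v))"

lemma cosh_transform_csqrt: "cosh_transform (csqrt (z\<^sup>2)) = cosh_transform z"
  using cosh_transform_sums[of "csqrt (z\<^sup>2)"] cosh_transform_sums[of z] sums_unique2 by simp

lemma Xi_square: "Xi (z\<^sup>2) = 1 + (z\<^sup>2 - 1 / 4) * (4 * cosh_transform z)"
  by (simp add: Xi_def cosh_transform_csqrt)

text \<open>\<open>csqrt\<close> jumps across its cut, so composition proves nothing there; the
  moment series, being a power series in \<open>v\<close>, does.\<close>

lemma Xi_entire: "Xi holomorphic_on UNIV"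
proof -
  have hol: "(\<lambda>v. cosh_transform (csqrt v)) holomorphic_on ball 0 r" for r
  proof (rule power_series_holomorphic)
    show "(\<lambda>k. cosh_moment k * (v - 0) ^ k) sums cosh_transform (csqrt v)" for v
      using cosh_transform_sums[of "csqrt v"] by simp
  qed
  have "(\<lambda>v. cosh_transform (csqrt v)) field_differentiable at w" for w
    by (rule holomorphic_on_imp_differentiable_at[OF hol[of "norm w + 1"]]) auto
  then have "(\<lambda>v. cosh_transform (csqrt v)) holomorphic_on UNIV"
    by (simp add: holomorphic_on_def)
  then show ?thesis unfolding Xi_def[abs_def] by (intro holomorphic_intros)
qed

text \<open>\<open>8 = 4 * 2\<close>: the 4 in \<open>Xi\<close> times the 2 in
  \<open>cosh_transform_norm\<close>.\<close>

lemma exp_minus_3_le: "8 * exp (- 3 :: real) \<le> 1"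
proof -
  have "(2::real) ^ 3 \<le> exp 1 ^ 3" using exp_ge_add_one_self[of 1] by (intro power_mono) auto
  then have "8 \<le> exp (3::real)" by (simp add: exp_of_nat_mult[symmetric])
  then show ?thesis by (simp add: exp_minus field_simps)
qed

lemma Xi_0_nonzero: "Xi 0 \<noteq> 0"
proof
  assume "Xi 0 = 0"
  then have "cosh_transform 0 = 1" by (simp add: Xi_def)
  then show False using cosh_transform_norm[of 0] exp_minus_3_le by simp
qed

lemma Xi_growth: "norm (Xi v) \<le> exp (4 * (1 + norm v) powr (3/4))"
proof -
  define x where "x = 1 + norm v"
  have x: "x \<ge> 1" by (simp add: x_def)
  define E where "E = exp (x powr (3/4))"
  have xp: "x powr (3/4) \<ge> 1" using x by (simp add: ge_one_powr_ge_zero)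
  have "norm (csqrt v) powr (3/2) = norm v powr (3/4)"
    by (simp add: norm_csqrt powr_half_sqrt[symmetric] powr_powr)
  also have "\<dots> \<le> x powr (3/4)" by (intro powr_mono2) (auto simp: x_def)
  finally have "2 * exp (- 3) * exp (norm (csqrt v) powr (3/2)) \<le> 2 * exp (- 3) * E"
    by (simp add: E_def)
  then have "norm (cosh_transform (csqrt v)) \<le> 2 * exp (- 3) * E"
    using cosh_transform_norm[of "csqrt v"] by linarith
  then have "norm (4 * cosh_transform (csqrt v)) \<le> (8 * exp (- 3)) * E"
    unfolding norm_mult by (simp add: mult_ac)
  also have "\<dots> \<le> 1 * E" using exp_minus_3_le by (intro mult_right_mono) (auto simp: E_def)
  finally have J: "norm (4 * cosh_transform (csqrt v)) \<le> E" by simp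
  have E1: "E \<ge> 1" using xp by (simp add: E_def)
  have "norm (Xi v) \<le> 1 + norm (v - 1/4) * norm (4 * cosh_transform (csqrt v))"
    unfolding Xi_def by (metis norm_triangle_ineq norm_one norm_mult)
  also have "\<dots> \<le> E + x * E"
    using E1 J norm_triangle_ineq4[of v "1/4"] x_def
    by (intro add_mono mult_mono) auto
  also have "\<dots> \<le> 2 * x * E" using x E1 by (simp add: algebra_simps)
  \<comment> \<open>The constant 2 costs one factor \<open>E\<close> and the polynomial factor
    \<open>x\<close> two more, whence the 4 in the final exponent.\<close>
  also have "\<dots> \<le> E * (E * E) * E"
  proof -
    have "2 \<le> E" using exp_ge_add_one_self[of "x powr (3/4)"] xp unfolding E_def by linarith
    moreover have "x \<le> E * E"
    proof -
      have "ln x = 4/3 * ln (x powr (3/4))" using x by (simp add: ln_powr)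
      also have "ln (x powr (3/4)) \<le> x powr (3/4)"
        using xp by (intro less_imp_le[OF ln_less_self]) auto
      finally have "ln x \<le> 2 * x powr (3/4)" using xp by simp
      then have "exp (ln x) \<le> exp (2 * x powr (3/4))" by simp
      then show ?thesis using x by (simp add: E_def exp_add[symmetric])
    qed
    ultimately show ?thesis using x E1 by (intro mult_mono) auto
  qed
  also have "\<dots> = exp (4 * (1 + norm v) powr (3/4))"
    unfolding E_def x_def exp_add[symmetric] by simp
  finally show ?thesis .
qed

text \<open>Riemann's argument: the Mellin integral is cut at \<open>u = 0\<close>, and its negative
  half is reflected and rewritten by \<open>theta_tail_minus\<close>, which supplies the second
  exponential of cosh and the polar terms. The factor \<open>s * (s - 1)\<close> turns
  \<open>1 / (s - 1) - 1 / s\<close> into the summand 1 of \<open>Xi\<close>.\<close>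

lemma Xi_dirichlet:
  assumes s: "Re s > 1"
  shows "Xi ((s - 1/2)\<^sup>2) = s * (s - 1) * (of_real pi powr (- s / 2) * Gamma (s / 2) * dirichlet_zeta s)"
proof -
  define z where "z = s - 1 / 2"
  define f where "f = (\<lambda>u::real. exp (s * of_real u) * complex_of_real (theta_tail u))"
  define D where "D = of_real pi powr (- s / 2) * Gamma (s / 2) * dirichlet_zeta s"
  have f: "has_bochner_integral lborel f (D / 2)"
    unfolding f_def D_def by (rule mellin_theta[OF s])
  then have fi: "integrable lborel f" by (simp add: has_bochner_integral_iff)
  have hw: "indicator {0..} u *\<^sub>R (exp (w * of_real u) * complex_of_real (theta_tail u))
      = of_real (half_weight u) * exp ((w - 1/2) * of_real u)" for u :: real and w
  proof (cases "u \<ge> 0")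
    case True
    have "exp (w * of_real u) = exp (of_real (u / 2)) * exp ((w - 1/2) * of_real u)"
      unfolding exp_add[symmetric] by (simp add: algebra_simps)
    then show ?thesis using True by (simp add: half_weight_def exp_of_real[symmetric])
  qed (simp add: half_weight_def)
  have hi: "integrable lborel (\<lambda>u. of_real (half_weight u) * exp (w * of_real u))" for w :: complex
  proof (rule half_weight_integrable(1)[where r = "norm w"])
    show "norm (exp (w * complex_of_real u)) \<le> exp (norm w * u)" if "u \<ge> 0" for u :: real
      using norm_exp[of "w * of_real u"] that by (simp add: norm_mult)
  qed auto
  define M where "M = (\<lambda>w::complex. \<integral>u. of_real (half_weight u) * exp (w * of_real u) \<partial>lborel)"
  have Mz: "M z + M (- z) = 2 * cosh_transform z"
  proof -
    have "M z + M (- z) = (\<integral>u. of_real (half_weight u) * exp (z * of_real u)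
         + of_real (half_weight u) * exp (- z * of_real u) \<partial>lborel)"
      unfolding M_def by (intro Bochner_Integration.integral_add[symmetric] hi)
    also have "\<dots> = (\<integral>u. 2 * (of_real (half_weight u) * cosh (z * of_real u)) \<partial>lborel)"
      by (intro Bochner_Integration.integral_cong)
        (auto simp: cosh_def scaleR_conv_of_real algebra_simps)
    also have "\<dots> = 2 * cosh_transform z" unfolding cosh_transform_def by simp
    finally show ?thesis .
  qed
  have pos: "integral\<^sup>L lborel (\<lambda>u. indicator {0..} u *\<^sub>R f u) = M z"
    unfolding f_def hw M_def z_def by simp
  have ip: "integrable lborel (\<lambda>u. indicator {0..} u *\<^sub>R f u)"
    using fi by (intro integrable_mult_indicator) auto
  have ineg: "integrable lborel (\<lambda>u. indicator {..<0} u *\<^sub>R f u)"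
    using fi by (intro integrable_mult_indicator) auto
  have "integral\<^sup>L lborel f = (\<integral>u. indicator {0..} u *\<^sub>R f u + indicator {..<0} u *\<^sub>R f u \<partial>lborel)"
    by (intro Bochner_Integration.integral_cong) (auto simp: indicator_def)
  also have "\<dots> = M z + (\<integral>u. indicator {..<0} u *\<^sub>R f u \<partial>lborel)"
    using ip ineg pos by simp
  also have "(\<integral>u. indicator {..<0} u *\<^sub>R f u \<partial>lborel) = (\<integral>u. indicator {..<0} (- u) *\<^sub>R f (- u) \<partial>lborel)"
    using lborel_integral_real_affine[of "-1" "\<lambda>u. indicator {..<0} u *\<^sub>R f u" 0] by simp
  also have "\<dots> = (\<integral>u. of_real (half_weight u) * exp (- z * of_real u)
       + (indicator {0..} u *\<^sub>R exp ((1 - s) * of_real u) / 2 - indicator {0..} u *\<^sub>R exp (- s * of_real u) / 2) \<partial>lborel)"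
  proof (rule integral_cong_AE)
    \<comment> \<open>The two integrands disagree at \<open>u = 0\<close>, a point of
      \<open>{0..}\<close> whose negative is not in \<open>{..<0}\<close>.\<close>
    have "AE u in lborel. u \<noteq> (0::real)" by (rule AE_lborel_singleton)
    then show "AE u in lborel. indicator {..<0} (- u) *\<^sub>R f (- u) = of_real (half_weight u) * exp (- z * of_real u)
       + (indicator {0..} u *\<^sub>R exp ((1 - s) * of_real u) / 2 - indicator {0..} u *\<^sub>R exp (- s * of_real u) / 2)"
    proof eventually_elim
      case (elim u)
      show ?case
      proof (cases "u > 0")
        case True
        have "f (- u) = exp (- s * of_real u) * (exp (of_real u) * of_real (theta_tail u) + exp (of_real u) / 2 - 1 / 2)"
          unfolding f_def theta_tail_minus by (simp add: exp_of_real[symmetric])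
        also have "\<dots> = exp ((1 - s) * of_real u) * of_real (theta_tail u) + exp ((1 - s) * of_real u) / 2 - exp (- s * of_real u) / 2"
        proof -
          have "exp ((1 - s) * of_real u) = exp (- s * of_real u) * exp (of_real u)"
            unfolding exp_add[symmetric] by (simp add: algebra_simps)
          then show ?thesis by (simp add: algebra_simps)
        qed
        finally show ?thesis using True hw[of u "1 - s"] by (simp add: z_def)
      qed (use elim in \<open>auto simp: half_weight_def\<close>)
    qed
  qed (auto simp: f_def)
  also have "\<dots> = M (- z) + (1 / (s - 1) / 2 - 1 / s / 2)"
  proof -
    have e1: "has_bochner_integral lborel (\<lambda>u::real. indicator {0..} u *\<^sub>R exp ((1 - s) * of_real u) / 2) (1 / (s - 1) / 2)"
      using has_bochner_integral_divide_zero[OF has_bochner_integral_exp_complex_half[of "s - 1"], of 2] s by simp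
    have e2: "has_bochner_integral lborel (\<lambda>u::real. indicator {0..} u *\<^sub>R exp (- s * of_real u) / 2) (1 / s / 2)"
      using has_bochner_integral_divide_zero[OF has_bochner_integral_exp_complex_half[of s], of 2] s by simp
    have e3: "has_bochner_integral lborel (\<lambda>u. of_real (half_weight u) * exp (- z * of_real u)) (M (- z))"
      using hi[of "- z"] by (simp add: M_def has_bochner_integral_iff)
    show ?thesis
      by (rule has_bochner_integral_integral_eq[OF has_bochner_integral_add[OF e3 has_bochner_integral_diff[OF e1 e2]]])
  qed
  finally have D2: "D / 2 = M z + (M (- z) + (1 / (s - 1) / 2 - 1 / s / 2))"
    using f by (simp only: has_bochner_integral_iff)
  have D: "D = 4 * cosh_transform z + (1 / (s - 1) - 1 / s)"
  proof -
    define p q where "p = 1 / (s - 1)" and "q = 1 / s"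
    have "D = 2 * (D / 2)" by simp
    also have "\<dots> = 2 * (M z + M (- z)) + (p - q)"
      unfolding D2 p_def[symmetric] q_def[symmetric] by (simp add: algebra_simps)
    finally show ?thesis unfolding Mz p_def q_def by simp
  qed
  have s0: "s \<noteq> 0" "s - 1 \<noteq> 0" using s by auto
  have zz: "z\<^sup>2 - 1 / 4 = s * (s - 1)" by (simp add: z_def power2_eq_square field_simps)
  have "s * (s - 1) * D = s * (s - 1) * (4 * cosh_transform z) + (s - (s - 1))"
  proof -
    have "s * (s - 1) * (1 / (s - 1)) = s" "s * (s - 1) * (1 / s) = s - 1" using s0 by auto
    then show ?thesis unfolding D distrib_left right_diff_distrib[of _ "1 / (s - 1)"] by (simp only:)
  qed
  then show ?thesis unfolding D_def[symmetric] z_def[symmetric] Xi_square zz by simp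
qed

section \<open>Partial fractions for entire functions of order below one\<close>

lemma entire_factor_zero:
  assumes g: "g holomorphic_on UNIV" and nz: "g w \<noteq> 0"
  shows "\<exists>n h. h holomorphic_on UNIV \<and> h a \<noteq> 0 \<and> (\<forall>z. g z = (z - a) ^ n * h z)"
proof (cases "g a = 0")
  case False
  then show ?thesis using g by (intro exI[of _ 0] exI[of _ g]) auto
next
  case True
  have nc: "\<not> g constant_on UNIV"
    unfolding constant_on_def using True nz by (metis UNIV_I)
  obtain h r n where n: "0 < n" "0 < r" and h: "h holomorphic_on ball a r"
    and gh: "\<And>z. z \<in> ball a r \<Longrightarrow> g z = (z - a) ^ n * h z"
    and hnz: "\<And>z. z \<in> ball a r \<Longrightarrow> h z \<noteq> 0"
    by (rule holomorphic_factor_zero_nonconstant[OF g open_UNIV connected_UNIV UNIV_I True nc])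
      (rule that)
  define H where "H = (\<lambda>z. if z = a then h a else g z / (z - a) ^ n)"
  have "H holomorphic_on ball a r"
    using h by (rule holomorphic_transform) (auto simp: H_def gh)
  moreover have "H holomorphic_on - {a}"
    by (rule holomorphic_transform[where f = "\<lambda>z. g z / (z - a) ^ n"])
      (auto simp: H_def intro!: holomorphic_intros holomorphic_on_subset[OF g])
  ultimately have "H holomorphic_on (ball a r \<union> - {a})"
    by (intro holomorphic_on_Un) auto
  moreover have "ball a r \<union> - {a} = UNIV" using \<open>0 < r\<close> by auto
  ultimately have "H holomorphic_on UNIV" by simp
  moreover have "H a \<noteq> 0" using hnz[of a] \<open>0 < r\<close> by (simp add: H_def)
  moreover have "g z = (z - a) ^ n * H z" for z
    using True n by (auto simp: H_def)
  ultimately show ?thesis by blast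
qed

text \<open>Factors normalised as \<open>1 - z / a\<close> leave the value at 0 untouched and are
  not small far outside the zeros; both properties enter the growth bound for the cofactor
  \<open>g\<close>.\<close>

lemma entire_factor_zeros:
  assumes f: "f holomorphic_on UNIV" and nz: "f w \<noteq> 0" and "finite Z" and "0 \<notin> Z"
  shows "\<exists>g (m :: complex \<Rightarrow> nat). g holomorphic_on UNIV \<and> (\<forall>z\<in>Z. g z \<noteq> 0) \<and>
           (\<forall>z. f z = g z * (\<Prod>a\<in>Z. (1 - z / a) ^ m a))"
  using \<open>finite Z\<close> \<open>0 \<notin> Z\<close>
proof (induction Z rule: finite_induct)
  case empty
  then show ?case using f by auto
next
  case (insert a Z)
  then obtain g m where g: "g holomorphic_on UNIV" "\<And>z. z \<in> Z \<Longrightarrow> g z \<noteq> 0"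
    and fg: "\<And>z. f z = g z * (\<Prod>a\<in>Z. (1 - z / a) ^ m a)"
    by auto
  have "g w \<noteq> 0" using nz fg by auto
  from entire_factor_zero[OF g(1) this, of a] obtain n h
    where h: "h holomorphic_on UNIV" "h a \<noteq> 0" "\<And>z. g z = (z - a) ^ n * h z" by auto
  have a: "a \<noteq> 0" using insert by auto
  define k where "k = (\<lambda>z. (- a) ^ n * h z)"
  have gk: "g z = (1 - z / a) ^ n * k z" for z
  proof -
    have "(z - a) = (1 - z / a) * (- a)" using a by (simp add: field_simps)
    then show ?thesis by (simp add: h(3) k_def power_mult_distrib[symmetric] mult.assoc[symmetric])
  qed
  have "k holomorphic_on UNIV" unfolding k_def by (intro holomorphic_intros h)
  moreover have "\<forall>z\<in>insert a Z. k z \<noteq> 0"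
    using h(2) g(2) a gk by (auto simp: k_def)
  moreover have "f z = k z * (\<Prod>b\<in>insert a Z. (1 - z / b) ^ (m(a := n)) b)" for z
  proof -
    have "(\<Prod>b\<in>Z. (1 - z / b) ^ (m(a := n)) b) = (\<Prod>b\<in>Z. (1 - z / b) ^ m b)"
      using insert.hyps by (intro prod.cong) auto
    then have "(\<Prod>b\<in>insert a Z. (1 - z / b) ^ (m(a := n)) b) = (1 - z / a) ^ n * (\<Prod>b\<in>Z. (1 - z / b) ^ m b)"
      using insert.hyps by simp
    then show ?thesis by (simp add: fg gk)
  qed
  ultimately show ?case by blast
qed

lemma deriv_log_prod:
  fixes m :: "complex \<Rightarrow> nat"
  assumes g: "g holomorphic_on UNIV" and "finite Z" and "0 \<notin> Z"
    and f: "\<And>z. f z = g z * (\<Prod>a\<in>Z. (1 - z / a) ^ m a)" and nz: "f z \<noteq> 0"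
  shows "deriv f z / f z = deriv g z / g z + (\<Sum>a\<in>Z. of_nat (m a) / (z - a))"
  using \<open>finite Z\<close> \<open>0 \<notin> Z\<close> f nz
proof (induction Z arbitrary: f rule: finite_induct)
  case empty
  then have "f = g" by auto
  then show ?case by simp
next
  case (insert a Z)
  define f1 where "f1 = (\<lambda>z. g z * (\<Prod>b\<in>Z. (1 - z / b) ^ m b))"
  have a: "a \<noteq> 0" using insert by auto
  have ff1: "f w = f1 w * (1 - w / a) ^ m a" for w
    using insert by (simp add: f1_def)
  have f1z: "f1 z \<noteq> 0" using insert.prems(3) ff1 by auto
  have "f1 holomorphic_on UNIV" unfolding f1_def
    by (intro holomorphic_intros g) (use insert in auto)
  then have d1: "(f1 has_field_derivative deriv f1 z) (at z)"
    by (simp add: holomorphic_derivI)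
  have IH: "deriv f1 z / f1 z = deriv g z / g z + (\<Sum>a\<in>Z. of_nat (m a) / (z - a))"
    using insert.IH[of f1] insert.prems f1z by (simp add: f1_def)
  have feq: "f = (\<lambda>w. f1 w * (1 - w / a) ^ m a)" using ff1 by auto
  show ?case
  proof (cases "m a = 0")
    case True
    then have "f = f1" using ff1 by auto
    then show ?thesis using IH True insert by simp
  next
    case False
    have za: "1 - z / a \<noteq> 0" using insert.prems(3) ff1 False by auto
    then have zz: "z - a \<noteq> 0" "a - z \<noteq> 0" using a by auto
    have "(f has_field_derivative (deriv f1 z * (1 - z / a) ^ m a
            + of_nat (m a) * (1 - z / a) ^ (m a - 1) * (- 1 / a) * f1 z)) (at z)"
      unfolding feq by (rule derivative_eq_intros d1 refl | simp add: a)+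
    then have df: "deriv f z = deriv f1 z * (1 - z / a) ^ m a
            + of_nat (m a) * (1 - z / a) ^ (m a - 1) * (- 1 / a) * f1 z"
      by (rule DERIV_imp_deriv)
    have "deriv f z / f z = deriv f1 z / f1 z + of_nat (m a) * (- 1 / a) / (1 - z / a)"
    proof -
      define P Q where "P = (1 - z / a) ^ (m a - 1)" and "Q = 1 - z / a"
      have PQ: "(1 - z / a) ^ m a = P * Q"
        unfolding P_def Q_def using False by (metis power_minus_mult not_gr_zero)
      have nz: "P \<noteq> 0" "Q \<noteq> 0" using za by (auto simp: P_def Q_def)
      have "deriv f z / f z
        = (deriv f1 z * (P * Q) + of_nat (m a) * P * (- 1 / a) * f1 z) / (f1 z * (P * Q))"
        unfolding df ff1 PQ P_def[symmetric] ..
      also have "\<dots> = deriv f1 z / f1 z + of_nat (m a) * (- 1 / a) / Q"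
        unfolding add_divide_distrib using nz f1z by simp
      finally show ?thesis unfolding Q_def .
    qed
    also have "of_nat (m a) * (- 1 / a) / (1 - z / a) = of_nat (m a) / (z - a)"
    proof -
      define Q where "Q = 1 - z / a"
      have "z - a = - a * Q" using a by (simp add: Q_def right_diff_distrib)
      then show ?thesis unfolding Q_def[symmetric] by (metis divide_divide_eq_left divide_minus_right divide_minus_left
         mult.commute mult_minus_left times_divide_eq_right mult.right_neutral)
    qed
    finally show ?thesis using IH insert by simp
  qed
qed

section \<open>Growth bounds for logarithmic derivatives\<close>

text \<open>The map \<open>u / (2 * M - u)\<close> takes the half-plane \<open>Re u < M\<close> into
  the unit disc and fixes 0, so the Schwarz lemma applies to its composition with
  \<open>h\<close>.\<close>

lemma Borel_Caratheodory:
  assumes h: "h holomorphic_on ball 0 R" and "0 < R" "h 0 = 0"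
    and M: "\<And>z. z \<in> ball 0 R \<Longrightarrow> Re (h z) < M" and z: "norm z < R"
  shows "norm (h z) \<le> 2 * M * norm z / (R - norm z)"
proof -
  have M0: "M > 0" using M[of 0] assms by simp
  define \<phi> where "\<phi> = (\<lambda>w. h (of_real R * w) / (2 * of_real M - h (of_real R * w)))"
  have inb: "of_real R * w \<in> ball 0 R" if "norm w < 1" for w :: complex
    using that \<open>0 < R\<close> by (simp add: norm_mult)
  have less: "norm u < norm (2 * of_real M - u)" if "Re u < M" for u :: complex
  proof -
    have "(Re u)^2 + (Im u)^2 < (2 * M - Re u)^2 + (Im u)^2"
      using that M0 by (simp add: power2_eq_square algebra_simps)
    then show ?thesis by (simp add: cmod_def)
  qed
  have nz: "2 * of_real M - h (of_real R * w) \<noteq> 0" if "norm w < 1" for w :: complex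
    using less[OF M[OF inb[OF that]]] by (metis norm_not_less_zero norm_zero)
  have hol: "\<phi> holomorphic_on ball 0 1" unfolding \<phi>_def
    by (intro holomorphic_intros holomorphic_on_compose_gen[OF _ h, unfolded o_def])
      (use inb nz in auto)
  have lt1: "norm (\<phi> w) < 1" if "norm w < 1" for w
    using less[OF M[OF inb[OF that]]] nz[OF that] by (simp add: \<phi>_def norm_divide divide_less_eq)
  have \<phi>0: "\<phi> 0 = 0" using \<open>h 0 = 0\<close> by (simp add: \<phi>_def)
  define w where "w = z / of_real R"
  have w1: "norm w < 1" using z \<open>0 < R\<close> by (simp add: w_def norm_divide)
  have Rw: "of_real R * w = z" using \<open>0 < R\<close> by (simp add: w_def)
  have "norm (\<phi> w) \<le> norm w"
    using Schwarz_Lemma(1)[OF hol \<phi>0 lt1 w1] .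
  then have "norm (h z) \<le> norm w * norm (2 * of_real M - h z)"
    using nz[OF w1] by (simp add: \<phi>_def Rw norm_divide divide_le_eq)
  also have "\<dots> \<le> norm w * (2 * M + norm (h z))"
    using norm_triangle_ineq4[of "2 * of_real M" "h z"] M0
    by (intro mult_left_mono) (auto simp: norm_mult)
  finally have "norm (h z) \<le> norm z / R * (2 * M + norm (h z))"
    using \<open>0 < R\<close> by (simp add: w_def norm_divide)
  then have "norm (h z) * R \<le> norm z * (2 * M + norm (h z))"
    using \<open>0 < R\<close> by (simp add: field_simps)
  then show ?thesis using z by (simp add: field_simps)
qed

text \<open>A zero-free function on a disc has a holomorphic logarithm. Borel-Caratheodory bounds it
  on radius \<open>3 * R / 4\<close>, with \<open>6 = 2 * (3/4) / (1/4)\<close>; Cauchy's inequality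
  on circles of radius \<open>R / 4\<close> bounds its derivative, with
  \<open>24 = 6 * 4\<close>.\<close>

lemma log_deriv_bound:
  assumes g: "g holomorphic_on ball 0 R" and "0 < R" and nz: "\<And>z. z \<in> ball 0 R \<Longrightarrow> g z \<noteq> 0"
    and B: "\<And>z. z \<in> ball 0 R \<Longrightarrow> norm (g z) < norm (g 0) * exp M" and z: "norm z \<le> R / 2"
  shows "norm (deriv g z / g z) \<le> 24 * M / R"
proof -
  obtain k where k: "k holomorphic_on ball 0 R" "\<And>z. z \<in> ball 0 R \<Longrightarrow> g z = exp (k z)"
    using contractible_imp_holomorphic_log[OF g convex_imp_contractible[OF convex_ball] nz]
    by metis
  define h where "h = (\<lambda>z. k z - k 0)"
  have h: "h holomorphic_on ball 0 R" unfolding h_def by (intro holomorphic_intros k)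
  have gh: "g w = g 0 * exp (h w)" if "w \<in> ball 0 R" for w
    using k(2)[OF that] k(2)[of 0] \<open>0 < R\<close> by (simp add: h_def exp_diff)
  have g0: "g 0 \<noteq> 0" using nz[of 0] \<open>0 < R\<close> by simp
  have ReM: "Re (h w) < M" if "w \<in> ball 0 R" for w
    using B[OF that] g0 by (simp add: gh[OF that] norm_mult)
  have h0: "h 0 = 0" by (simp add: h_def)
  have M0: "M > 0" using ReM[of 0] h0 \<open>0 < R\<close> by simp
  have bd: "norm (h w) \<le> 6 * M" if "norm w \<le> 3 * R / 4" for w
  proof -
    have "norm (h w) \<le> 2 * M * norm w / (R - norm w)"
      by (rule Borel_Caratheodory[OF h \<open>0 < R\<close> h0 ReM]) (use that \<open>0 < R\<close> in auto)
    also have "\<dots> \<le> 2 * M * (3 * R / 4) / (R / 4)"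
      using that \<open>0 < R\<close> M0 by (intro frac_le mult_left_mono) auto
    finally show ?thesis using \<open>0 < R\<close> by simp
  qed
  have sub: "cball z (R/4) \<subseteq> cball 0 (3 * R / 4)"
  proof
    fix w assume "w \<in> cball z (R/4)"
    then have "norm (w - z) \<le> R / 4" by (simp add: dist_norm norm_minus_commute)
    then show "w \<in> cball 0 (3 * R / 4)" using z norm_triangle_sub[of w z] by auto
  qed
  have sub2: "cball z (R/4) \<subseteq> ball 0 R" using sub \<open>0 < R\<close> by fastforce
  have "norm ((deriv ^^ 1) h z) \<le> fact 1 * (6 * M) / (R/4) ^ 1"
  proof (rule Cauchy_inequality)
    show "h holomorphic_on ball z (R/4)"
      using h sub2 by (meson ball_subset_cball holomorphic_on_subset order_trans)
    show "continuous_on (cball z (R/4)) h"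
      using h sub2 holomorphic_on_imp_continuous_on holomorphic_on_subset by blast
    show "norm (h x) \<le> 6 * M" if "norm (z - x) = R / 4" for x
      using that sub bd by (auto simp: subset_iff dist_norm)
  qed (use \<open>0 < R\<close> in auto)
  then have dh: "norm (deriv h z) \<le> 24 * M / R" using \<open>0 < R\<close> by simp
  have zb: "z \<in> ball 0 R" using z \<open>0 < R\<close> by auto
  have "(h has_field_derivative deriv h z) (at z)"
    using holomorphic_derivI[OF h open_ball zb] .
  then have "((\<lambda>w. g 0 * exp (h w)) has_field_derivative (g 0 * exp (h z) * deriv h z)) (at z)"
    by (auto intro!: derivative_eq_intros)
  then have "(g has_field_derivative (g 0 * exp (h z) * deriv h z)) (at z)"
    by (rule has_field_derivative_transform_within_open[OF _ open_ball zb]) (simp add: gh)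
  then have "deriv g z = g z * deriv h z"
    using gh[OF zb] by (simp add: DERIV_imp_deriv)
  then show ?thesis using dh nz[OF zb] by simp
qed

text \<open>On the circle of radius \<open>3 * R\<close> all the factors \<open>1 - z / a\<close>
  have modulus at least 1, so there the cofactor \<open>g\<close> is no larger than
  \<open>F\<close>, and inside by the maximum principle. The growth exponent
  \<open>R powr (3/4)\<close> divided by \<open>R\<close> is the error; order below 1 makes it
  vanish. The multiplicities are chosen after \<open>R\<close>, and only \<open>K\<close> is
  uniform.\<close>

lemma log_deriv_partial_fractions:
  fixes F :: "complex \<Rightarrow> complex"
  assumes F: "F holomorphic_on UNIV" and F0: "F 0 \<noteq> 0" and "C \<ge> 0"
    and growth: "\<And>z. norm (F z) \<le> exp (C * (1 + norm z) powr (3/4))"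
  shows "\<exists>K\<ge>0. \<forall>R\<ge>1. finite {a\<in>cball 0 R. F a = 0} \<and>
     (\<exists>m::complex \<Rightarrow> nat. (\<forall>a\<in>{a\<in>cball 0 R. F a = 0}. m a \<ge> 1) \<and>
       (\<forall>z. norm z \<le> R / 2 \<longrightarrow> F z \<noteq> 0 \<longrightarrow>
          norm (deriv F z / F z - (\<Sum>a\<in>{a\<in>cball 0 R. F a = 0}. of_nat (m a) / (z - a)))
            \<le> K * R powr (-1/4)))"
proof (intro exI[of _ "24 * (4 * C + \<bar>ln (norm (F 0))\<bar> + 1)"] conjI allI impI)
  show "0 \<le> 24 * (4 * C + \<bar>ln (norm (F 0))\<bar> + 1)" using \<open>C \<ge> 0\<close> by simp
next
  fix R :: real assume R: "1 \<le> R"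
  define Z where "Z = {a\<in>cball 0 R. F a = 0}"
  define D where "D = 4 * C + \<bar>ln (norm (F 0))\<bar> + 1"
  show fin: "finite {a\<in>cball 0 R. F a = 0}"
  proof (cases "F constant_on UNIV")
    case True
    then have "{a\<in>cball 0 R. F a = 0} = {}" using F0 by (auto simp: constant_on_def)
    then show ?thesis by (metis finite.emptyI)
  next
    case False
    then show ?thesis
      by (intro holomorphic_compact_finite_zeros[OF F]) auto
  qed
  then have finZ: "finite Z" by (simp add: Z_def)
  have Z0: "0 \<notin> Z" using F0 by (simp add: Z_def)
  obtain g m where g: "g holomorphic_on UNIV" and gZ: "\<And>z. z \<in> Z \<Longrightarrow> g z \<noteq> 0"
    and Fg: "\<And>z. F z = g z * (\<Prod>a\<in>Z. (1 - z / a) ^ m a)"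
    using entire_factor_zeros[OF F F0 finZ Z0] by metis
  have g0: "g 0 = F 0" using Fg[of 0] by simp
  have gnz: "g z \<noteq> 0" if "z \<in> ball 0 R" for z
    using gZ[of z] Fg[of z] that by (cases "F z = 0") (auto simp: Z_def)
  have m1: "m a \<ge> 1" if "a \<in> Z" for a
  proof (rule ccontr)
    assume "\<not> m a \<ge> 1"
    then have ma: "m a = 0" by simp
    have "F a = 0" using that by (simp add: Z_def)
    then obtain b where b: "b \<in> Z" "(1 - a / b) ^ m b = 0"
      using Fg[of a] gZ[OF \<open>a \<in> Z\<close>] finZ by auto
    then have "b \<noteq> 0" "1 - a / b = 0" "m b \<noteq> 0" using Z0 by (auto simp: power_eq_0_iff)
    then have "a = b" by simp
    then show False using ma \<open>m b \<noteq> 0\<close> by simp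
  qed
  define B where "B = exp (C * (1 + 3 * R) powr (3/4))"
  have sph: "norm (g z) \<le> B" if "norm z = 3 * R" for z
  proof -
    have "1 \<le> norm (\<Prod>a\<in>Z. (1 - z / a) ^ m a)"
      unfolding prod_norm[symmetric] norm_power
    proof (intro prod_ge_1 one_le_power)
      fix a assume a: "a \<in> Z"
      then have a0: "norm a > 0" "norm a \<le> R" using Z0 by (auto simp: Z_def)
      then have "norm (z / a) \<ge> 3"
        using that by (simp add: norm_divide le_divide_eq)
      then show "1 \<le> norm (1 - z / a)"
        using norm_triangle_ineq3[of "z/a" 1] by (simp add: norm_minus_commute)
    qed
    then have "norm (g z) \<le> norm (F z)"
      unfolding Fg norm_mult using mult_left_mono[of 1 _ "norm (g z)"] by auto
    also have "\<dots> \<le> B" using growth[of z] that by (simp add: B_def)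
    finally show ?thesis .
  qed
  have gB: "norm (g z) \<le> B" if "norm z \<le> 3 * R" for z
  proof (rule maximum_modulus_frontier[of g "cball 0 (3*R)"])
    show "g holomorphic_on interior (cball 0 (3 * R))" using g holomorphic_on_subset by blast
    show "continuous_on (closure (cball 0 (3 * R))) g"
      using g holomorphic_on_imp_continuous_on holomorphic_on_subset by blast
    show "\<And>z. z \<in> frontier (cball 0 (3 * R)) \<Longrightarrow> norm (g z) \<le> B"
      using sph R by (auto simp: sphere_def)
  qed (use that in auto)
  \<comment> \<open>Chosen so that \<open>norm (g 0) * exp M = B * exp 1\<close>; the summand 1
    makes the bound strict.\<close>
  define M where "M = C * (1 + 3 * R) powr (3/4) - ln (norm (F 0)) + 1"
  have M: "norm (g z) < norm (g 0) * exp M" if "z \<in> ball 0 R" for z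
  proof -
    have "norm (g 0) * exp M = B * exp 1"
      using F0 by (simp add: M_def B_def g0 exp_add exp_diff)
    moreover have "B > 0" by (simp add: B_def)
    moreover have "norm (g z) \<le> B" using that R by (intro gB) auto
    ultimately show ?thesis by (smt (verit) exp_gt_one mult_less_cancel_left1)
  qed
  have MD: "M \<le> D * R powr (3/4)"
  proof -
    have "(1 + 3 * R) powr (3/4) \<le> (4 * R) powr (3/4)" using R by (intro powr_mono2) auto
    also have "\<dots> = 4 powr (3/4) * R powr (3/4)" using R by (simp add: powr_mult)
    also have "\<dots> \<le> 4 * R powr (3/4)"
      using powr_mono[of "3/4" 1 "4::real"] by (intro mult_right_mono) auto
    finally have 1: "C * (1 + 3 * R) powr (3/4) \<le> C * (4 * R powr (3/4))"
      using \<open>C \<ge> 0\<close> by (rule mult_left_mono)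
    have 2: "R powr (3/4) \<ge> 1" using R by (simp add: ge_one_powr_ge_zero)
    have "1 - ln (norm (F 0)) \<le> (\<bar>ln (norm (F 0))\<bar> + 1) * 1" by simp
    also have "\<dots> \<le> (\<bar>ln (norm (F 0))\<bar> + 1) * R powr (3/4)"
      using 2 by (intro mult_left_mono) auto
    finally show ?thesis using 1 by (simp add: M_def D_def algebra_simps)
  qed
  show "\<exists>m::complex \<Rightarrow> nat. (\<forall>a\<in>{a\<in>cball 0 R. F a = 0}. m a \<ge> 1) \<and>
       (\<forall>z. norm z \<le> R / 2 \<longrightarrow> F z \<noteq> 0 \<longrightarrow>
          norm (deriv F z / F z - (\<Sum>a\<in>{a\<in>cball 0 R. F a = 0}. of_nat (m a) / (z - a)))
            \<le> 24 * (4 * C + \<bar>ln (norm (F 0))\<bar> + 1) * R powr (-1/4))"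
    unfolding Z_def[symmetric] D_def[symmetric]
  proof (intro exI[of _ m] conjI ballI allI impI)
    fix z assume z: "norm z \<le> R / 2" "F z \<noteq> 0"
    have "norm (deriv g z / g z) \<le> 24 * M / R"
      using gnz M z(1) R by (intro log_deriv_bound holomorphic_on_subset[OF g]) auto
    also have "\<dots> \<le> 24 * (D * R powr (3/4)) / R"
      using MD R by (intro divide_right_mono) auto
    also have "\<dots> = 24 * D * R powr (-1/4)"
      using R powr_diff[of R "3/4" 1] by simp
    finally show "norm (deriv F z / F z - (\<Sum>a\<in>Z. of_nat (m a) / (z - a))) \<le> 24 * D * R powr (-1/4)"
      using deriv_log_prod[OF g finZ Z0 Fg z(2)] by simp
  qed (use m1 in auto)
qed

section \<open>Identification of zeta and the lower bound\<close>

text \<open>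
  This is \<open>Xi / (s (s - 1))\<close> divided by \<open>\<pi> powr (- s / 2) * Gamma (s / 2)\<close>; using \<open>rGamma (s / 2 + 1)\<close> removes
  the singularity at 0.
\<close>
definition zeta_continuation :: "complex \<Rightarrow> complex" where
  "zeta_continuation s = Xi ((s - 1/2)\<^sup>2) * of_real pi powr (s / 2) * rGamma (s / 2 + 1) / (2 * (s - 1))"

lemma Xi_compose_holomorphic:
  "f holomorphic_on A \<Longrightarrow> (\<lambda>s. Xi (f s)) holomorphic_on A"
  using holomorphic_on_compose_gen[OF _ Xi_entire, of f A] by (simp add: o_def)

lemma zeta_continuation_holomorphic: "zeta_continuation holomorphic_on - {1}"
  unfolding zeta_continuation_def[abs_def]
  by (intro holomorphic_intros Xi_compose_holomorphic) auto

lemma Gamma_times_rGamma_plus1: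
  fixes z :: complex
  assumes "z \<notin> \<int>\<^sub>\<le>\<^sub>0"
  shows "Gamma z * rGamma (z + 1) = 1 / z"
proof -
  have "z \<noteq> 0" using assms by auto
  moreover have "Gamma z * (z * rGamma (z + 1)) = 1"
    unfolding rGamma_plus1 using assms by (simp add: rGamma_inverse_Gamma Gamma_eq_zero_iff)
  ultimately show ?thesis by (simp add: field_simps)
qed

lemma pi_powr_cancel: "of_real pi powr (- s / 2) * of_real pi powr (s / 2) = (1 :: complex)"
  by (simp add: powr_def exp_add[symmetric])

lemma zeta_continuation_dirichlet:
  assumes s: "Re s > 1"
  shows "zeta_continuation s = dirichlet_zeta s"
proof -
  have n: "s / 2 \<notin> \<int>\<^sub>\<le>\<^sub>0" using s by (auto elim!: nonpos_Ints_cases simp: complex_eq_iff)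
  have s0: "s \<noteq> 0" "s - 1 \<noteq> 0" using s by auto
  have "zeta_continuation s = s * (s - 1) * dirichlet_zeta s
      * (of_real pi powr (- s / 2) * of_real pi powr (s / 2)) * (Gamma (s / 2) * rGamma (s / 2 + 1)) / (2 * (s - 1))"
    unfolding zeta_continuation_def Xi_dirichlet[OF s] by (simp add: mult_ac)
  also have "\<dots> = s * (s - 1) * dirichlet_zeta s * (1 / (s / 2)) / (2 * (s - 1))"
    unfolding pi_powr_cancel Gamma_times_rGamma_plus1[OF n] by simp
  also have "\<dots> = dirichlet_zeta s"
  proof -
    have "s * d * D * (1 / (s / 2)) / (2 * d) = D" if "d \<noteq> 0" for d D :: complex
      using that s0 by simp
    then show ?thesis using s0(2) .
  qed
  finally show ?thesis .
qed

text \<open>The property that defines \<open>riemann_zeta\<close> holds only once some function is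
  known to have it; \<open>zeta_continuation\<close> is that witness, and the identity theorem on
  the connected punctured plane makes the choice irrelevant.\<close>

lemma riemann_zeta_eq:
  assumes "s \<noteq> 1"
  shows "riemann_zeta s = zeta_continuation s"
proof -
  let ?P = "\<lambda>f. f holomorphic_on (- {1}) \<and> (\<forall>s. 1 < Re s \<longrightarrow> f s = (\<Sum>n. 1 / (of_nat (Suc n)) powr s))"
  have "?P zeta_continuation"
    using zeta_continuation_holomorphic zeta_continuation_dirichlet by (auto simp: dirichlet_zeta_def)
  then have P: "?P riemann_zeta" unfolding riemann_zeta_def by (rule someI[of ?P])
  show ?thesis
  proof (rule analytic_continuation_open[where s = "{s. Re s > 1}" and s' = "- {1}"
        and f = riemann_zeta and g = zeta_continuation])
    show "open {s. Re s > 1}" by (rule open_halfspace_Re_gt)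
    show "connected (- {1::complex})" by (intro connected_punctured_universe) simp
    show "{s. Re s > 1} \<noteq> {}" by (auto intro!: exI[of _ 2])
    show "riemann_zeta z = zeta_continuation z" if "z \<in> {s. Re s > 1}" for z
      using that P zeta_continuation_dirichlet by (simp add: dirichlet_zeta_def)
  qed (use P zeta_continuation_holomorphic assms in auto)
qed

text \<open>\<open>Gamma\<close> has the default value 0 at its poles, so \<open>s / 2\<close> is
  kept away from them.\<close>

lemma xi1_eq:
  assumes "s \<noteq> 1" and n: "s / 2 \<notin> \<int>\<^sub>\<le>\<^sub>0"
  shows "xi1 s = Xi ((s - 1/2)\<^sup>2) / (s * (s - 1))"
proof -
  have s0: "s \<noteq> 0" "s - 1 \<noteq> 0" using assms by auto
  have "xi1 s = (of_real pi powr (- s / 2) * of_real pi powr (s / 2)) * (Gamma (s / 2) * rGamma (s / 2 + 1))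
       * Xi ((s - 1/2)\<^sup>2) / (2 * (s - 1))"
    unfolding xi1_def riemann_zeta_eq[OF assms(1)] zeta_continuation_def by (simp add: mult_ac)
  also have "\<dots> = (1 / (s / 2)) * Xi ((s - 1/2)\<^sup>2) / (2 * (s - 1))"
    unfolding pi_powr_cancel Gamma_times_rGamma_plus1[OF n] by simp
  also have "\<dots> = Xi ((s - 1/2)\<^sup>2) / (s * (s - 1))"
  proof -
    have "(1 / (s / 2)) * X / (2 * d) = X / (s * d)" for d X :: complex
      using s0 by simp
    then show ?thesis .
  qed
  finally show ?thesis .
qed

lemma Xi_quarter: "Xi (1 / 4) = 1"
  using Xi_square[of "1/2"] by (simp add: power2_eq_square)

text \<open>\<open>9/4 = (2 - 1/2)^2\<close> corresponds to \<open>s = 2\<close>, where the Basel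
  sum gives \<open>2 * (1 / pi) * (pi^2 / 6)\<close>.\<close>

lemma Xi_nine_quarters: "Xi (9 / 4) = of_real (pi / 3)"
proof -
  have "(\<lambda>n. 1 / of_nat (Suc n) powr 2 :: complex) = (\<lambda>n. of_real (1 / (real n + 1)\<^sup>2))"
  proof
    fix n
    have "(of_nat (Suc n) powr 2 :: complex) = of_nat (Suc n) ^ 2"
      by (simp add: powr_def exp_double exp_of_real del: of_nat_Suc)
    then show "1 / of_nat (Suc n) powr 2 = complex_of_real (1 / (real n + 1)\<^sup>2)"
      by (simp add: add.commute)
  qed
  moreover have "(\<lambda>n. complex_of_real (1 / (real n + 1)\<^sup>2)) sums of_real (pi\<^sup>2 / 6)"
    using inverse_squares_sums by (intro sums_of_real) (simp add: add.commute)
  ultimately have z2: "dirichlet_zeta 2 = of_real (pi\<^sup>2 / 6)"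
    unfolding dirichlet_zeta_def by (simp add: sums_unique[symmetric])
  have "Xi ((2 - 1/2)\<^sup>2) = 2 * (2 - 1) * (of_real pi powr (- 2 / 2) * Gamma (2 / 2) * dirichlet_zeta 2)"
    by (rule Xi_dirichlet) simp
  moreover have "(of_real pi powr (- 1) :: complex) = 1 / of_real pi"
    by (simp add: powr_minus divide_inverse)
  ultimately have "Xi ((2 - 1/2)\<^sup>2) = 2 * (1 / of_real pi * of_real (pi\<^sup>2 / 6))"
    by (simp add: z2)
  also have "\<dots> = of_real (pi / 3)" by (simp add: power2_eq_square)
  finally show ?thesis by (simp add: power2_eq_square)
qed

lemma zeta_continuation_nonzero:
  assumes "Re s \<ge> 1" and "s \<noteq> 1"
  shows "zeta_continuation s \<noteq> 0"
proof (cases "Re s = 1")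
  case False
  then show ?thesis using assms zeta_continuation_dirichlet[of s] dirichlet_zeta_nonzero[of s] by auto
next
  case True
  then have s: "s = 1 + \<i> * of_real (Im s)" "Im s \<noteq> 0" using assms by (auto simp: complex_eq_iff)
  \<comment> \<open>This is \<open>(s - 1) * zeta_continuation s\<close> continued over
    \<open>s = 1\<close>; its value there is the limit that \<open>zeta_nonzero_Re_1\<close> asks
    for.\<close>
  define f where "f = (\<lambda>s. Xi ((s - 1/2)\<^sup>2) * of_real pi powr (s / 2) * rGamma (s / 2 + 1) / 2)"
  have "f holomorphic_on UNIV"
    unfolding f_def by (intro holomorphic_intros Xi_compose_holomorphic) auto
  then have "isCont f 1"
    using holomorphic_on_imp_continuous_on continuous_on_eq_continuous_at[of UNIV f] by auto
  then have "(f \<longlongrightarrow> f 1) (at 1)" by (simp add: isCont_def)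
  then have "((\<lambda>s. (s - 1) * zeta_continuation s) \<longlongrightarrow> f 1) (at 1)"
  proof (rule Lim_transform_eventually)
    show "eventually (\<lambda>s. f s = (s - 1) * zeta_continuation s) (at 1)"
    proof -
      have "X / 2 = d * (X / (2 * d))" if "d \<noteq> 0" for d X :: complex
        using that by simp
      then show ?thesis
        unfolding eventually_at_filter f_def zeta_continuation_def
        by (intro always_eventually allI impI) (metis right_minus_eq)
    qed
  qed
  from zeta_nonzero_Re_1[OF zeta_continuation_holomorphic zeta_continuation_dirichlet this s(2)]
  show ?thesis using s(1) by simp
qed

text \<open>The root with nonnegative real part puts \<open>\<rho> = 1/2 + z\<close> into
  \<open>Re \<rho> >= 1/2\<close>, and a zero of \<open>Xi\<close> is a zero of
  \<open>zeta_continuation\<close>. Nonvanishing excludes \<open>Re \<rho> >= 1\<close>, the value 1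
  of \<open>Xi\<close> at 1/4 excludes \<open>\<rho> = 1\<close>, and in the open strip the
  hypothesis makes \<open>z\<close> imaginary. Strict negativity of \<open>v\<close> is
  \<open>Xi 0 \<noteq> 0\<close>.\<close>

lemma Xi_zero_real_negative:
  assumes RH: "\<And>\<rho>. riemann_zeta \<rho> = 0 \<Longrightarrow> 0 < Re \<rho> \<Longrightarrow> Re \<rho> < 1 \<Longrightarrow> Re \<rho> = 1 / 2"
    and v: "Xi v = 0"
  shows "\<exists>G>0. v = of_real (- G)"
proof -
  define z where "z = csqrt v"
  define \<rho> where "\<rho> = 1 / 2 + z"
  have z2: "z\<^sup>2 = v" by (simp add: z_def)
  have "Re z \<ge> 0" unfolding z_def using csqrt_principal[of v] by auto
  then have re: "Re \<rho> \<ge> 1 / 2" by (simp add: \<rho>_def)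
  have r1: "\<rho> \<noteq> 1"
  proof
    assume "\<rho> = 1"
    moreover have "z = \<rho> - 1 / 2" by (simp add: \<rho>_def)
    ultimately have "z = 1 / 2" by simp
    then have "v = 1 / 4" unfolding z2[symmetric] by (simp only: power2_eq_square) simp
    then show False using v Xi_quarter by (metis zero_neq_one)
  qed
  have "zeta_continuation \<rho> = 0" using v z2 by (simp add: zeta_continuation_def \<rho>_def)
  then have "Re \<rho> < 1" "riemann_zeta \<rho> = 0"
    using zeta_continuation_nonzero[of \<rho>] r1 riemann_zeta_eq[OF r1] by force+
  then have "Re \<rho> = 1 / 2" using RH re by auto
  then have "z = \<i> * of_real (Im z)" by (simp add: \<rho>_def complex_eq_iff)
  then have "v = of_real (- (Im z)\<^sup>2)"
    using z2 by (metis i_squared mult_minus1 of_real_minus of_real_power power_mult_distrib power2_i)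
  moreover have "Im z \<noteq> 0" using calculation v Xi_0_nonzero by auto
  ultimately show ?thesis by (intro exI[of _ "(Im z)\<^sup>2"]) auto
qed


section \<open>Inequalities for the share of one zero and of the poles\<close>

text \<open>Partial fractions at \<open>i * g\<close> and \<open>- i * g\<close>, with
  \<open>Re (1 / w) = Re w / norm w ^ 2\<close>. Replacing \<open>(Re w)^2\<close> by 1 in the
  denominators makes the bound linear in \<open>Re z\<close>, so that bounds at two points can be
  added.\<close>

lemma pair_kernel_lower:
  fixes z :: complex and g :: real
  assumes a: "0 \<le> Re z" "Re z \<le> 1" and nz: "z\<^sup>2 + of_real (g\<^sup>2) \<noteq> 0"
  shows "Re (2 * z / (z\<^sup>2 + of_real (g\<^sup>2))) \<ge> Re z * (1 / (1 + (Im z - g)\<^sup>2) + 1 / (1 + (Im z + g)\<^sup>2))"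
proof -
  define p q where "p = z - \<i> * of_real g" and "q = z + \<i> * of_real g"
  have pq: "z\<^sup>2 + of_real (g\<^sup>2) = p * q" by (simp add: p_def q_def power2_eq_square algebra_simps)
  have "p \<noteq> 0" "q \<noteq> 0" using nz pq by auto
  moreover have "2 * z = p + q" by (simp add: p_def q_def)
  ultimately have e: "2 * z / (z\<^sup>2 + of_real (g\<^sup>2)) = 1 / p + 1 / q"
    unfolding pq by (simp add: field_simps)
  have le: "Re z * (1 / (1 + (Im w)\<^sup>2)) \<le> Re (1 / w)" if "Re w = Re z" "w \<noteq> 0" for w
  proof -
    have "(Re w)\<^sup>2 + (Im w)\<^sup>2 > 0" using that(2) by (simp add: complex_neq_0)
    moreover have "(Re w)\<^sup>2 \<le> 1" using that a by (simp add: power_le_one)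
    ultimately have "1 / (1 + (Im w)\<^sup>2) \<le> 1 / ((Re w)\<^sup>2 + (Im w)\<^sup>2)" by (intro divide_left_mono) auto
    then have "Re z * (1 / (1 + (Im w)\<^sup>2)) \<le> Re z * (1 / ((Re w)\<^sup>2 + (Im w)\<^sup>2))"
      using a by (intro mult_left_mono)
    then show ?thesis using that by (simp add: Re_divide)
  qed
  have "Re z * (1 / (1 + (Im p)\<^sup>2)) + Re z * (1 / (1 + (Im q)\<^sup>2)) \<le> Re (1 / p) + Re (1 / q)"
    by (intro add_mono le \<open>p \<noteq> 0\<close> \<open>q \<noteq> 0\<close>) (auto simp: p_def q_def)
  moreover have "Im p = Im z - g" "Im q = Im z + g" by (auto simp: p_def q_def)
  ultimately show ?thesis unfolding e by (simp add: distrib_left)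
qed

text \<open>Opposite imaginary parts merely interchange the two fractions, so both points carry the
  same sum, with weights \<open>Re z1\<close> and \<open>Re z2\<close> that add up to 1.\<close>

lemma double_pair_kernel_lower:
  fixes z1 z2 :: complex and g :: real
  assumes "0 \<le> Re z1" "0 \<le> Re z2" "Re z1 + Re z2 = 1" "Im z2 = - Im z1"
    and "z1\<^sup>2 + of_real (g\<^sup>2) \<noteq> 0" "z2\<^sup>2 + of_real (g\<^sup>2) \<noteq> 0"
  shows "Re (2 * z1 / (z1\<^sup>2 + of_real (g\<^sup>2)) + 2 * z2 / (z2\<^sup>2 + of_real (g\<^sup>2)))
          \<ge> 1 / (1 + (Im z1 - g)\<^sup>2) + 1 / (1 + (Im z1 + g)\<^sup>2)"
proof -
  define p q where "p = 1 / (1 + (Im z1 - g)\<^sup>2)" and "q = 1 / (1 + (Im z1 + g)\<^sup>2)"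
  have "Re (2 * z1 / (z1\<^sup>2 + of_real (g\<^sup>2))) \<ge> Re z1 * (p + q)"
    unfolding p_def q_def using assms by (intro pair_kernel_lower) auto
  moreover have "Re (2 * z2 / (z2\<^sup>2 + of_real (g\<^sup>2))) \<ge> Re z2 * (q + p)"
  proof -
    have "(Im z2 - g)\<^sup>2 = (Im z1 + g)\<^sup>2" "(Im z2 + g)\<^sup>2 = (Im z1 - g)\<^sup>2"
      using assms(4) by (simp_all add: power2_eq_square algebra_simps)
    then show ?thesis
      unfolding p_def q_def using pair_kernel_lower[of z2 g] assms by simp
  qed
  moreover have "Re z1 * (p + q) + Re z2 * (q + p) = (Re z1 + Re z2) * (p + q)" by (simp add: algebra_simps)
  ultimately show ?thesis unfolding assms(3) by (simp add: p_def q_def)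
qed

text \<open>After cross-multiplication the difference of the two sides is
  \<open>2 * g^2 * (3 * y^2 - 1 - g^2)\<close>, which is where the threshold for a single zero comes
  from.\<close>

lemma kernel_near:
  fixes y g :: real
  assumes "0 < g\<^sup>2" and "g\<^sup>2 < 3 * y\<^sup>2 - 1"
  shows "1 / (1 + (y - g)\<^sup>2) + 1 / (1 + (y + g)\<^sup>2) > 2 / (1 + y\<^sup>2)"
proof -
  define A B where "A = 1 + (y - g)\<^sup>2" and "B = 1 + (y + g)\<^sup>2"
  have pos: "A > 0" "B > 0" "1 + y\<^sup>2 > 0" by (auto simp: A_def B_def add_pos_nonneg)
  have "(A + B) * (1 + y\<^sup>2) - 2 * (A * B) = 2 * g\<^sup>2 * (3 * y\<^sup>2 - 1 - g\<^sup>2)"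
    by (simp add: A_def B_def power2_eq_square algebra_simps)
  also have "\<dots> > 0" using assms by (intro mult_pos_pos) auto
  finally have "2 * (A * B) < (A + B) * (1 + y\<^sup>2)" by simp
  then have "2 / (1 + y\<^sup>2) < (A + B) / (A * B)"
    using pos by (simp add: divide_less_eq less_divide_eq field_simps)
  also have "(A + B) / (A * B) = 1 / A + 1 / B" using pos by (simp add: field_simps)
  finally show ?thesis by (simp add: A_def B_def)
qed

text \<open>Harmonic against arithmetic mean, \<open>1 / A + 1 / B >= 4 / (A + B)\<close>; the mixed
  terms \<open>2 * y * g\<close> cancel in \<open>A + B\<close>.\<close>

lemma kernel_far:
  fixes y g :: real
  assumes "3 * y\<^sup>2 - 1 \<le> g\<^sup>2" and "y\<^sup>2 > 333 / 5"
  shows "1 / (1 + (y - g)\<^sup>2) + 1 / (1 + (y + g)\<^sup>2) \<ge> 37 / 50 * (2 / g\<^sup>2)"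
proof -
  define A B where "A = 1 + (y - g)\<^sup>2" and "B = 1 + (y + g)\<^sup>2"
  have pos: "A > 0" "B > 0" by (auto simp: A_def B_def add_pos_nonneg)
  have AB: "A + B = 2 * (1 + y\<^sup>2 + g\<^sup>2)" by (simp add: A_def B_def power2_eq_square algebra_simps)
  have "4 * (A * B) \<le> (A + B) * (A + B)"
    using zero_le_power2[of "A - B"] by (simp add: power2_eq_square algebra_simps)
  then have "4 / (A + B) \<le> (A + B) / (A * B)" using pos by (simp add: divide_le_eq le_divide_eq field_simps)
  also have "\<dots> = 1 / A + 1 / B" using pos by (simp add: field_simps)
  finally have "4 / (A + B) \<le> 1 / A + 1 / B" .
  have 1: "2 / (1 + y\<^sup>2 + g\<^sup>2) \<le> 1 / A + 1 / B"
  proof -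
    have "4 / (2 * T) = 2 / T" for T :: real by simp
    with \<open>4 / (A + B) \<le> 1 / A + 1 / B\<close> show ?thesis unfolding AB by (simp only:)
  qed
  \<comment> \<open>\<open>G / (1 + Y + G)\<close> increases with \<open>G\<close> and equals
    \<open>3/4 - 1 / (4 * Y)\<close> at \<open>G = 3 * Y - 1\<close>; 37/50 lies just below
    3/4.\<close>
  have "37 / 50 * (1 + Y + G) \<le> G" if "3 * Y - 1 \<le> G" "Y > 333 / 5" for Y G :: real
    using that by simp
  from this[OF assms] have "37 / 50 * (1 + y\<^sup>2 + g\<^sup>2) \<le> g\<^sup>2" .
  moreover have "g\<^sup>2 > 0" "1 + y\<^sup>2 + g\<^sup>2 > 0" using assms by linarith+
  ultimately have "37 / 50 * (2 / g\<^sup>2) \<le> 2 / (1 + y\<^sup>2 + g\<^sup>2)"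
    by (simp add: field_simps)
  with 1 show ?thesis by (simp add: A_def B_def)
qed

text \<open>The middle \<open>Re w = 1\<close> is the worst case and gives equality: with
  \<open>e = Re w - 1\<close> the cross-multiplied difference is
  \<open>2 * e^2 * (3 * Y - 1 + e^2)\<close>.\<close>

lemma pole_terms_upper:
  fixes w :: complex
  assumes x: "0 \<le> Re w" "Re w \<le> 2" and y: "(Im w)\<^sup>2 \<ge> 1"
  shows "Re (1 / w - 1 / (w - 2)) \<le> 2 / (1 + (Im w)\<^sup>2)"
proof -
  define e Y where "e = Re w - 1" and "Y = (Im w)\<^sup>2"
  have e: "e\<^sup>2 \<le> 1" using x by (simp add: e_def abs_square_le_1)
  define P Q where "P = (1 + e)\<^sup>2 + Y" and "Q = (1 - e)\<^sup>2 + Y"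
  have Y: "Y \<ge> 1" using y by (simp add: Y_def)
  have pos: "P > 0" "Q > 0" using Y by (auto simp: P_def Q_def add_nonneg_pos)
  have "Re (1 / w - 1 / (w - 2)) = (1 + e) / P + (1 - e) / Q"
    by (simp add: Re_divide P_def Q_def e_def Y_def power2_eq_square minus_divide_left[symmetric])
      (simp add: algebra_simps minus_divide_left)
  also have "\<dots> = ((1 + e) * Q + (1 - e) * P) / (P * Q)" using pos by (simp add: field_simps)
  also have "\<dots> \<le> 2 / (1 + Y)"
  proof -
    have "2 * (P * Q) - ((1 + e) * Q + (1 - e) * P) * (1 + Y) = 2 * e\<^sup>2 * (3 * Y - 1 + e\<^sup>2)"
      by (simp add: P_def Q_def power2_eq_square algebra_simps)
    also have "\<dots> \<ge> 0" using Y by (intro mult_nonneg_nonneg) auto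
    finally have "((1 + e) * Q + (1 - e) * P) * (1 + Y) \<le> 2 * (P * Q)" by simp
    then show ?thesis using pos Y by (simp add: divide_le_eq le_divide_eq field_simps)
  qed
  finally show ?thesis by (simp add: Y_def)
qed

text \<open>Integrating a bound \<open>c * x\<close> for the derivative of
  \<open>ln (norm (Xi (x^2)))\<close> from 1/2 to 3/2, that is \<open>s = x + 1/2\<close> from 1 to
  2, gives exactly \<open>c\<close>, while the logarithm itself grows from 0 to
  \<open>ln (pi / 3)\<close>. The proof uses the squared modulus of
  \<open>Xi (x^2) * exp (- c * x^2 / 2)\<close>, which is nonincreasing, so no logarithm of
  \<open>Xi\<close> has to be chosen.\<close>

lemma Xi_sum_rule:
  assumes nz: "\<And>x::real. 1/2 \<le> x \<Longrightarrow> x \<le> 3/2 \<Longrightarrow> Xi (of_real (x\<^sup>2)) \<noteq> 0"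
    and c: "\<And>x::real. 1/2 \<le> x \<Longrightarrow> x \<le> 3/2 \<Longrightarrow>
         Re (2 * of_real x * (deriv Xi (of_real (x\<^sup>2)) / Xi (of_real (x\<^sup>2)))) \<le> c * x"
  shows "ln (pi / 3) \<le> c"
proof -
  define f where "f = (\<lambda>z. Xi (z\<^sup>2) * exp (- of_real c / 2 * z\<^sup>2))"
  define f' where "f' = (\<lambda>z. (2 * z * deriv Xi (z\<^sup>2)) * exp (- of_real c / 2 * z\<^sup>2)
      + Xi (z\<^sup>2) * (- of_real c * z * exp (- of_real c / 2 * z\<^sup>2)))"
  have dXi: "(Xi has_field_derivative deriv Xi w) (at w)" for w
    using holomorphic_derivI[OF Xi_entire] by auto
  have df: "(f has_field_derivative f' z) (at z)" for z
  proof -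
    have "((\<lambda>z. Xi (z\<^sup>2)) has_field_derivative (deriv Xi (z\<^sup>2) * (2 * z))) (at z)"
      by (rule DERIV_chain2[OF dXi]) (auto intro!: derivative_eq_intros)
    then show ?thesis unfolding f_def f'_def
      by (auto intro!: derivative_eq_intros simp: algebra_simps)
  qed
  define h where "h = (\<lambda>x::real. (Re (f (of_real x)))\<^sup>2 + (Im (f (of_real x)))\<^sup>2)"
  have dv: "((\<lambda>x. f (of_real x)) has_vector_derivative f' (of_real x)) (at x)" for x
    by (rule has_vector_derivative_real_field) (rule df)
  have dRe: "((\<lambda>x. Re (f (of_real x))) has_real_derivative Re (f' (of_real x))) (at x)"
   and dIm: "((\<lambda>x. Im (f (of_real x))) has_real_derivative Im (f' (of_real x))) (at x)" for x
    using bounded_linear.has_vector_derivative[OF bounded_linear_Re dv[of x]]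
      bounded_linear.has_vector_derivative[OF bounded_linear_Im dv[of x]]
    by (auto simp: has_real_derivative_iff_has_vector_derivative)
  have dh: "(h has_real_derivative 2 * (Re (f (of_real x)) * Re (f' (of_real x)) + Im (f (of_real x)) * Im (f' (of_real x)))) (at x)" for x
    unfolding h_def by (rule derivative_eq_intros dRe dIm refl)+ (simp add: algebra_simps)
  have "h (3/2) \<le> h (1/2)"
  proof (rule DERIV_nonpos_imp_nonincreasing[where f = h])
    fix x :: real assume x: "1/2 \<le> x" "x \<le> 3/2"
    define F where "F = f (of_real x)"
    have ff: "f' (of_real x) = F * (2 * of_real x * (deriv Xi (of_real (x\<^sup>2)) / Xi (of_real (x\<^sup>2))) - of_real (c * x))"
      using nz[OF x] by (simp add: f'_def F_def f_def field_simps)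
    define r where "r = 2 * of_real x * (deriv Xi (of_real (x\<^sup>2)) / Xi (of_real (x\<^sup>2))) - of_real (c * x)"
    have "Re r \<le> 0" using c[OF x] by (simp add: r_def)
    have "Re F * Re (F * r) + Im F * Im (F * r) = ((Re F)\<^sup>2 + (Im F)\<^sup>2) * Re r"
      by (simp add: power2_eq_square algebra_simps)
    also have "\<dots> \<le> 0" using \<open>Re r \<le> 0\<close> by (intro mult_nonneg_nonpos) auto
    finally have "2 * (Re F * Re (F * r) + Im F * Im (F * r)) \<le> 0" by simp
    moreover have "(h has_real_derivative 2 * (Re F * Re (F * r) + Im F * Im (F * r))) (at x)"
      using dh[of x] unfolding F_def[symmetric] ff r_def[symmetric] .
    ultimately show "\<exists>y. (h has_real_derivative y) (at x) \<and> y \<le> 0" by blast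
  qed simp
  moreover have "h x = (norm (Xi (of_real (x\<^sup>2))))\<^sup>2 * exp (- c * x\<^sup>2)" for x
  proof -
    have "h x = (norm (f (of_real x)))\<^sup>2" unfolding h_def by (simp add: cmod_power2)
    also have "norm (f (of_real x)) = norm (Xi (of_real (x\<^sup>2))) * exp (- c / 2 * x\<^sup>2)"
      by (simp add: f_def norm_mult)
    also have "\<dots>\<^sup>2 = (norm (Xi (of_real (x\<^sup>2))))\<^sup>2 * exp (- c * x\<^sup>2)"
      by (simp add: power_mult_distrib exp_double[symmetric])
    finally show ?thesis .
  qed
  ultimately have "(pi / 3)\<^sup>2 * exp (- c * (3/2)\<^sup>2) \<le> exp (- c * (1/2)\<^sup>2)"
    using Xi_quarter Xi_nine_quarters by (simp add: power2_eq_square)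
  then have "ln ((pi / 3)\<^sup>2 * exp (- c * (3/2)\<^sup>2)) \<le> ln (exp (- c * (1/2)\<^sup>2))"
    by (subst ln_le_cancel_iff) auto
  moreover have "ln ((pi / 3)\<^sup>2 * exp e) = 2 * ln (pi / 3) + e" for e
    by (subst ln_mult) (auto simp: ln_realpow simp del: power_divide)
  ultimately show ?thesis by (simp add: power2_eq_square)
qed


text \<open>Both \<open>L\<close> and \<open>Q\<close> are independent of \<open>R\<close>, so
  truncation errors disappear in the limit without any convergence statement about the sums over
  zeros.\<close>

lemma le_of_powr_error:
  fixes L D Q R0 :: real
  assumes "\<And>R. R \<ge> R0 \<Longrightarrow> L - D * R powr (-1/4) \<le> Q"
  shows "L \<le> Q"
proof -
  have "((\<lambda>R::real. R powr (-1/4)) \<longlongrightarrow> 0) at_top"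
    by (rule tendsto_neg_powr) (auto intro: filterlim_ident)
  then have lim: "((\<lambda>R::real. L - D * R powr (-1/4)) \<longlongrightarrow> L - D * 0) at_top"
    by (intro tendsto_intros)
  have ev: "eventually (\<lambda>R. L - D * R powr (-1/4) \<le> Q) at_top"
    using eventually_ge_at_top[of R0] by eventually_elim (rule assms)
  show ?thesis using tendsto_upperbound[OF lim ev] by simp
qed

lemma Re_log_deriv_error:
  fixes m :: "complex \<Rightarrow> nat" and z L :: complex
  assumes "norm (L - (\<Sum>v\<in>Z. of_nat (m v) / (z\<^sup>2 - v))) \<le> e"
  shows "\<bar>Re (2 * z * L) - (\<Sum>v\<in>Z. real (m v) * Re (2 * z / (z\<^sup>2 - v)))\<bar> \<le> 2 * norm z * e"
proof -
  have "(\<Sum>v\<in>Z. real (m v) * Re (2 * z / (z\<^sup>2 - v))) = Re (\<Sum>v\<in>Z. of_nat (m v) * (2 * z / (z\<^sup>2 - v)))"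
  proof -
    have "Re (of_nat n * w) = real n * Re w" for n and w :: complex by simp
    then show ?thesis by (simp only: Re_sum)
  qed
  also have "(\<Sum>v\<in>Z. of_nat (m v) * (2 * z / (z\<^sup>2 - v))) = 2 * z * (\<Sum>v\<in>Z. of_nat (m v) / (z\<^sup>2 - v))"
    by (simp add: sum_distrib_left mult_ac)
  finally have "Re (2 * z * L) - (\<Sum>v\<in>Z. real (m v) * Re (2 * z / (z\<^sup>2 - v)))
      = Re (2 * z * (L - (\<Sum>v\<in>Z. of_nat (m v) / (z\<^sup>2 - v))))"
    by (simp add: right_diff_distrib)
  also have "\<bar>\<dots>\<bar> \<le> norm (2 * z * (L - (\<Sum>v\<in>Z. of_nat (m v) / (z\<^sup>2 - v))))"
    by (rule abs_Re_le_cmod)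
  also have "\<dots> \<le> 2 * norm z * e"
    unfolding norm_mult using assms by (intro mult_mono) auto
  finally show ?thesis .
qed

text \<open>The multiplicities depend on \<open>R\<close>, so the lower bound for \<open>Q\<close>
  and the sum rule are derived for one and the same \<open>R\<close> and \<open>m\<close> (in
  \<open>Qlow\<close>), combined term by term there, and only then is \<open>R\<close> sent to
  infinity.\<close>

lemma Xi_log_deriv_lower:
  fixes z1 z2 :: complex
  assumes zeros: "\<And>v. Xi v = 0 \<Longrightarrow> \<exists>G>0. v = of_real (- G)"
    and z: "0 \<le> Re z1" "0 \<le> Re z2" "Re z1 + Re z2 = 1" "Im z2 = - Im z1"
    and nz: "Xi (z1\<^sup>2) \<noteq> 0" "Xi (z2\<^sup>2) \<noteq> 0" and y: "(Im z1)\<^sup>2 > 333 / 5"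
  shows "Re (2 * z1 * (deriv Xi (z1\<^sup>2) / Xi (z1\<^sup>2)) + 2 * z2 * (deriv Xi (z2\<^sup>2) / Xi (z2\<^sup>2)))
          > 2 / (1 + (Im z1)\<^sup>2)"
proof -
  define Lg where "Lg = (\<lambda>v. deriv Xi v / Xi v)"
  define Q where "Q = Re (2 * z1 * Lg (z1\<^sup>2) + 2 * z2 * Lg (z2\<^sup>2))"
  define k where "k = (\<lambda>v. Re (2 * z1 / (z1\<^sup>2 - v)) + Re (2 * z2 / (z2\<^sup>2 - v)))"
  define Z where "Z = (\<lambda>R. {a\<in>cball 0 R. Xi a = 0})"
  define y where "y = Im z1"
  obtain K where K: "K \<ge> 0" and KR: "\<And>R. R \<ge> 1 \<Longrightarrow> finite (Z R) \<and>
     (\<exists>m::complex \<Rightarrow> nat. (\<forall>a\<in>Z R. m a \<ge> 1) \<and>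
       (\<forall>z. norm z \<le> R / 2 \<longrightarrow> Xi z \<noteq> 0 \<longrightarrow>
          norm (Lg z - (\<Sum>a\<in>Z R. of_nat (m a) / (z - a))) \<le> K * R powr (-1/4)))"
    using log_deriv_partial_fractions[OF Xi_entire Xi_0_nonzero, of 4] Xi_growth unfolding Z_def Lg_def by auto
  \<comment> \<open>The partial fractions hold on the disc of radius \<open>R / 2\<close>. The 5
    brings in the points \<open>x^2 <= 9/4\<close> of the sum rule, the other entries
    \<open>z1^2\<close> and \<open>z2^2\<close>.\<close>
  define R0 where "R0 = max 5 (max (2 * norm (z1\<^sup>2)) (2 * norm (z2\<^sup>2)))"
  define C where "C = (2 * norm z1 + 2 * norm z2) * K"
  have kernel: "k v \<ge> 1 / (1 + (y - sqrt G)\<^sup>2) + 1 / (1 + (y + sqrt G)\<^sup>2)"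
    if "Xi v = 0" "v = of_real (- G)" "G > 0" for v G
  proof -
    have "z1\<^sup>2 + of_real ((sqrt G)\<^sup>2) \<noteq> 0" "z2\<^sup>2 + of_real ((sqrt G)\<^sup>2) \<noteq> 0"
      using that nz by (auto simp: add_eq_0_iff2)
    from double_pair_kernel_lower[OF z this] show ?thesis
      using that by (simp add: k_def y_def)
  qed
  have kpos: "k v \<ge> 0" if "Xi v = 0" for v
  proof -
    obtain G where G: "G > 0" "v = of_real (- G)" using zeros \<open>Xi v = 0\<close> by blast
    have "0 \<le> 1 / (1 + (y - sqrt G)\<^sup>2) + 1 / (1 + (y + sqrt G)\<^sup>2)" by (intro add_nonneg_nonneg) auto
    then show ?thesis using kernel[OF that G(2,1)] by linarith
  qed
  have Qlow: "\<exists>m::complex \<Rightarrow> nat. (\<forall>a\<in>Z R. m a \<ge> 1) \<and> (\<Sum>v\<in>Z R. real (m v) * k v) - C * R powr (-1/4) \<le> Q \<and>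
      ln (pi / 3) \<le> (\<Sum>v\<in>Z R. real (m v) * (2 / (- Re v))) + 2 * K * R powr (-1/4)"
    if R: "R \<ge> R0" for R
  proof -
    have R1: "R \<ge> 5" "norm (z1\<^sup>2) \<le> R / 2" "norm (z2\<^sup>2) \<le> R / 2" using R by (auto simp: R0_def)
    obtain m where fin: "finite (Z R)" and m: "\<And>a. a \<in> Z R \<Longrightarrow> m a \<ge> (1::nat)"
      and err: "\<And>z. norm z \<le> R / 2 \<Longrightarrow> Xi z \<noteq> 0 \<Longrightarrow>
          norm (Lg z - (\<Sum>a\<in>Z R. of_nat (m a) / (z - a))) \<le> K * R powr (-1/4)"
      using KR[of R] R1 by auto
    have "(\<Sum>v\<in>Z R. real (m v) * k v) = (\<Sum>v\<in>Z R. real (m v) * Re (2 * z1 / (z1\<^sup>2 - v)))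
        + (\<Sum>v\<in>Z R. real (m v) * Re (2 * z2 / (z2\<^sup>2 - v)))"
      by (simp only: k_def distrib_left sum.distrib)
    moreover have "\<bar>Re (2 * z1 * Lg (z1\<^sup>2)) - (\<Sum>v\<in>Z R. real (m v) * Re (2 * z1 / (z1\<^sup>2 - v)))\<bar>
        \<le> 2 * norm z1 * (K * R powr (-1/4))"
      by (intro Re_log_deriv_error err R1 nz)
    moreover have "\<bar>Re (2 * z2 * Lg (z2\<^sup>2)) - (\<Sum>v\<in>Z R. real (m v) * Re (2 * z2 / (z2\<^sup>2 - v)))\<bar>
        \<le> 2 * norm z2 * (K * R powr (-1/4))"
      by (intro Re_log_deriv_error err R1 nz)
    moreover have "C * R powr (-1/4) = 2 * norm z1 * (K * R powr (-1/4)) + 2 * norm z2 * (K * R powr (-1/4))"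
      by (simp add: C_def algebra_simps)
    moreover have "Q = Re (2 * z1 * Lg (z1\<^sup>2)) + Re (2 * z2 * Lg (z2\<^sup>2))" by (simp only: Q_def plus_complex.sel)
    ultimately have 1: "(\<Sum>v\<in>Z R. real (m v) * k v) - C * R powr (-1/4) \<le> Q" by linarith
    define A where "A = (\<Sum>v\<in>Z R. real (m v) * (2 / (- Re v)))"
    have "ln (pi / 3) \<le> A + 2 * (K * R powr (-1/4))"
    proof (rule Xi_sum_rule)
      fix x :: real assume x: "1/2 \<le> x" "x \<le> 3/2"
      show nzx: "Xi (of_real (x\<^sup>2)) \<noteq> 0"
      proof
        assume "Xi (of_real (x\<^sup>2)) = 0"
        then obtain G where "G > 0" "complex_of_real (x\<^sup>2) = of_real (- G)" using zeros by blast
        then have "x\<^sup>2 = - G" by (simp only: of_real_eq_iff)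
        then show False using \<open>G > 0\<close> zero_le_power2[of x] by linarith
      qed
      have "x\<^sup>2 \<le> (3/2)\<^sup>2" using x by (intro power_mono) auto
      then have "norm (complex_of_real (x\<^sup>2)) \<le> R / 2"
        using R1 by (simp add: power2_eq_square norm_mult)
      from Re_log_deriv_error[of "Lg (of_real (x\<^sup>2))" m "of_real x" "Z R" "K * R powr (-1/4)"] err[OF this nzx]
      have "Re (2 * of_real x * Lg (of_real (x\<^sup>2))) \<le>
         (\<Sum>v\<in>Z R. real (m v) * Re (2 * of_real x / ((of_real x)\<^sup>2 - v))) + 2 * norm (complex_of_real x) * (K * R powr (-1/4))"
        by simp
      also have "\<dots> \<le> x * A + 2 * x * (K * R powr (-1/4))"
      proof (intro add_mono)
        have "(\<Sum>v\<in>Z R. real (m v) * Re (2 * of_real x / ((of_real x)\<^sup>2 - v))) \<le>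
           (\<Sum>v\<in>Z R. x * (real (m v) * (2 / (- Re v))))"
        proof (rule sum_mono)
          fix v assume "v \<in> Z R"
          then obtain G where G: "G > 0" "v = of_real (- G)" using zeros by (auto simp: Z_def)
          have "2 * of_real x / ((of_real x)\<^sup>2 - v) = complex_of_real (2 * x / (x\<^sup>2 + G))"
            using G by simp
          then have "Re (2 * of_real x / ((of_real x)\<^sup>2 - v)) = 2 * x / (x\<^sup>2 + G)"
            by (simp only: Re_complex_of_real)
          \<comment> \<open>Dropping \<open>x^2\<close> beside \<open>G\<close> makes the bound
            linear in \<open>x\<close>, the form required by \<open>Xi_sum_rule\<close>.\<close>
          also have "\<dots> \<le> 2 * x / G" using G x by (intro divide_left_mono) (auto intro!: mult_pos_pos add_nonneg_pos)
          finally have "real (m v) * Re (2 * of_real x / ((of_real x)\<^sup>2 - v)) \<le> real (m v) * (2 * x / G)"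
            by (intro mult_left_mono) auto
          then show "real (m v) * Re (2 * of_real x / ((of_real x)\<^sup>2 - v)) \<le> x * (real (m v) * (2 / (- Re v)))"
            using G by (simp add: mult_ac)
        qed
        then show "(\<Sum>v\<in>Z R. real (m v) * Re (2 * of_real x / ((of_real x)\<^sup>2 - v))) \<le> x * A"
          by (simp add: A_def sum_distrib_left)
      qed (use x in auto)
      finally show "Re (2 * of_real x * (deriv Xi (of_real (x\<^sup>2)) / Xi (of_real (x\<^sup>2)))) \<le> (A + 2 * (K * R powr (-1/4))) * x"
        unfolding Lg_def by (simp add: algebra_simps)
    qed
    then show ?thesis using 1 m by (intro exI[of _ m]) (auto simp: A_def)
  qed
  show ?thesis
  proof (cases "\<exists>v. Xi v = 0 \<and> - Re v < 3 * y\<^sup>2 - 1")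
    case True
    then obtain v where v: "Xi v = 0" "- Re v < 3 * y\<^sup>2 - 1" by auto
    obtain G where G: "G > 0" "v = of_real (- G)" using zeros[OF v(1)] by auto
    have "k v \<le> Q"
    proof (rule le_of_powr_error[of "max R0 (norm v)"])
      fix R assume R: "R \<ge> max R0 (norm v)"
      then obtain m where m: "\<forall>a\<in>Z R. m a \<ge> (1::nat)"
        and Q: "(\<Sum>v\<in>Z R. real (m v) * k v) - C * R powr (-1/4) \<le> Q" using Qlow[of R] by auto
      have vZ: "v \<in> Z R" using R v by (simp add: Z_def)
      have "R \<ge> 1" using R by (simp add: R0_def)
      then have fin: "finite (Z R)" using KR by blast
      have "1 * k v \<le> real (m v) * k v" using m vZ kpos[OF v(1)] by (intro mult_right_mono) auto
      also have "\<dots> \<le> (\<Sum>v\<in>Z R. real (m v) * k v)"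
        using kpos by (intro member_le_sum[OF vZ _ fin]) (auto simp: Z_def)
      finally show "k v - C * R powr (-1/4) \<le> Q" using Q by simp
    qed
    moreover have "2 / (1 + y\<^sup>2) < k v"
    proof -
      have "2 / (1 + y\<^sup>2) < 1 / (1 + (y - sqrt G)\<^sup>2) + 1 / (1 + (y + sqrt G)\<^sup>2)"
        using v(2) G by (intro kernel_near) auto
      then show ?thesis using kernel[OF v(1) G(2,1)] by linarith
    qed
    ultimately show ?thesis by (simp add: Q_def Lg_def y_def)
  next
    case False
    have "37 / 50 * ln (pi / 3) \<le> Q"
    proof (rule le_of_powr_error)
      fix R assume R: "R \<ge> R0"
      then obtain m where Q: "(\<Sum>v\<in>Z R. real (m v) * k v) - C * R powr (-1/4) \<le> Q"
        and S: "ln (pi / 3) \<le> (\<Sum>v\<in>Z R. real (m v) * (2 / (- Re v))) + 2 * K * R powr (-1/4)"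
        using Qlow[of R] by auto
      have "37 / 50 * (\<Sum>v\<in>Z R. real (m v) * (2 / (- Re v))) = (\<Sum>v\<in>Z R. real (m v) * (37 / 50 * (2 / (- Re v))))"
        by (simp only: sum_distrib_left mult.left_commute)
      also have "\<dots> \<le> (\<Sum>v\<in>Z R. real (m v) * k v)"
      proof (intro sum_mono mult_left_mono)
        fix v assume "v \<in> Z R"
        then have v: "Xi v = 0" by (simp add: Z_def)
        then obtain G where G: "G > 0" "v = of_real (- G)" using zeros by blast
        have "37 / 50 * (2 / (sqrt G)\<^sup>2) \<le> 1 / (1 + (y - sqrt G)\<^sup>2) + 1 / (1 + (y + sqrt G)\<^sup>2)"
          using False v G y by (intro kernel_far) (auto simp: y_def not_less)
        then show "37 / 50 * (2 / (- Re v)) \<le> k v" using kernel[OF v G(2,1)] G by simp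
      qed auto
      finally show "37 / 50 * ln (pi / 3) - (37 / 25 * K + C) * R powr (-1/4) \<le> Q"
        using Q S by (simp add: algebra_simps)
    qed
    moreover have "2 / (1 + y\<^sup>2) < 37 / 50 * ln (pi / 3)"
    proof -
      \<comment> \<open>The poles cost less than \<open>2 / (1 + 333/5) = 2 / 67.6\<close>, about
        0.0296. By \<open>ln x <= x - 1\<close> at \<open>3 / pi\<close> the zeros give at least
        \<open>37/50 * (1 - 3 / 3.14)\<close>, about 0.0330.\<close>
      have "3 / pi \<le> 3 / 3.14" using pi_approx by (intro divide_left_mono) auto
      moreover have "ln (3 / pi) \<le> 3 / pi - 1" by (rule ln_le_minus_one) auto
      moreover have "ln (3 / pi) = - ln (pi / 3)" by (simp add: ln_div)
      ultimately have "ln (pi / 3) \<ge> 1 - 3 / 3.14" by linarith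
      moreover have "2 / (1 + y\<^sup>2) \<le> 2 / 67.6"
        using assms(8) by (intro divide_left_mono) (auto simp: y_def add_pos_nonneg)
      ultimately show ?thesis by simp
    qed
    ultimately show ?thesis by (simp add: Q_def Lg_def y_def)
  qed
qed


section \<open>The quotient \<open>U\<close> and its logarithmic derivative\<close>

lemma half_notin_nonpos_Ints: "Im s \<noteq> 0 \<Longrightarrow> s / 2 \<notin> \<int>\<^sub>\<le>\<^sub>0"
  by (auto elim!: nonpos_Ints_cases simp: complex_eq_iff)

text \<open>Numerator and denominator of \<open>U\<close> share the factor \<open>2 * s - 1\<close>
  from the poles of \<open>xi1\<close>; after its cancellation only \<open>s / (s - 1)\<close>
  accompanies \<open>Xi\<close>.\<close>

lemma U_eq:
  assumes "Im s > 0"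
  shows "U s = (Xi ((2 * s - 3/2)\<^sup>2) * s) / (Xi ((2 * s - 1/2)\<^sup>2) * (s - 1))"
proof -
  have s1: "s \<noteq> 1" "2 * s \<noteq> 1" using assms by (auto simp: complex_eq_iff)
  have 1: "xi1 (2 * s - 1) = Xi ((2 * s - 3/2)\<^sup>2) / ((2 * s - 1) * (2 * s - 1 - 1))"
    using xi1_eq[of "2 * s - 1"] half_notin_nonpos_Ints[of "2 * s - 1"] assms s1 by (auto simp: diff_diff_eq)
  have 2: "xi1 (2 * s) = Xi ((2 * s - 1/2)\<^sup>2) / (2 * s * (2 * s - 1))"
    using xi1_eq[of "2 * s"] half_notin_nonpos_Ints[of "2 * s"] assms s1 by auto
  have e: "2 * s - 1 - 1 = 2 * (s - 1)" by simp
  have nz: "2 * s - 1 \<noteq> 0" "s \<noteq> 0" "s - 1 \<noteq> 0" using assms by (auto simp: complex_eq_iff)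
  have "X / (p * (2 * q)) / (Y / (2 * s * p)) = (X * s) / (Y * q)" if "p \<noteq> 0" "q \<noteq> 0" for X Y p q :: complex
    using that nz(2) by (simp add: field_simps)
  from this[OF nz(1,3)] show ?thesis unfolding U_def 1 2 e .
qed

lemma log_deriv_U:
  assumes s: "Im s > 0" and nz: "Xi ((2 * s - 3/2)\<^sup>2) \<noteq> 0" "Xi ((2 * s - 1/2)\<^sup>2) \<noteq> 0"
  defines "Lg \<equiv> (\<lambda>v. deriv Xi v / Xi v)"
  shows "deriv U s / U s = 4 * (2 * s - 3/2) * Lg ((2 * s - 3/2)\<^sup>2) - 4 * (2 * s - 1/2) * Lg ((2 * s - 1/2)\<^sup>2)
           + 1 / s - 1 / (s - 1)"
proof -
  define A B where "A = Xi ((2 * s - 3/2)\<^sup>2)" and "B = Xi ((2 * s - 1/2)\<^sup>2)"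
  define A' B' where "A' = 4 * (2 * s - 3/2) * deriv Xi ((2 * s - 3/2)\<^sup>2)"
    and "B' = 4 * (2 * s - 1/2) * deriv Xi ((2 * s - 1/2)\<^sup>2)"
  have ABnz: "A \<noteq> 0" "B \<noteq> 0" using nz by (auto simp: A_def B_def)
  have s0: "s \<noteq> 0" "s - 1 \<noteq> 0" using s by (auto simp: complex_eq_iff)
  have dXi: "(Xi has_field_derivative deriv Xi w) (at w)" for w
    using holomorphic_derivI[OF Xi_entire] by auto
  have dA: "((\<lambda>s. Xi ((2 * s - c)\<^sup>2)) has_field_derivative (4 * (2 * s - c) * deriv Xi ((2 * s - c)\<^sup>2))) (at s)" for c
  proof -
    have "((\<lambda>s. (2 * s - c)\<^sup>2) has_field_derivative (4 * (2 * s - c))) (at s)"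
      by (auto intro!: derivative_eq_intros)
    from DERIV_chain2[OF dXi this] show ?thesis by (simp add: mult.commute)
  qed
  have "((\<lambda>s. (Xi ((2 * s - 3/2)\<^sup>2) * s) / (Xi ((2 * s - 1/2)\<^sup>2) * (s - 1))) has_field_derivative
     ((A' * s + 1 * A) * (B * (s - 1)) - (A * s) * (B' * (s - 1) + (1 - 0) * B)) / ((B * (s - 1)) * (B * (s - 1)))) (at s)"
    unfolding A_def B_def A'_def B'_def
    by (rule DERIV_divide DERIV_mult DERIV_ident DERIV_diff DERIV_const dA)+ (use nz s0 in auto)
  then have "(U has_field_derivative
     ((A' * s + 1 * A) * (B * (s - 1)) - (A * s) * (B' * (s - 1) + (1 - 0) * B)) / ((B * (s - 1)) * (B * (s - 1)))) (at s)"
    by (rule has_field_derivative_transform_within_open[where S = "{s. Im s > 0}"])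
      (use s in \<open>auto simp: U_eq open_halfspace_Im_gt\<close>)
  then have "deriv U s = ((A' * s + 1 * A) * (B * (s - 1)) - (A * s) * (B' * (s - 1) + (1 - 0) * B)) / ((B * (s - 1)) * (B * (s - 1)))"
    by (rule DERIV_imp_deriv)
  moreover have "U s = (A * s) / (B * (s - 1))" unfolding A_def B_def by (rule U_eq[OF s])
  moreover have "((A' * s + 1 * A) * (B * t) - (A * s) * (B' * t + (1 - 0) * B)) / ((B * t) * (B * t)) / ((A * s) / (B * t))
     = A' / A - B' / B + 1 / s - 1 / t" if "t \<noteq> 0" for t
    using that ABnz s0 by (simp add: divide_simps) (simp add: algebra_simps)
  ultimately have "deriv U s / U s = A' / A - B' / B + 1 / s - 1 / (s - 1)" using s0(2) by (simp only:)
  then show ?thesis by (simp add: Lg_def A_def B_def A'_def B'_def)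
qed

theorem theorem8:
  fixes s :: complex
  assumes prop1: "\<forall>\<rho>. riemann_zeta \<rho> = 0 \<and> 0 < Re \<rho> \<and> Re \<rho> < 1 \<longrightarrow>
                     Re ((\<rho> + 1) / 2) = 3 / 4 \<and> Re (\<rho> / 2) = 1 / 4"
    and "1 / 4 \<le> Re s" and "Re s \<le> 3 / 4" and "Im s > 4.08046"
    and "xi1 (2 * s - 1) \<noteq> 0" and "xi1 (2 * s) \<noteq> 0"
  shows "Re (deriv U s / U s) < 0"
proof -
  have Im: "Im s > 0" using assms(4) by simp
  then have s1: "s \<noteq> 1" "2 * s \<noteq> 1" by (auto simp: complex_eq_iff)
  \<comment> \<open>\<open>Xi\<close> sees only the squares, so the sign of \<open>z2\<close> is
    free. This sign makes both real parts nonnegative for \<open>1/4 <= Re s <= 3/4\<close> with sum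
    1, and the imaginary parts opposite.\<close>
  define z1 z2 where "z1 = 2 * s - 1/2" and "z2 = 3/2 - 2 * s"
  have zeros: "\<exists>G>0. v = of_real (- G)" if "Xi v = 0" for v
  proof (rule Xi_zero_real_negative[OF _ that])
    fix \<rho> assume "riemann_zeta \<rho> = 0" "0 < Re \<rho>" "Re \<rho> < 1"
    then show "Re \<rho> = 1 / 2" using prop1 by auto
  qed
  have z2sq: "(2 * s - 3/2)\<^sup>2 = z2\<^sup>2" by (simp add: z2_def power2_commute)
  have nz2: "Xi (z2\<^sup>2) \<noteq> 0"
    using xi1_eq[of "2 * s - 1"] half_notin_nonpos_Ints[of "2 * s - 1"] assms(5) Im s1
    by (auto simp: diff_diff_eq z2sq)
  have nz1: "Xi (z1\<^sup>2) \<noteq> 0"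
    using xi1_eq[of "2 * s"] half_notin_nonpos_Ints[of "2 * s"] assms(6) Im s1 by (auto simp: z1_def)
  have y: "(Im z1)\<^sup>2 > 333 / 5"
  proof -
    \<comment> \<open>\<open>Im z1 = 2 * Im s\<close> and \<open>8.16092 = 2 * 4.08046\<close>; its
      square, about 66.6006, just exceeds \<open>333/5 = 66.6\<close>.\<close>
    have "(8.16092::real)\<^sup>2 < (Im z1)\<^sup>2"
      using assms(4) by (intro power_strict_mono) (auto simp: z1_def)
    then show ?thesis by (simp add: power2_eq_square)
  qed
  define L1 L2 where "L1 = deriv Xi (z1\<^sup>2) / Xi (z1\<^sup>2)" and "L2 = deriv Xi (z2\<^sup>2) / Xi (z2\<^sup>2)"
  have low: "Re (2 * z1 * L1 + 2 * z2 * L2) > 2 / (1 + (Im z1)\<^sup>2)"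
    unfolding L1_def L2_def
    by (rule Xi_log_deriv_lower[OF zeros _ _ _ _ nz1 nz2 y]) (use assms(2,3) in \<open>auto simp: z1_def z2_def\<close>)
  have up: "Re (1 / (2 * s) - 1 / (2 * s - 2)) \<le> 2 / (1 + (Im z1)\<^sup>2)"
    using pole_terms_upper[of "2 * s"] assms(2,3) y by (simp add: z1_def)
  \<comment> \<open>The negative sign of \<open>z2\<close> turns the difference of the two
    \<open>Xi\<close> terms into minus a sum, so that \<open>up\<close> and \<open>low\<close>
    compare directly.\<close>
  have "deriv U s / U s = 2 * ((1 / (2 * s) - 1 / (2 * s - 2)) - (2 * z1 * L1 + 2 * z2 * L2))"
  proof -
    have U: "deriv U s / U s = 4 * (2 * s - 3/2) * L2 - 4 * z1 * L1 + 1 / s - 1 / (s - 1)"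
      using log_deriv_U[OF Im] nz1 nz2 by (simp add: z2sq L1_def L2_def z1_def)
    have p: "1 / s = 2 * (1 / (2 * s))" by simp
    have q: "1 / (s - 1) = 2 * (1 / (2 * s - 2))"
    proof -
      have "1 / t = 2 * (1 / (2 * t))" for t :: complex by simp
      from this[of "s - 1"] show ?thesis by (simp only: right_diff_distrib mult_1_right)
    qed
    have z2: "2 * s - 3/2 = - z2" by (simp add: z2_def)
    have "4 * (- z2) * L2 - 4 * z1 * L1 + 2 * p - 2 * q = 2 * ((p - q) - (2 * z1 * L1 + 2 * z2 * L2))" for p q
      by (simp add: algebra_simps)
    then show ?thesis unfolding U z2 p q .
  qed
  moreover have "Re (2 * (p - q)) = 2 * (Re p - Re q)" for p q by simp
  ultimately have eq: "Re (deriv U s / U s) = 2 * (Re (1 / (2 * s) - 1 / (2 * s - 2)) - Re (2 * z1 * L1 + 2 * z2 * L2))"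
    by (simp only:)
  have "2 * (p - q) < 0" if "p < q" for p q :: real using that by simp
  from this[OF le_less_trans[OF up low]] show ?thesis unfolding eq .
qed

end
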